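(* Let $E$ be a product system over a unital $C^*$-algebra $\mathcal B$ admitting at least one continuous unit, let $\omega$ be a continuous unit on $E$, and let $\mathcal U=\mathcal U_\omega$ be the maximal continuous set of units containing $\omega$. Define on $\mathcal U$ $$x+y=x\boxplus y\boxplus(-\omega),\qquad b\cdot x=bx\boxplus(1-b)\omega,\qquad x\cdot b=xb\boxplus\omega(1-b)\qquad(x,y\in\mathcal U,\ b\in\mathcal B),$$ and define $x\approx y$ if and only if $x=y^\beta$ for some $\beta\in\mathcal B$. Then: (a) With these operations $\mathcal U$ is a (algebraic) left-right $\mathcal B$-$\mathcal B$ module. (b) The relation $\approx$ is an equivalence relation on $\mathcal U$ and it is compatible with all algebraic operations of $\mathcal U$, i.e. for all $b\in\mathcal B$ and units in $\mathcal U$: $$x\approx y\ \Longrightarrow\ x\cdot b\approx y\cdot b\ \text{ and }\ b\cdot x\approx b\cdot y,$$ $$x^1\approx x^2,\ y^1\approx y^2\ \Longrightarrow\ x^1+y^1\approx x^2+y^2.$$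
   Context: $\mathcal B$ is a unital $C^*$-algebra with unit $1$. A Hilbert $\mathcal B$-$\mathcal B$ module is a right Hilbert $\mathcal B$-module (inner product $\mathcal B$-valued, linear in the second variable) with a unital left action of $\mathcal B$ by adjointable operators. A product system over $\mathcal B$ is a family $E=(E_t)_{t\ge0}$ of Hilbert $\mathcal B$-$\mathcal B$ modules with $E_0\cong\mathcal B$ and (associative) bilinear unitary isomorphisms $\varphi_{t,s}:E_t\otimes E_s\to E_{t+s}$, where $\otimes$ is the inner tensor product over $\mathcal B$ with $\langle u\otimes v,u_1\otimes v_1\rangle=\langle v,\langle u,u_1\rangle v_1\rangle$; one identifies $E_t\otimes E_s$ with $E_{t+s}$. A unit on $E$ is a family $u=(u_t)_{t\ge0}$, $u_t\in E_t$, with $u_0=1$ and $u_t\otimes u_s=u_{t+s}$. For units $u,v$ put $\mathcal K^{u,v}_t(b)=\langle u_t,bv_t\rangle$; these are bounded linear operators on $\mathcal B$ forming a semigroup in $t$. A set $S$ of units is continuous if for all $\xi,\eta\in S$ the semigroup $\mathcal K_t^{\xi,\eta}$ is uniformly continuous (continuous in the norm of $L(\mathcal B)$); then $\mathcal L^{\xi,\eta}=\frac{d}{dt}\mathcal K^{\xi,\eta}_t|_{t=0}\in L(\mathcal B)$ and $\mathcal K^{\xi,\eta}_t=\exp(t\mathcal L^{\xi,\eta})$. A unit $u$ is continuous if $\{u\}$ is continuous. For a continuous unit $\omega$, $\mathcal U_\omega$ is the set of all continuous units $x$ such that $\{x,\omega\}$ is a continuous set; it is the maximal continuous set of units containing $\omega$.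 For $x^1,\dots,x^n\in\mathcal U_\omega$ and $\varkappa_1,\dots,\varkappa_n\in\mathcal B$ with $\sum_j\varkappa_j=1$, $\varkappa_1x^1\boxplus\dots\boxplus\varkappa_nx^n$ denotes the unit $\zeta$ with $\zeta_t=\lim_{m\to\infty}\big(\sum_j\varkappa_jx^j_{t/m}\big)^{\otimes m}$ (norm limit), and $x^1\varkappa_1\boxplus\dots\boxplus x^n\varkappa_n$ the unit obtained from $\sum_jx^j_{t/m}\varkappa_j$ in the same way. For $x\in\mathcal U_\omega$, $\beta\in\mathcal B$, $x^\beta$ is the unit with $x^\beta_t=\lim_{m\to\infty}\big(x_{t/m}e^{\beta t/m}\big)^{\otimes m}$. It is known that these limits exist and the units belong to $\mathcal U_\omega$. For all $\xi\in\mathcal U_\omega$, $a,c\in\mathcal B$, the kernels are $\mathcal L^{x+y,\xi}=\mathcal L^{x,\xi}+\mathcal L^{y,\xi}-\mathcal L^{\omega,\xi}$, $\mathcal L^{x\cdot a,\xi}(c)=a^*\mathcal L^{x,\xi}(c)+(1-a)^*\mathcal L^{\omega,\xi}(c)$, $\mathcal L^{a\cdot x,\xi}(c)=\mathcal L^{x,\xi}(a^*c)+\mathcal L^{\omega,\xi}((1-a^* )c)$, $\mathcal L^{x^\beta,\xi}(c)=\mathcal L^{x,\xi}(c)+\beta^*c$, $\mathcal L^{x^\beta,x^\beta}(c)=\mathcal L^{x,x}(c)+\beta^*c+c\beta$. *)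

theory Defs
  imports "HOL-Analysis.Analysis"
begin

section \<open>Unital C*-algebras\<close>

class cstar_algebra = real_normed_algebra_1 + banach +
  fixes scaleC :: "complex \<Rightarrow> 'a \<Rightarrow> 'a" (infixr "*\<^sub>C" 75)
    and star :: "'a \<Rightarrow> 'a"
  assumes scaleC_add_right: "c *\<^sub>C (x + y) = c *\<^sub>C x + c *\<^sub>C y"
    and scaleC_add_left: "(c + d) *\<^sub>C x = c *\<^sub>C x + d *\<^sub>C x"
    and scaleC_scaleC: "c *\<^sub>C d *\<^sub>C x = (c * d) *\<^sub>C x"
    and scaleC_of_real: "complex_of_real r *\<^sub>C x = r *\<^sub>R x"
    and mult_scaleC_left: "(c *\<^sub>C x) * y = c *\<^sub>C (x * y)"
    and mult_scaleC_right: "x * (c *\<^sub>C y) = c *\<^sub>C (x * y)"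
    and norm_scaleC: "norm (c *\<^sub>C x) = cmod c * norm x"
    and star_add: "star (x + y) = star x + star y"
    and star_scaleC: "star (c *\<^sub>C x) = cnj c *\<^sub>C star x"
    and star_mult: "star (x * y) = star y * star x"
    and star_star: "star (star x) = x"
    and cstar_identity: "norm (star x * x) = (norm x)\<^sup>2"


section \<open>Hilbert bimodules\<close>

record ('b, 'e) bimod =
  mcarrier :: "'e set"
  madd :: "'e \<Rightarrow> 'e \<Rightarrow> 'e"
  mzero :: 'e
  lact :: "'b \<Rightarrow> 'e \<Rightarrow> 'e"
  ract :: "'e \<Rightarrow> 'b \<Rightarrow> 'e"

record ('b, 'e) hbimod = "('b, 'e) bimod" +
  minner :: "'e \<Rightarrow> 'e \<Rightarrow> 'b"

text \<open>Since the actions are unital, the complex vector space structure is that of the scalar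
  multiples of the unit; the last axiom says that the left and the right action induce the same
  one.\<close>

locale bimodule =
  fixes M :: "('b::cstar_algebra, 'e, 'z) bimod_scheme"
  assumes madd_closed: "\<lbrakk>x \<in> mcarrier M; y \<in> mcarrier M\<rbrakk> \<Longrightarrow> madd M x y \<in> mcarrier M"
    and mzero_closed: "mzero M \<in> mcarrier M"
    and madd_assoc: "\<lbrakk>x \<in> mcarrier M; y \<in> mcarrier M; z \<in> mcarrier M\<rbrakk> \<Longrightarrow>
        madd M (madd M x y) z = madd M x (madd M y z)"
    and madd_commute: "\<lbrakk>x \<in> mcarrier M; y \<in> mcarrier M\<rbrakk> \<Longrightarrow> madd M x y = madd M y x"
    and madd_zero: "x \<in> mcarrier M \<Longrightarrow> madd M x (mzero M) = x"
    and madd_inverse: "x \<in> mcarrier M \<Longrightarrow> \<exists>y\<in>mcarrier M. madd M x y = mzero M"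
    and lact_closed: "x \<in> mcarrier M \<Longrightarrow> lact M a x \<in> mcarrier M"
    and lact_madd: "\<lbrakk>x \<in> mcarrier M; y \<in> mcarrier M\<rbrakk> \<Longrightarrow>
        lact M a (madd M x y) = madd M (lact M a x) (lact M a y)"
    and lact_add: "x \<in> mcarrier M \<Longrightarrow> lact M (a + b) x = madd M (lact M a x) (lact M b x)"
    and lact_mult: "x \<in> mcarrier M \<Longrightarrow> lact M (a * b) x = lact M a (lact M b x)"
    and lact_one: "x \<in> mcarrier M \<Longrightarrow> lact M 1 x = x"
    and ract_closed: "x \<in> mcarrier M \<Longrightarrow> ract M x a \<in> mcarrier M"
    and ract_madd: "\<lbrakk>x \<in> mcarrier M; y \<in> mcarrier M\<rbrakk> \<Longrightarrow>
        ract M (madd M x y) a = madd M (ract M x a) (ract M y a)"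
    and ract_add: "x \<in> mcarrier M \<Longrightarrow> ract M x (a + b) = madd M (ract M x a) (ract M x b)"
    and ract_mult: "x \<in> mcarrier M \<Longrightarrow> ract M x (a * b) = ract M (ract M x a) b"
    and ract_one: "x \<in> mcarrier M \<Longrightarrow> ract M x 1 = x"
    and lact_ract: "x \<in> mcarrier M \<Longrightarrow> ract M (lact M a x) b = lact M a (ract M x b)"
    and lact_scalar: "x \<in> mcarrier M \<Longrightarrow> lact M (c *\<^sub>C 1) x = ract M x (c *\<^sub>C 1)"

definition mdiff :: "('b::cstar_algebra, 'e, 'z) bimod_scheme \<Rightarrow> 'e \<Rightarrow> 'e \<Rightarrow> 'e" where
  "mdiff M x y = madd M x (ract M y (- 1))"

definition msum :: "('b, 'e, 'z) bimod_scheme \<Rightarrow> 'e list \<Rightarrow> 'e" where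
  "msum M xs = foldr (madd M) xs (mzero M)"

definition mnorm :: "('b::cstar_algebra, 'e, 'z) hbimod_scheme \<Rightarrow> 'e \<Rightarrow> real" where
  "mnorm M x = sqrt (norm (minner M x x))"

definition mlim :: "('b::cstar_algebra, 'e, 'z) hbimod_scheme \<Rightarrow> (nat \<Rightarrow> 'e) \<Rightarrow> 'e \<Rightarrow> bool" where
  "mlim M X l \<longleftrightarrow> l \<in> mcarrier M \<and> (\<lambda>n. mnorm M (mdiff M (X n) l)) \<longlonglongrightarrow> 0"

definition mCauchy :: "('b::cstar_algebra, 'e, 'z) hbimod_scheme \<Rightarrow> (nat \<Rightarrow> 'e) \<Rightarrow> bool" where
  "mCauchy M X \<longleftrightarrow> (\<forall>e>0. \<exists>N. \<forall>m\<ge>N. \<forall>n\<ge>N. mnorm M (mdiff M (X m) (X n)) < e)"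

text \<open>Conjugate linearity in the first variable follows from linearity in the second one and
  symmetry. The axiom \<open>minner_lact\<close> says that the left action is a *-representation by adjointable
  operators. An element of a C*-algebra is positive iff it has the form \<open>star b * b\<close>.\<close>

locale hilbert_bimodule = bimodule M
  for M :: "('b::cstar_algebra, 'e, 'z) hbimod_scheme" +
  assumes minner_madd: "\<lbrakk>x \<in> mcarrier M; y \<in> mcarrier M; z \<in> mcarrier M\<rbrakk> \<Longrightarrow>
        minner M x (madd M y z) = minner M x y + minner M x z"
    and minner_ract: "\<lbrakk>x \<in> mcarrier M; y \<in> mcarrier M\<rbrakk> \<Longrightarrow>
        minner M x (ract M y b) = minner M x y * b"
    and minner_star: "\<lbrakk>x \<in> mcarrier M; y \<in> mcarrier M\<rbrakk> \<Longrightarrow>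
        star (minner M x y) = minner M y x"
    and minner_positive: "x \<in> mcarrier M \<Longrightarrow> \<exists>b. minner M x x = star b * b"
    and minner_definite: "\<lbrakk>x \<in> mcarrier M; minner M x x = 0\<rbrakk> \<Longrightarrow> x = mzero M"
    and minner_lact: "\<lbrakk>x \<in> mcarrier M; y \<in> mcarrier M\<rbrakk> \<Longrightarrow>
        minner M (lact M b x) y = minner M x (lact M (star b) y)"
    and mcomplete: "\<lbrakk>\<And>n. X n \<in> mcarrier M; mCauchy M X\<rbrakk> \<Longrightarrow> \<exists>l. mlim M X l"

definition self_bimod :: "('b::cstar_algebra, 'b) hbimod" where
  "self_bimod = \<lparr>mcarrier = UNIV, madd = (+), mzero = 0, lact = (*), ract = (*),
     minner = (\<lambda>a b. star a * b)\<rparr>"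

definition bilinear_unitary ::
  "('b::cstar_algebra, 'e) hbimod \<Rightarrow> ('b, 'f) hbimod \<Rightarrow> ('e \<Rightarrow> 'f) \<Rightarrow> bool" where
  "bilinear_unitary M N f \<longleftrightarrow>
     bij_betw f (mcarrier M) (mcarrier N) \<and>
     (\<forall>x\<in>mcarrier M. \<forall>y\<in>mcarrier M. f (madd M x y) = madd N (f x) (f y)) \<and>
     (\<forall>x\<in>mcarrier M. \<forall>a. f (lact M a x) = lact N a (f x) \<and> f (ract M x a) = ract N (f x) a) \<and>
     (\<forall>x\<in>mcarrier M. \<forall>y\<in>mcarrier M. minner N (f x) (f y) = minner M x y)"

text \<open>\<open>T\<close>, with elementary tensors \<open>\<tau> u v\<close>, is the inner tensor product of \<open>M\<close> and \<open>N\<close> over the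
  algebra: the Hilbert bimodule generated by elementary tensors with the given inner products. These
  properties determine \<open>(T, \<tau>)\<close> up to a unique bilinear unitary preserving elementary tensors.\<close>

definition inner_tensor_product ::
  "('b::cstar_algebra, 'e) hbimod \<Rightarrow> ('b, 'f) hbimod \<Rightarrow> ('b, 'g) hbimod \<Rightarrow> ('e \<Rightarrow> 'f \<Rightarrow> 'g) \<Rightarrow> bool"
  where
  "inner_tensor_product M N T \<tau> \<longleftrightarrow>
     hilbert_bimodule T \<and>
     (\<forall>u\<in>mcarrier M. \<forall>v\<in>mcarrier N. \<tau> u v \<in> mcarrier T) \<and>
     (\<forall>u\<in>mcarrier M. \<forall>u'\<in>mcarrier M. \<forall>v\<in>mcarrier N.
        \<tau> (madd M u u') v = madd T (\<tau> u v) (\<tau> u' v)) \<and>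
     (\<forall>u\<in>mcarrier M. \<forall>v\<in>mcarrier N. \<forall>v'\<in>mcarrier N.
        \<tau> u (madd N v v') = madd T (\<tau> u v) (\<tau> u v')) \<and>
     (\<forall>u\<in>mcarrier M. \<forall>v\<in>mcarrier N. \<forall>b.
        \<tau> (ract M u b) v = \<tau> u (lact N b v) \<and>
        \<tau> (lact M b u) v = lact T b (\<tau> u v) \<and>
        \<tau> u (ract N v b) = ract T (\<tau> u v) b) \<and>
     (\<forall>u\<in>mcarrier M. \<forall>v\<in>mcarrier N. \<forall>u'\<in>mcarrier M. \<forall>v'\<in>mcarrier N.
        minner T (\<tau> u v) (\<tau> u' v') = minner N v (lact N (minner M u u') v')) \<and>
     (\<forall>x\<in>mcarrier T. \<forall>e>0. \<exists>ps. set ps \<subseteq> mcarrier M \<times> mcarrier N \<and>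
        mnorm T (mdiff T x (msum T (map (\<lambda>(u, v). \<tau> u v) ps))) < e)"


section \<open>Product systems and units\<close>

text \<open>All fibers live on subsets of one type; this is no restriction, as the disjoint union of an
  arbitrary family of sets is such a type. Only the indices \<open>t \<ge> 0\<close> matter. The function \<open>tens P t s\<close>
  is \<open>(u, v) \<mapsto> \<phi>\<^sub>t\<^sub>,\<^sub>s (u \<otimes> v)\<close>, and \<open>iota P\<close> identifies the algebra with the fiber at \<open>0\<close>. A bilinear
  unitary \<open>\<phi>\<^sub>t\<^sub>,\<^sub>s\<close> from the inner tensor product of \<open>E\<^sub>t\<close> and \<open>E\<^sub>s\<close> onto \<open>E\<^sub>t\<^sub>+\<^sub>s\<close> is the same thing as a map
  turning \<open>E\<^sub>t\<^sub>+\<^sub>s\<close> into an inner tensor product of \<open>E\<^sub>t\<close> and \<open>E\<^sub>s\<close>.\<close>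

record ('b, 'e) prod_sys =
  fiber :: "real \<Rightarrow> ('b, 'e) hbimod"
  tens :: "real \<Rightarrow> real \<Rightarrow> 'e \<Rightarrow> 'e \<Rightarrow> 'e"
  iota :: "'b \<Rightarrow> 'e"

locale product_system =
  fixes P :: "('b::cstar_algebra, 'e) prod_sys"
  assumes fiber_hilbert: "0 \<le> t \<Longrightarrow> hilbert_bimodule (fiber P t)"
    and iota_unitary: "bilinear_unitary self_bimod (fiber P 0) (iota P)"
    and tens_product: "\<lbrakk>0 \<le> t; 0 \<le> s\<rbrakk> \<Longrightarrow>
        inner_tensor_product (fiber P t) (fiber P s) (fiber P (t + s)) (tens P t s)"
    and tens_assoc: "\<lbrakk>0 \<le> r; 0 \<le> s; 0 \<le> t;
          x \<in> mcarrier (fiber P r); y \<in> mcarrier (fiber P s); z \<in> mcarrier (fiber P t)\<rbrakk> \<Longrightarrow>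
        tens P (r + s) t (tens P r s x y) z = tens P r (s + t) x (tens P s t y z)"

text \<open>Units are extensional functions on the nonnegative reals (value \<open>undefined\<close> elsewhere), so
  that equality of functions is equality of units.\<close>

definition is_unit_of :: "('b::cstar_algebra, 'e) prod_sys \<Rightarrow> (real \<Rightarrow> 'e) \<Rightarrow> bool" where
  "is_unit_of P u \<longleftrightarrow>
     u \<in> (\<Pi>\<^sub>E t\<in>{0..}. mcarrier (fiber P t)) \<and>
     u 0 = iota P 1 \<and>
     (\<forall>t\<ge>0. \<forall>s\<ge>0. tens P t s (u t) (u s) = u (t + s))"

text \<open>\<open>kernel P u v t\<close> is the map \<open>b \<mapsto> \<langle>u\<^sub>t, b v\<^sub>t\<rangle>\<close>, as an element of the normed space of bounded
  operators. The type \<open>\<Rightarrow>\<^sub>L\<close> consists of the bounded real-linear maps; on complex-linear ones its norm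
  is the usual operator norm.\<close>

definition kernel ::
  "('b::cstar_algebra, 'e) prod_sys \<Rightarrow> (real \<Rightarrow> 'e) \<Rightarrow> (real \<Rightarrow> 'e) \<Rightarrow> real \<Rightarrow> 'b \<Rightarrow>\<^sub>L 'b" where
  "kernel P u v t = Blinfun (\<lambda>b. minner (fiber P t) (u t) (lact (fiber P t) b (v t)))"

definition continuous_unit_set ::
  "('b::cstar_algebra, 'e) prod_sys \<Rightarrow> (real \<Rightarrow> 'e) set \<Rightarrow> bool" where
  "continuous_unit_set P S \<longleftrightarrow>
     (\<forall>u\<in>S. is_unit_of P u) \<and> (\<forall>u\<in>S. \<forall>v\<in>S. continuous_on {0..} (kernel P u v))"

definition continuous_unit :: "('b::cstar_algebra, 'e) prod_sys \<Rightarrow> (real \<Rightarrow> 'e) \<Rightarrow> bool" where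
  "continuous_unit P u \<longleftrightarrow> continuous_unit_set P {u}"

definition U_set :: "('b::cstar_algebra, 'e) prod_sys \<Rightarrow> (real \<Rightarrow> 'e) \<Rightarrow> (real \<Rightarrow> 'e) set" where
  "U_set P \<omega> = {x. continuous_unit P x \<and> continuous_unit_set P {x, \<omega>}}"


section \<open>Operations on units\<close>

text \<open>\<open>tpow P s x m\<close> is the \<open>m\<close>-fold tensor power of \<open>x \<in> E\<^sub>s\<close>, an element of \<open>E\<^sub>m\<^sub>s\<close>.\<close>

primrec tpow :: "('b::cstar_algebra, 'e) prod_sys \<Rightarrow> real \<Rightarrow> 'e \<Rightarrow> nat \<Rightarrow> 'e" where
  "tpow P s x 0 = iota P 1"
| "tpow P s x (Suc m) = (if m = 0 then x else tens P (real m * s) s (tpow P s x m) x)"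

text \<open>The family \<open>\<zeta>\<^sub>t = lim\<^sub>m (y\<^sub>t\<^sub>/\<^sub>m)\<^sup>\<otimes>\<^sup>m\<close>, limit in the norm of \<open>E\<^sub>t\<close>.\<close>

definition unit_limit ::
  "('b::cstar_algebra, 'e) prod_sys \<Rightarrow> (real \<Rightarrow> 'e) \<Rightarrow> real \<Rightarrow> 'e" where
  "unit_limit P y = (\<lambda>t\<in>{0..}.
     THE l. mlim (fiber P t) (\<lambda>m. tpow P (t / real m) (y (t / real m)) m) l)"

text \<open>\<open>boxplus_left P [(\<kappa>\<^sub>1, x\<^sub>1), \<dots>, (\<kappa>\<^sub>n, x\<^sub>n)]\<close> is \<open>\<kappa>\<^sub>1x\<^sub>1 \<boxplus> \<dots> \<boxplus> \<kappa>\<^sub>nx\<^sub>n\<close>, and \<open>boxplus_right\<close> is the analogue with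
  coefficients on the right; meant for coefficients with sum \<open>1\<close>.\<close>

definition boxplus_left ::
  "('b::cstar_algebra, 'e) prod_sys \<Rightarrow> ('b \<times> (real \<Rightarrow> 'e)) list \<Rightarrow> real \<Rightarrow> 'e" where
  "boxplus_left P kxs = unit_limit P
     (\<lambda>s. msum (fiber P s) (map (\<lambda>(k, x). lact (fiber P s) k (x s)) kxs))"

definition boxplus_right ::
  "('b::cstar_algebra, 'e) prod_sys \<Rightarrow> ((real \<Rightarrow> 'e) \<times> 'b) list \<Rightarrow> real \<Rightarrow> 'e" where
  "boxplus_right P xks = unit_limit P
     (\<lambda>s. msum (fiber P s) (map (\<lambda>(x, k). ract (fiber P s) (x s) k) xks))"

definition unit_exp ::
  "('b::cstar_algebra, 'e) prod_sys \<Rightarrow> (real \<Rightarrow> 'e) \<Rightarrow> 'b \<Rightarrow> real \<Rightarrow> 'e" where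
  "unit_exp P x \<beta> = unit_limit P (\<lambda>s. ract (fiber P s) (x s) (exp (s *\<^sub>R \<beta>)))"

definition U_bimod ::
  "('b::cstar_algebra, 'e) prod_sys \<Rightarrow> (real \<Rightarrow> 'e) \<Rightarrow> ('b, real \<Rightarrow> 'e) bimod" where
  "U_bimod P \<omega> = \<lparr>
     mcarrier = U_set P \<omega>,
     madd = (\<lambda>x y. boxplus_left P [(1, x), (1, y), (- 1, \<omega>)]),
     mzero = \<omega>,
     lact = (\<lambda>b x. boxplus_left P [(b, x), (1 - b, \<omega>)]),
     ract = (\<lambda>x b. boxplus_right P [(x, b), (\<omega>, 1 - b)])\<rparr>"

definition U_equiv ::
  "('b::cstar_algebra, 'e) prod_sys \<Rightarrow> (real \<Rightarrow> 'e) \<Rightarrow> ((real \<Rightarrow> 'e) \<times> (real \<Rightarrow> 'e)) set" where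
  "U_equiv P \<omega> = {(x, y). x \<in> U_set P \<omega> \<and> y \<in> U_set P \<omega> \<and> (\<exists>\<beta>. x = unit_exp P y \<beta>)}"

end

(* A unit x in U is determined by the generators L(x,y) of the semigroups K_t(b) = <x_t, b y_t>, y in U,
   so every identity between units is an identity between generators. A section y of the product
   system such as x_s + x'_s - omega_s has kernels 1 + s L + O(s^2) against all units. Since units
   split along partitions, the same expansion holds for <y_s, b (y_{s_1} (x) ... (x) y_{s_n})>,
   s = s_1 + ... + s_n, uniformly over all partitions of s; multiplying over the cells of a coarse
   partition shows that two tensor products of y along fine partitions of t are close. Hence they
   converge, the limit is a unit, and its generators are read off from the first-order expansion of
   y. In terms of D(x) = L(x,.) - L(omega,.), the operations on U become addition of the D(x), composition
   of D(x) with c -> b* c (for b . x), and left multiplication of D(x) by b* (for x . b). *)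

theory Submission
  imports Defs
begin

text \<open>Two obstacles shape the proof. Closeness of two tensor products is measured by kernels
  of tensor products against each other, while an operation on units is controlled only against
  units. The way out is a bootstrap: the section against units, then by conjugation units against
  the section, then units against its tensor products. As the section is an affine combination of
  units, its own expansion against those tensor products follows from that of the units, with the
  same formula. Remainders are kept quadratic because over cells of length at most d they sum to at
  most d times the total time.

  The other obstacle is the module norm. A square \<open>minner M x x\<close> is only known to have
  the form \<open>star b * b\<close>, but the Cauchy-Schwarz inequality and the norm bound for the
  left action need the norm to be monotone on sums of such elements. This is the Kelley-Vaught
  theorem, obtained here with positivity defined by a norm inequality, square roots by iteration,
  and invertibility of translates in place of the spectrum.\<close>

subsection \<open>Positivity in C*-algebras\<close>

lemma neumann_inverse:
  fixes x :: "'a::{real_normed_algebra_1,banach}"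
  assumes "norm (1 - x) < 1"
  shows "\<exists>y. x * y = 1 \<and> y * x = 1"
proof -
  define z where "z = 1 - x"
  define y where "y = (\<Sum>n. z ^ n)"
  have s: "summable (\<lambda>n. z ^ n)"
    using complete_algebra_summable_geometric[OF assms] by (simp add: z_def)
  have y: "y = 1 + (\<Sum>n. z ^ Suc n)"
    using suminf_split_head[OF s] by (simp add: y_def)
  have "y = 1 + z * y"
    using suminf_mult[OF s, of z] unfolding y_def[symmetric] power_Suc[symmetric] y[symmetric] by (simp add: y)
  moreover have "y = 1 + y * z"
    using suminf_mult2[OF s, of z] unfolding y_def[symmetric] power_Suc2[symmetric] by (simp add: y)
  moreover have "x = 1 - z" by (simp add: z_def)
  ultimately have "x * y = 1" "y * x = 1"
    by (metis add_diff_cancel_right' left_diff_distrib mult_1,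
        metis add_diff_cancel_right' right_diff_distrib mult_1_right)
  then show ?thesis by blast
qed

lemma scaleC_minus_left: "(- c) *\<^sub>C (x::'b::cstar_algebra) = - (c *\<^sub>C x)"
proof -
  have "(- c) *\<^sub>C x + c *\<^sub>C x = (0::complex) *\<^sub>C x"
    by (simp flip: scaleC_add_left)
  also have "\<dots> = 0"
    using scaleC_of_real[of 0 x] by simp
  finally show ?thesis
    by (simp add: eq_neg_iff_add_eq_0)
qed

lemma scaleC_diff_right: "c *\<^sub>C (x - y) = c *\<^sub>C x - c *\<^sub>C (y::'b::cstar_algebra)"
  using right_diff_distrib[of "c *\<^sub>C 1" x y] by (simp add: mult_scaleC_left)

lemma star_scaleR: "star (r *\<^sub>R x) = r *\<^sub>R star (x::'b::cstar_algebra)"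
  using star_scaleC[of "complex_of_real r" x] by (simp add: scaleC_of_real)

lemma star_zero [simp]: "star (0::'b::cstar_algebra) = 0"
  using star_scaleR[of 0 "0::'b"] by simp

lemma star_minus: "star (- x) = - star (x::'b::cstar_algebra)"
  using star_scaleR[of "-1" x] by simp

lemma star_diff: "star (x - y) = star x - star (y::'b::cstar_algebra)"
  using star_add[of x "- y"] by (simp add: star_minus)

lemma star_one [simp]: "star (1::'b::cstar_algebra) = 1"
proof -
  have "star (star (1::'b) * 1) = star 1 * 1"
    by (simp only: star_mult star_star)
  then show ?thesis by (simp add: star_star)
qed

lemma norm_star [simp]: "norm (star x) = norm (x::'b::cstar_algebra)"
proof -
  have "norm y \<le> norm (star y)" for y :: 'b
  proof (cases "y = 0")
    case False
    have "norm y * norm y \<le> norm (star y) * norm y"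
      using norm_mult_ineq[of "star y" y] cstar_identity[of y] by (simp add: power2_eq_square)
    then show ?thesis using False by simp
  qed simp
  from this[of x] this[of "star x"] show ?thesis
    by (simp add: star_star)
qed

lemma bounded_linear_star: "bounded_linear (star :: 'b::cstar_algebra \<Rightarrow> 'b)"
  by (rule bounded_linear_intro[of _ 1]) (simp_all add: star_add star_scaleR)

section \<open>Self-adjoint elements, square roots, and positivity\<close>

definition sa :: "'b::cstar_algebra \<Rightarrow> bool" where
  "sa x \<longleftrightarrow> star x = x"

lemma sa_intros:
  fixes x y :: "'b::cstar_algebra"
  shows "sa (1::'b)" "sa (0::'b)" "sa (star x * x)"
    "sa x \<Longrightarrow> sa y \<Longrightarrow> sa (x + y)" "sa x \<Longrightarrow> sa y \<Longrightarrow> sa (x - y)"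
    "sa x \<Longrightarrow> sa (r *\<^sub>R x)" "sa x \<Longrightarrow> sa (- x)" "sa x \<Longrightarrow> sa (x * x)"
    "sa x \<Longrightarrow> sa y \<Longrightarrow> x * y = y * x \<Longrightarrow> sa (x * y)"
  by (simp_all add: sa_def star_add star_diff star_mult star_star star_scaleR star_minus)

lemma sa_norm_square: "sa x \<Longrightarrow> norm (x * x) = (norm (x::'b::cstar_algebra))\<^sup>2"
  using cstar_identity[of x] by (simp add: sa_def)

text \<open>The iteration \<open>s \<mapsto> (h + s\<^sup>2) / 2\<close> is dominated by its scalar version at \<open>h = 1\<close>.\<close>

lemma sqrt_one_minus:
  fixes h :: "'b::cstar_algebra"
  assumes h: "norm h \<le> 1" and "sa h"
  obtains s where "sa s" "norm (1 - s) \<le> 1" "s * s = 1 - h" "\<And>z. z * h = h * z \<Longrightarrow> z * s = s * z"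
proof -
  define f where "f = rec_nat (0::'b) (\<lambda>_ s. (1/2) *\<^sub>R (h + s * s))"
  define g where "g = rec_nat (0::real) (\<lambda>_ s. (1/2) * (1 + s * s))"
  have f0: "f 0 = 0" and fS: "f (Suc n) = (1/2) *\<^sub>R (h + f n * f n)" for n
    by (simp_all add: f_def)
  have g0: "g 0 = 0" and gS: "g (Suc n) = (1/2) * (1 + g n * g n)" for n
    by (simp_all add: g_def)
  have g01: "0 \<le> g n \<and> g n \<le> 1" for n
    by (induction n) (auto simp: g0 gS mult_le_one)
  have comm: "z * f n = f n * z" if z: "z * h = h * z" for z n
  proof (induction n)
    case (Suc n)
    have "z * (f n * f n) = (f n * z) * f n"
      by (simp add: Suc flip: mult.assoc)
    also have "\<dots> = (f n * f n) * z"
      by (simp add: Suc mult.assoc)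
    finally have "z * (f n * f n) = (f n * f n) * z" .
    then show ?case
      by (simp add: fS algebra_simps z)
  qed (simp add: f0)
  have ff: "f m * f n = f n * f m" for m n
    by (intro comm comm[symmetric]) simp
  have saf: "sa (f n)" for n
    by (induction n) (auto simp: f0 fS intro!: sa_intros \<open>sa h\<close>)
  have nf: "norm (f n) \<le> g n" for n
  proof (induction n)
    case (Suc n)
    have "norm (h + f n * f n) \<le> 1 + g n * g n"
      using h norm_mult_ineq[of "f n" "f n"] mult_mono[OF Suc Suc] g01[of n]
      by (intro norm_triangle_le) auto
    then show ?case by (simp add: fS gS)
  qed (simp add: f0 g0)
  \<comment> \<open>All \<open>f n\<close> commute, so a difference of squares factors. The
    increments of \<open>g\<close> obey the same recursion, and the bound passes to the next
    index.\<close>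
  have df: "norm (f (Suc n) - f n) \<le> g (Suc n) - g n" for n
  proof (induction n)
    case (Suc n)
    have "f (Suc (Suc n)) - f (Suc n) = (1/2) *\<^sub>R ((f (Suc n) + f n) * (f (Suc n) - f n))"
      unfolding fS[of "Suc n"] fS[of n] using ff[of "Suc n" n]
      by (simp add: algebra_simps fS)
    then have "norm (f (Suc (Suc n)) - f (Suc n))
        \<le> (1/2) * (norm (f (Suc n) + f n) * norm (f (Suc n) - f n))"
      by (simp add: norm_mult_ineq)
    also have "\<dots> \<le> (1/2) * ((g (Suc n) + g n) * (g (Suc n) - g n))"
      using Suc nf[of n] nf[of "Suc n"]
      by (intro mult_left_mono mult_mono) (auto intro: norm_triangle_le add_mono simp: g01)
    also have "\<dots> = g (Suc (Suc n)) - g (Suc n)"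
      unfolding gS[of "Suc n"] gS[of n] by (simp add: algebra_simps gS)
    finally show ?case .
  qed (simp add: f0 g0 fS gS h)
  have "incseq g"
    by (rule incseq_SucI) (use df order_trans[OF norm_ge_zero] in force)
  then have "convergent g"
    using g01 by (intro Bseq_monoseq_convergent BseqI'[of _ 1]) (auto simp: monoseq_def incseq_def)
  then obtain l where "g \<longlonglongrightarrow> l"
    by (auto simp: convergent_def)
  then have "(\<lambda>n. g (Suc n) - g n) sums (l - g 0)"
    by (rule telescope_sums)
  then have "summable (\<lambda>n. norm (f (Suc n) - f n))"
    by (intro summable_comparison_test'[OF sums_summable]) (auto simp: df)
  then have "summable (\<lambda>n. f (Suc n) - f n)"
    by (rule summable_norm_cancel)
  then have "convergent (\<lambda>n. \<Sum>i<n. f (Suc i) - f i)"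
    by (simp add: summable_iff_convergent)
  then obtain s where s: "f \<longlonglongrightarrow> s"
    unfolding sum_lessThan_telescope convergent_def f0 by auto
  have "(\<lambda>n. f (Suc n)) \<longlonglongrightarrow> (1/2) *\<^sub>R (h + s * s)"
    unfolding fS by (intro tendsto_intros s)
  moreover have "(\<lambda>n. f (Suc n)) \<longlonglongrightarrow> s"
    using s by (rule LIMSEQ_Suc)
  ultimately have s_eq: "s = (1/2) *\<^sub>R (h + s * s)"
    using LIMSEQ_unique by blast
  have "2 *\<^sub>R s = h + s * s"
    using arg_cong[OF s_eq, of "\<lambda>x. 2 *\<^sub>R x"] by simp
  \<comment> \<open>The fixed point equation \<open>2 s = h + s^2\<close> is
    \<open>(1 - s)^2 = 1 - h\<close> in disguise, so the root sought is
    \<open>1 - s\<close>.\<close>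
  then have sq: "(1 - s) * (1 - s) = 1 - h"
    by (simp add: algebra_simps scaleR_2)
  have "(\<lambda>n. star (f n)) \<longlonglongrightarrow> star s"
    by (intro bounded_linear.tendsto[OF bounded_linear_star] s)
  then have "f \<longlonglongrightarrow> star s"
    using saf by (simp add: sa_def)
  then have "sa s"
    using s LIMSEQ_unique unfolding sa_def by blast
  moreover have "z * s = s * z" if z: "z * h = h * z" for z
  proof -
    have "(\<lambda>n. z * f n) \<longlonglongrightarrow> z * s" "(\<lambda>n. f n * z) \<longlonglongrightarrow> s * z"
      by (intro tendsto_intros s)+
    then show ?thesis
      using comm[OF z] LIMSEQ_unique by auto
  qed
  moreover have "norm s \<le> 1"
    using Lim_bounded[OF tendsto_norm[OF s], of 0 1] nf g01 order_trans by blast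
  ultimately have "sa (1 - s)" "norm (1 - (1 - s)) \<le> 1"
      "\<And>z. z * h = h * z \<Longrightarrow> z * (1 - s) = (1 - s) * z"
    by (simp_all add: sa_intros(1) sa_intros(5) right_diff_distrib left_diff_distrib)
  then show ?thesis
    using sq by (intro that[of "1 - s"])
qed

text \<open>For self-adjoint x the inequality says that the spectrum lies in [0, 2t], so this is the
  usual positivity, stated without spectra.\<close>

definition pos :: "'b::cstar_algebra \<Rightarrow> bool" where
  "pos x \<longleftrightarrow> sa x \<and> (\<exists>t\<ge>0. norm (t *\<^sub>R 1 - x) \<le> t)"

text \<open>Scaling by t reduces to the root of \<open>1 - h\<close> with
  \<open>h = 1 - x/t\<close>. That the root commutes with everything commuting with x is what later
  makes products and sums of roots manageable.\<close>

lemma pos_sqrt: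
  fixes x :: "'b::cstar_algebra"
  assumes "pos x"
  obtains s where "pos s" "sa s" "s * s = x" "\<And>z. z * x = x * z \<Longrightarrow> z * s = s * z"
proof -
  obtain t where t: "t \<ge> 0" "norm (t *\<^sub>R 1 - x) \<le> t" and x: "sa x"
    using assms by (auto simp: pos_def)
  show ?thesis
  proof (cases "t = 0")
    case True
    then show ?thesis using t by (intro that[of 0]) (auto simp: pos_def intro: sa_intros)
  next
    case False
    with t have t0: "t > 0" by simp
    let ?h = "1 - (1/t) *\<^sub>R x"
    have "?h = (1/t) *\<^sub>R (t *\<^sub>R 1 - x)"
      using t0 by (simp add: algebra_simps)
    then have "norm ?h = norm (t *\<^sub>R 1 - x) / t"
      using t0 by simp
    then have "norm ?h \<le> 1"
      using t t0 by simp
    moreover have "sa ?h"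
      by (intro sa_intros x)
    ultimately obtain s where s: "sa s" "norm (1 - s) \<le> 1" "s * s = 1 - ?h"
        "\<And>z. z * ?h = ?h * z \<Longrightarrow> z * s = s * z"
      by (rule sqrt_one_minus) blast
    show ?thesis
    proof (rule that[of "sqrt t *\<^sub>R s"])
      show "sqrt t *\<^sub>R s * sqrt t *\<^sub>R s = x"
        using t0 s(3) by simp
      have "norm (sqrt t *\<^sub>R 1 - sqrt t *\<^sub>R s) \<le> sqrt t"
        using s(2) t0 unfolding scaleR_diff_right[symmetric] by (simp add: mult_left_le)
      then show "pos (sqrt t *\<^sub>R s)"
        using t0 by (auto simp: pos_def intro!: sa_intros s exI[of _ "sqrt t"])
      show "z * sqrt t *\<^sub>R s = sqrt t *\<^sub>R s * z" if "z * x = x * z" for z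
        using s(4)[of z] that by (simp add: algebra_simps)
    qed (auto intro: sa_intros s)
  qed
qed

text \<open>Since s and r commute, \<open>u = s + i r\<close> satisfies
  \<open>star u * u = t\<close>, so u has norm \<open>sqrt t\<close>; s is the real part of u and
  hence no larger.\<close>

lemma norm_le_of_sum_squares:
  fixes s r :: "'b::cstar_algebra"
  assumes "sa s" "sa r" "s * r = r * s" "s * s + r * r = t *\<^sub>R 1" "t \<ge> 0"
  shows "norm (s * s) \<le> t"
proof -
  let ?u = "s + \<i> *\<^sub>C r"
  have st: "star ?u = s - \<i> *\<^sub>C r"
    using assms by (simp add: star_add star_scaleC sa_def scaleC_minus_left)
  have "star ?u * ?u = s * s + r * r"
    unfolding st using assms(3)
    by (simp add: algebra_simps mult_scaleC_left mult_scaleC_right scaleC_scaleC scaleC_minus_left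
        scaleC_diff_right scaleC_add_right)
       (use scaleC_of_real[of 1] in simp)
  then have "(norm ?u)\<^sup>2 = t"
    using cstar_identity[of ?u] assms by simp
  have "2 *\<^sub>R s = ?u + star ?u"
    unfolding st by (simp add: scaleR_2)
  then have "2 * norm s \<le> norm ?u + norm (star ?u)"
    by (metis norm_scaleR norm_triangle_ineq abs_numeral)
  then have "norm s \<le> norm ?u" by simp
  then have "(norm s)\<^sup>2 \<le> (norm ?u)\<^sup>2"
    by (intro power_mono) auto
  then show ?thesis
    using \<open>(norm ?u)\<^sup>2 = t\<close> sa_norm_square[OF \<open>sa s\<close>] by simp
qed

lemma pos_sa: "pos x \<Longrightarrow> sa x"
  by (simp add: pos_def)

lemma pos_norm_minus:
  assumes "sa (x::'b::cstar_algebra)" "norm x \<le> t"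
  shows "pos (t *\<^sub>R 1 - x)"
  using assms norm_ge_zero[of x]
  by (auto simp: pos_def intro!: sa_intros exI[of _ t] simp del: norm_ge_zero)

text \<open>With t the norm of \<open>s * s\<close> and r a root of \<open>t - s * s\<close>, the
  norm of \<open>r * r\<close> is at most t by the previous estimate, which is exactly the
  inequality defining positivity of \<open>s * s\<close>.\<close>

lemma pos_square:
  fixes s :: "'b::cstar_algebra"
  assumes "sa s"
  shows "pos (s * s)"
proof -
  let ?t = "norm (s * s)"
  have "pos (?t *\<^sub>R 1 - s * s)"
    by (intro pos_norm_minus sa_intros assms) simp
  then obtain r where r: "sa r" "r * r = ?t *\<^sub>R 1 - s * s"
      "\<And>z. z * (?t *\<^sub>R 1 - s * s) = (?t *\<^sub>R 1 - s * s) * z \<Longrightarrow> z * r = r * z"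
    using pos_sqrt by metis
  have "s * r = r * s"
    by (rule r) (simp add: algebra_simps)
  then have "norm (r * r) \<le> ?t"
    by (intro norm_le_of_sum_squares[OF r(1) assms]) (auto simp: r)
  then show ?thesis
    unfolding r pos_def using assms by (auto intro!: sa_intros exI[of _ ?t])
qed

lemma pos_add:
  assumes "pos (x::'b::cstar_algebra)" "pos y"
  shows "pos (x + y)"
proof -
  obtain t u where *: "t \<ge> 0" "norm (t *\<^sub>R 1 - x) \<le> t" "u \<ge> 0" "norm (u *\<^sub>R 1 - y) \<le> u"
    using assms by (auto simp: pos_def)
  have "norm ((t *\<^sub>R 1 - x) + (u *\<^sub>R 1 - y)) \<le> t + u"
    using * by (intro norm_triangle_le add_mono)
  then show ?thesis
    using assms * unfolding pos_def
    by (intro conjI sa_intros exI[of _ "t + u"]) (auto simp: algebra_simps)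
qed

lemma pos_scaleR:
  assumes "pos (x::'b::cstar_algebra)" "r \<ge> 0" shows "pos (r *\<^sub>R x)"
proof -
  obtain s where "sa s" "s * s = x"
    using assms pos_sqrt by metis
  then have "r *\<^sub>R x = (sqrt r *\<^sub>R s) * (sqrt r *\<^sub>R s)"
    using assms by simp
  then show ?thesis
    using \<open>sa s\<close> by (metis pos_square sa_intros(6))
qed

lemma pos_one: "pos (1::'b::cstar_algebra)"
  using pos_square[OF sa_intros(1)] by simp

lemma pos_mult:
  assumes "pos (x::'b::cstar_algebra)" "pos y" "x * y = y * x"
  shows "pos (x * y)"
proof -
  obtain s where s: "sa s" "s * s = x" "\<And>z. z * x = x * z \<Longrightarrow> z * s = s * z"
    using assms pos_sqrt by metis
  obtain r where r: "sa r" "r * r = y" "\<And>z. z * y = y * z \<Longrightarrow> z * r = r * z"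
    using assms pos_sqrt by metis
  have "x * r = r * x" by (rule r(3)[OF assms(3)])
  then have "r * s = s * r" by (intro s(3)) simp
  have "x * y = (s * s) * (r * r)"
    by (simp add: s(2) r(2))
  also have "\<dots> = (s * r) * (s * r)"
    using \<open>r * s = s * r\<close> by (metis mult.assoc)
  finally have "x * y = (s * r) * (s * r)" .
  moreover have "sa (s * r)"
    by (rule sa_intros(9)[OF s(1) r(1)]) (simp add: \<open>r * s = s * r\<close>)
  ultimately show ?thesis
    using pos_square by metis
qed

text \<open>The roots of x and of \<open>t - x\<close> commute and their squares add up to
  t.\<close>

lemma pos_norm_le:
  assumes "pos (x::'b::cstar_algebra)" "pos (t *\<^sub>R 1 - x)" "t \<ge> 0"
  shows "norm x \<le> t"
proof -
  obtain s where s: "sa s" "s * s = x" "\<And>z. z * x = x * z \<Longrightarrow> z * s = s * z"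
    using assms pos_sqrt by metis
  obtain r where r: "sa r" "r * r = t *\<^sub>R 1 - x"
      "\<And>z. z * (t *\<^sub>R 1 - x) = (t *\<^sub>R 1 - x) * z \<Longrightarrow> z * r = r * z"
    using assms pos_sqrt by metis
  have "s * r = r * s"
    by (intro r(3)) (simp add: right_diff_distrib left_diff_distrib s(3)[OF refl])
  moreover have "s * s + r * r = t *\<^sub>R 1"
    by (simp add: s(2) r(2))
  ultimately have "norm (s * s) \<le> t"
    using norm_le_of_sum_squares s(1) r(1) assms(3) by blast
  then show ?thesis by (simp add: s)
qed

text \<open>The form in which positivity enters the theory of Hilbert modules: both the
  Cauchy-Schwarz inequality and the bound for the left action rest on it.\<close>

lemma pos_norm_mono:
  assumes "pos (x::'b::cstar_algebra)" "pos y"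
  shows "norm x \<le> norm (x + y)"
proof (rule pos_norm_le[OF assms(1)])
  have "pos (norm (x + y) *\<^sub>R 1 - (x + y) + y)"
    by (intro pos_add pos_norm_minus assms pos_sa) simp
  then show "pos (norm (x + y) *\<^sub>R 1 - x)"
    by (simp add: algebra_simps)
qed simp

lemma pos_antisym: "pos (x::'b::cstar_algebra) \<Longrightarrow> pos (- x) \<Longrightarrow> x = 0"
  using pos_norm_mono[of x "- x"] by simp

section \<open>Invertible elements as a substitute for the spectrum\<close>

definition unit_elt :: "'a::monoid_mult \<Rightarrow> bool" where
  "unit_elt x \<longleftrightarrow> (\<exists>y. x * y = 1 \<and> y * x = 1)"

lemma unit_elt_scaleR:
  fixes x :: "'b::cstar_algebra"
  shows "r \<noteq> 0 \<Longrightarrow> unit_elt (r *\<^sub>R x) \<longleftrightarrow> unit_elt x"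
proof -
  have "unit_elt (r *\<^sub>R x)" if "r \<noteq> 0" "unit_elt x" for r and x :: 'b
  proof -
    obtain y where "x * y = 1" "y * x = 1"
      using \<open>unit_elt x\<close> by (auto simp: unit_elt_def)
    then show ?thesis
      using \<open>r \<noteq> 0\<close> unfolding unit_elt_def by (intro exI[of _ "(1/r) *\<^sub>R y"]) simp
  qed
  from this[of r x] this[of "1/r" "r *\<^sub>R x"] show "r \<noteq> 0 \<Longrightarrow> unit_elt (r *\<^sub>R x) \<longleftrightarrow> unit_elt x"
    by auto
qed

text \<open>After division by \<open>t + r\<close> the element is within
  \<open>t / (t + r) < 1\<close> of 1, so the Neumann series applies.\<close>

lemma pos_unit_elt:
  assumes "pos (x::'b::cstar_algebra)" "r > 0"
  shows "unit_elt (r *\<^sub>R 1 + x)"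
proof -
  obtain t where t: "t \<ge> 0" "norm (t *\<^sub>R 1 - x) \<le> t"
    using assms by (auto simp: pos_def)
  let ?q = "(1/(t + r)) *\<^sub>R (r *\<^sub>R 1 + x)"
  have "1 - ?q = (1/(t + r)) *\<^sub>R ((t + r) *\<^sub>R 1 - (r *\<^sub>R 1 + x))"
    using t assms(2) by (simp only: scaleR_diff_right scaleR_scaleR) simp
  also have "(t + r) *\<^sub>R 1 - (r *\<^sub>R 1 + x) = t *\<^sub>R 1 - x"
    by (simp add: algebra_simps)
  finally have "norm (1 - ?q) = norm (t *\<^sub>R 1 - x) / (t + r)"
    using t assms(2) by simp
  then have "norm (1 - ?q) < 1"
    using t assms(2) by (simp only: divide_less_eq) auto
  then have "unit_elt ?q"
    unfolding unit_elt_def by (rule neumann_inverse)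
  then show ?thesis
    using t assms(2) by (simp add: unit_elt_scaleR)
qed

text \<open>With y the inverse and e the reciprocal of its norm, \<open>1 - e y\<close> is positive;
  multiplying by the commuting positive x gives \<open>x - e\<close>.\<close>

lemma pos_invertible_gap:
  assumes "pos (x::'b::cstar_algebra)" "unit_elt x"
  obtains e where "e > 0" "pos (x - e *\<^sub>R 1)"
proof -
  obtain y where y: "x * y = 1" "y * x = 1"
    using assms by (auto simp: unit_elt_def)
  have "y \<noteq> 0" using y by auto
  have "star y * x = 1"
    using arg_cong[OF y(1), of star] pos_sa[OF assms(1)] by (simp add: star_mult sa_def)
  then have "sa y"
    using y unfolding sa_def by (metis mult.assoc mult.left_neutral mult.right_neutral)
  define e where "e = 1 / norm y"
  have e: "e > 0" using \<open>y \<noteq> 0\<close> by (simp add: e_def)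
  have "pos (1 *\<^sub>R 1 - e *\<^sub>R y)"
    using \<open>y \<noteq> 0\<close> by (intro pos_norm_minus sa_intros \<open>sa y\<close>) (simp add: e_def)
  then have "pos (x * (1 *\<^sub>R 1 - e *\<^sub>R y))"
    by (intro pos_mult assms) (simp_all add: algebra_simps y)
  then show ?thesis
    using e by (intro that[of e]) (auto simp: algebra_simps y)
qed

text \<open>The defining inequality is shown with the fixed radius \<open>norm x\<close>, up to an
  error e that then tends to 0.\<close>

lemma pos_closed:
  assumes "\<And>e. e > 0 \<Longrightarrow> pos (x + e *\<^sub>R 1)"
  shows "pos (x::'b::cstar_algebra)"
proof -
  have "pos (x + 1 *\<^sub>R 1)" using assms[of 1] by simp
  then have "sa ((x + 1 *\<^sub>R 1) - 1 *\<^sub>R 1)"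
    by (intro sa_intros pos_sa)
  then have x: "sa x" by simp
  have "norm (norm x *\<^sub>R 1 - x) \<le> norm x"
  proof (rule field_le_epsilon)
    fix e :: real assume e: "e > 0"
    let ?y = "x + (e/2) *\<^sub>R 1" and ?t = "norm x + e / 2"
    have "norm ?y \<le> ?t"
      using e by (intro norm_triangle_le) simp
    then have "pos (?t *\<^sub>R 1 - ?y)"
      by (intro pos_norm_minus sa_intros x)
    moreover have "pos (?t *\<^sub>R 1 - (?t *\<^sub>R 1 - ?y))"
      using assms[of "e/2"] e by (simp add: add.commute)
    ultimately have "norm (?t *\<^sub>R 1 - ?y) \<le> ?t"
      using e by (intro pos_norm_le) auto
    moreover have "?t *\<^sub>R 1 - ?y = norm x *\<^sub>R 1 - x"
      by (simp add: algebra_simps)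
    ultimately show "norm (norm x *\<^sub>R 1 - x) \<le> norm x + e"
      using e by simp
  qed
  then show ?thesis
    using x by (auto simp: pos_def intro!: exI[of _ "norm x"])
qed

text \<open>Let m be the least t for which \<open>t + x\<close> is positive. If m were positive,
  \<open>m + x\<close> would be invertible and positive, and the gap below it would allow a smaller
  t.\<close>

lemma pos_of_unit_elt:
  fixes x :: "'b::cstar_algebra"
  assumes x: "sa x" and inv: "\<And>r. r > 0 \<Longrightarrow> unit_elt (r *\<^sub>R 1 + x)"
  shows "pos x"
proof -
  define T where "T = {t. t \<ge> 0 \<and> pos (t *\<^sub>R 1 + x)}"
  define m where "m = Inf T"
  have T: "norm x \<in> T"
    using pos_norm_minus[of "- x" "norm x"] x by (auto simp: T_def intro: sa_intros)
  have bdd: "bdd_below T" by (rule bdd_belowI[of _ 0]) (auto simp: T_def)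
  have m0: "m \<ge> 0"
    unfolding m_def by (rule cInf_greatest) (use T in blast, simp add: T_def)
  have pm: "pos (m *\<^sub>R 1 + x)"
  proof (rule pos_closed)
    fix e :: real assume "e > 0"
    then obtain t where t: "t \<in> T" "t < m + e"
      using cInf_lessD[of T "m + e"] T unfolding m_def by auto
    have "pos ((t *\<^sub>R 1 + x) + (m + e - t) *\<^sub>R 1)"
      using t unfolding T_def by (intro pos_add[OF _ pos_scaleR[OF pos_one]]) simp_all
    then show "pos (m *\<^sub>R 1 + x + e *\<^sub>R 1)"
      by (simp add: algebra_simps)
  qed
  have "m = 0"
  proof (rule ccontr)
    assume "m \<noteq> 0"
    with m0 have m: "m > 0" by simp
    obtain e where e: "e > 0" "pos (m *\<^sub>R 1 + x - e *\<^sub>R 1)"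
      using pos_invertible_gap[OF pm inv[OF m]] by auto
    have "pos ((m *\<^sub>R 1 + x - e *\<^sub>R 1) + (e - min m e) *\<^sub>R 1)"
      using e by (intro pos_add pos_scaleR pos_one) auto
    then have "m - min m e \<in> T"
      unfolding T_def by (auto simp: algebra_simps)
    then have "m \<le> m - min m e"
      unfolding m_def by (intro cInf_lower bdd)
    then show False using m e by auto
  qed
  then show ?thesis using pm by simp
qed

text \<open>If c inverts \<open>1 + a b\<close>, then \<open>1 - b c a\<close> inverts
  \<open>1 + b a\<close>. This is the algebraic core of the fact that ab and ba have the same
  nonzero spectrum.\<close>

lemma unit_elt_one_plus_swap:
  fixes a b :: "'a::ring_1"
  assumes "unit_elt (1 + a * b)"
  shows "unit_elt (1 + b * a)"
proof -
  obtain c where c: "(1 + a * b) * c = 1" "c * (1 + a * b) = 1"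
    using assms by (auto simp: unit_elt_def)
  have 1: "a * b * c = 1 - c" and 2: "c * a * b = 1 - c"
    using c by (simp_all add: algebra_simps eq_diff_eq)
  have "b * (a * b * c) * a = b * a - b * c * a"
    unfolding 1 by (simp add: algebra_simps)
  moreover have "b * (c * a * b) * a = b * a - b * c * a"
    unfolding 2 by (simp add: algebra_simps)
  ultimately show ?thesis
    unfolding unit_elt_def
    by (intro exI[of _ "1 - b * c * a"]) (simp add: algebra_simps)
qed

lemma pos_zero_of_units:
  fixes y :: "'b::cstar_algebra"
  assumes "pos y" and inv: "\<And>r. r > 0 \<Longrightarrow> unit_elt (r *\<^sub>R 1 - y)"
  shows "y = 0"
proof -
  have "pos (- y)"
    using assms by (intro pos_of_unit_elt) (auto intro: sa_intros pos_sa)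
  then show ?thesis using pos_antisym assms by blast
qed

lemma unit_elt_factor:
  assumes "unit_elt (x * y)" "x * y = y * x"
  shows "unit_elt x"
proof -
  obtain c where c: "x * y * c = 1" "c * (x * y) = 1"
    using assms by (auto simp: unit_elt_def)
  have "y * c = (c * y * x) * (y * c)"
    using c assms by (simp add: mult.assoc)
  also have "\<dots> = c * y * (x * y * c)"
    by (simp add: mult.assoc)
  finally have "y * c = c * y" using c by simp
  then show ?thesis
    using c assms unfolding unit_elt_def by (intro exI[of _ "y * c"]) (metis mult.assoc)
qed

text \<open>Here k is the absolute value of h. The product \<open>(r + k - h) (r + k + h)\<close>
  equals \<open>r^2 + 2 r k\<close>, which is invertible because k is positive; hence so is its
  commuting factor \<open>r + (k - h)\<close>.\<close>

lemma pos_abs_minus: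
  fixes h :: "'b::cstar_algebra"
  assumes h: "sa h" and k: "pos k" "k * k = h * h" "h * k = k * h"
  shows "pos (k - h)"
proof (rule pos_of_unit_elt)
  show "sa (k - h)" by (intro sa_intros pos_sa h k)
next
  fix r :: real assume r: "r > 0"
  let ?x = "r *\<^sub>R 1 + (k - h)" and ?y = "r *\<^sub>R 1 + (k + h)"
  have "pos ((2 * r) *\<^sub>R k)" "0 < r * r" using k r by (auto intro: pos_scaleR)
  then have "unit_elt ((r * r) *\<^sub>R 1 + (2 * r) *\<^sub>R k)"
    by (rule pos_unit_elt)
  also have "(r * r) *\<^sub>R 1 + (2 * r) *\<^sub>R k = ?x * ?y"
    using k by (simp add: algebra_simps flip: scaleR_2)
  finally have "unit_elt (?x * ?y)" .
  then show "unit_elt ?x"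
    by (rule unit_elt_factor) (simp add: algebra_simps k)
qed

text \<open>Positive and negative part are \<open>(k + h)/2\<close> and \<open>(k - h)/2\<close>
  with k the absolute value of h; their products vanish since \<open>k^2 = h^2\<close>.\<close>

lemma sa_decompose:
  fixes h :: "'b::cstar_algebra"
  assumes h: "sa h"
  obtains p q where "pos p" "pos q" "h = p - q" "p * q = 0" "q * p = 0"
proof -
  obtain k where k: "pos k" "k * k = h * h" "\<And>z. z * (h * h) = (h * h) * z \<Longrightarrow> z * k = k * z"
    using pos_sqrt[OF pos_square[OF h]] by metis
  have hk: "h * k = k * h"
    by (rule k(3)) (simp add: mult.assoc)
  have "pos (k - h)" "pos (k - (- h))"
    by (rule pos_abs_minus[OF h k(1,2) hk])
       (rule pos_abs_minus[OF sa_intros(7)[OF h] k(1)], simp_all add: k(2) hk)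
  then have "pos ((1/2) *\<^sub>R (k + h))" "pos ((1/2) *\<^sub>R (k - h))"
    by (auto intro: pos_scaleR)
  moreover have "h = (1/2) *\<^sub>R (k + h) - (1/2) *\<^sub>R (k - h)"
    by (simp add: algebra_simps flip: scaleR_add_left)
  ultimately show ?thesis
    by (rule that) (simp_all add: algebra_simps k hk)
qed

text \<open>The Kelley--Vaught theorem. The negative part \<open>q\<close> of \<open>star a * a\<close> gives an element \<open>b = a * q\<close> with
  \<open>star b * b = - q\<^sup>3\<close>; then \<open>b * star b\<close> is positive, and since \<open>b * star b\<close> and \<open>star b * b\<close> have the
  same nonzero spectrum, \<open>q\<close> vanishes.\<close>

theorem pos_star_mult: "pos (star a * (a::'b::cstar_algebra))"
proof -
  let ?h = "star a * a"
  obtain p q where pq: "pos p" "pos q" "?h = p - q" "p * q = 0" "q * p = 0"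
    using sa_decompose[OF sa_intros(3)] by metis
  define b where "b = a * q"
  define y where "y = q * q * q"
  have "star b * b = q * ?h * q"
    using pos_sa[OF pq(2)] by (simp add: b_def star_mult sa_def mult.assoc)
  also have "\<dots> = - y"
    unfolding pq(3) by (simp add: right_diff_distrib left_diff_distrib pq y_def)
  finally have sbb: "star b * b = - y" .
  have py: "pos y"
    unfolding y_def by (intro pos_mult pq) (simp_all add: mult.assoc)
  \<comment> \<open>Up to factors 2 and -2 these are the real and imaginary parts of b. The identity
    \<open>e^2 + f^2 = 2 (b star b + star b b)\<close> then shows that \<open>b * star b\<close> is
    a sum of squares plus y.\<close>
  define e where "e = b + star b"
  define f where "f = \<i> *\<^sub>C (b - star b)"
  have "sa e" "sa f"
    by (simp_all add: e_def f_def sa_def star_add star_star star_scaleC star_diff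
        scaleC_minus_left scaleC_diff_right)
  have "f * f = - ((b - star b) * (b - star b))"
    using scaleC_of_real[of 1 "(b - star b) * (b - star b)"]
    by (simp add: f_def mult_scaleC_left mult_scaleC_right scaleC_scaleC scaleC_minus_left)
  then have "e * e + f * f = 2 *\<^sub>R (b * star b) + 2 *\<^sub>R (star b * b)"
    by (simp add: e_def algebra_simps scaleR_2)
  from arg_cong[OF this, of "\<lambda>x. (1/2) *\<^sub>R x"]
  have "b * star b = (1/2) *\<^sub>R (e * e + f * f) + y"
    by (simp add: sbb scaleR_add_right scaleR_diff_right)
  moreover have "pos ((1/2) *\<^sub>R (e * e + f * f) + y)"
    by (intro pos_add pos_scaleR pos_square \<open>sa e\<close> \<open>sa f\<close> py) auto
  ultimately have pb: "pos (b * star b)" by simp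
  have "y = 0"
  proof (rule pos_zero_of_units[OF py])
    fix r :: real assume r: "r > 0"
    have 1: "r *\<^sub>R 1 + z = r *\<^sub>R (1 + (1/r) *\<^sub>R z)" for z :: 'b
      using r by (simp add: algebra_simps)
    have "unit_elt (1 + (1/r) *\<^sub>R (b * star b))"
      using pos_unit_elt[OF pb r] r unfolding 1 by (simp add: unit_elt_scaleR)
    then have "unit_elt (1 + ((1/r) *\<^sub>R b) * star b)" by simp
    then have "unit_elt (1 + star b * ((1/r) *\<^sub>R b))"
      by (rule unit_elt_one_plus_swap)
    then have "unit_elt (r *\<^sub>R 1 + star b * b)"
      using r unfolding 1 by (simp add: unit_elt_scaleR)
    then show "unit_elt (r *\<^sub>R 1 - y)"
      by (simp add: sbb)
  qed
  then have "(q * q) * (q * q) = 0"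
    by (simp add: y_def mult.assoc)
  then have "q = 0"
    using sa_norm_square[OF pos_sa[OF pq(2)]] sa_norm_square[OF sa_intros(8)[OF pos_sa[OF pq(2)]]]
    by simp
  then show ?thesis using pq by simp
qed

text \<open>The difference is needed as \<open>star c * c\<close>, because in this form the left
  action turns it into a square \<open>minner M (lact M c x) (lact M c x)\<close>.\<close>

lemma pos_norm_diff_star_mult:
  "\<exists>c. (norm a)\<^sup>2 *\<^sub>R 1 - star a * a = star c * (c::'b::cstar_algebra)"
proof -
  have "pos ((norm a)\<^sup>2 *\<^sub>R 1 - star a * a)"
    by (intro pos_norm_minus sa_intros) (simp add: cstar_identity)
  then show ?thesis
    by (metis pos_sqrt sa_def)
qed

subsection \<open>Norms in Hilbert bimodules\<close>

context hilbert_bimodule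
begin

abbreviation E where "E \<equiv> mcarrier M"

lemma minner_madd_left:
  "\<lbrakk>x \<in> E; y \<in> E; z \<in> E\<rbrakk> \<Longrightarrow> minner M (madd M y z) x = minner M y x + minner M z x"
  using arg_cong[OF minner_madd[of x y z], of star]
  by (simp add: star_add minner_star madd_closed)

lemma minner_ract_left:
  "\<lbrakk>x \<in> E; y \<in> E\<rbrakk> \<Longrightarrow> minner M (ract M y b) x = star b * minner M y x"
  using arg_cong[OF minner_ract[of x y b], of star]
  by (simp add: star_mult minner_star ract_closed)

lemma mdiff_closed: "\<lbrakk>x \<in> E; y \<in> E\<rbrakk> \<Longrightarrow> mdiff M x y \<in> E"
  by (simp add: mdiff_def madd_closed ract_closed)

lemma minner_mdiff:
  assumes "x \<in> E" "y \<in> E" "z \<in> E"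
  shows "minner M x (mdiff M y z) = minner M x y - minner M x z"
    and "minner M (mdiff M y z) x = minner M y x - minner M z x"
  using assms
  by (simp_all add: mdiff_def minner_madd minner_madd_left ract_closed minner_ract minner_ract_left
      star_minus)

lemma minner_mzero: "x \<in> E \<Longrightarrow> minner M x (mzero M) = 0"
  using minner_madd[of x "mzero M" "mzero M"] madd_zero[of "mzero M"] by (simp add: mzero_closed)

lemma pos_minner: "x \<in> E \<Longrightarrow> pos (minner M x x)"
  using minner_positive pos_star_mult by metis

lemma mnorm_square: "(mnorm M x)\<^sup>2 = norm (minner M x x)"
  by (simp add: mnorm_def)

lemma mnorm_nonneg [simp]: "mnorm M x \<ge> 0"
  by (simp add: mnorm_def)

text \<open>With \<open>h = \<langle>x, y\<rangle>\<close> and \<open>c = 1 / \<parallel>x\<parallel>\<^sup>2\<close>, expanding the positive element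
  \<open>\<langle>y - x c h, y - x c h\<rangle>\<close> gives \<open>2 c h\<^sup>* h \<le> \<langle>y, y\<rangle> + c\<^sup>2 h\<^sup>* \<langle>x, x\<rangle> h\<close>.\<close>

lemma cauchy_schwarz:
  assumes x: "x \<in> E" and y: "y \<in> E"
  shows "norm (minner M x y) \<le> mnorm M x * mnorm M y"
proof -
  define h where "h = minner M x y"
  define X where "X = norm (minner M x x)"
  define Y where "Y = norm (minner M y y)"
  have yx: "minner M y x = star h"
    using minner_star[OF x y] by (simp add: h_def)
  have "(norm h)\<^sup>2 \<le> X * Y"
  proof (cases "X = 0")
    case True
    then have "x = mzero M"
      using x minner_definite by (simp add: X_def)
    then have "star h = 0"
      using minner_mzero[OF y] yx by simp
    then have "h = 0"
      by (metis star_star star_zero)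
    then show ?thesis by (simp add: X_def Y_def)
  next
    case False
    define c where "c = 1 / X"
    have X: "X > 0" using False by (simp add: X_def)
    then have c: "c > 0" by (simp add: c_def)
    let ?w = "ract M x (c *\<^sub>R h)"
    let ?z = "mdiff M y ?w"
    have w: "?w \<in> E" using x by (rule ract_closed)
    have "minner M ?z ?z = minner M y y - c *\<^sub>R (star h * h) - (c *\<^sub>R (star h * h)
        - (c * c) *\<^sub>R (star h * (minner M x x * h)))"
      using x y w
      by (simp add: minner_mdiff mdiff_closed minner_ract minner_ract_left yx star_scaleR mult.assoc
          left_diff_distrib right_diff_distrib scaleR_diff_right flip: h_def)
    then have eq: "(2 * c) *\<^sub>R (star h * h) + minner M ?z ?z
        = minner M y y + (c * c) *\<^sub>R (star h * (minner M x x * h))"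
      by (simp add: algebra_simps flip: scaleR_2)
    have "norm ((2 * c) *\<^sub>R (star h * h)) \<le> norm ((2 * c) *\<^sub>R (star h * h) + minner M ?z ?z)"
      using c y w by (intro pos_norm_mono pos_scaleR pos_star_mult pos_minner mdiff_closed) auto
    also have "\<dots> \<le> Y + (c * c) * (norm h * (X * norm h))"
      unfolding eq
    proof (intro norm_triangle_le add_mono)
      have "norm (star h * (minner M x x * h)) \<le> norm h * (X * norm h)"
        using order_trans[OF norm_mult_ineq mult_left_mono[OF norm_mult_ineq norm_ge_zero]]
        unfolding X_def by (metis norm_star)
      then show "norm ((c * c) *\<^sub>R (star h * (minner M x x * h))) \<le> (c * c) * (norm h * (X * norm h))"
        using c by simp
    qed (simp add: Y_def)
    finally have "2 * c * (norm h)\<^sup>2 \<le> Y + (c * c) * (norm h * (X * norm h))"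
      using c by (simp add: cstar_identity)
    also have "\<dots> = Y + c * (norm h)\<^sup>2"
      using X by (simp add: c_def power2_eq_square)
    finally show ?thesis
      using X by (simp add: c_def field_simps)
  qed
  then have "sqrt ((norm h)\<^sup>2) \<le> sqrt (X * Y)"
    by (rule real_sqrt_le_mono)
  then show ?thesis
    by (simp add: h_def X_def Y_def mnorm_def real_sqrt_mult)
qed

lemma lact_scaleR_one: "x \<in> E \<Longrightarrow> lact M (r *\<^sub>R 1) x = ract M x (r *\<^sub>R 1)"
  using lact_scalar[of x "complex_of_real r"] by (simp add: scaleC_of_real)

lemma minner_lact_scaleR:
  assumes "x \<in> E" "y \<in> E"
  shows "minner M x (lact M (r *\<^sub>R b) y) = r *\<^sub>R minner M x (lact M b y)"
proof -
  have "lact M (r *\<^sub>R b) y = lact M (r *\<^sub>R 1) (lact M b y)"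
    using assms by (simp flip: lact_mult)
  also have "\<dots> = ract M (lact M b y) (r *\<^sub>R 1)"
    using assms by (simp add: lact_scaleR_one lact_closed)
  finally show ?thesis
    using assms by (simp add: minner_ract lact_closed)
qed

text \<open>The identity \<open>norm(a)^2 = star a * a + star c * c\<close> writes a multiple of
  \<open>minner M x x\<close> as a sum of two positive squares, one of them that of ax.\<close>

lemma mnorm_lact:
  assumes x: "x \<in> E"
  shows "mnorm M (lact M a x) \<le> norm a * mnorm M x"
proof -
  obtain c where c: "(norm a)\<^sup>2 *\<^sub>R 1 - star a * a = star c * c"
    using pos_norm_diff_star_mult by metis
  have *: "minner M (lact M b x) (lact M b x) = minner M x (lact M (star b * b) x)" for b
    using x by (simp add: minner_lact lact_closed lact_mult)
  have "(norm a)\<^sup>2 *\<^sub>R 1 = star a * a + star c * c"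
    using c by (simp add: algebra_simps)
  then have "(norm a)\<^sup>2 *\<^sub>R minner M x x =
      minner M (lact M a x) (lact M a x) + minner M (lact M c x) (lact M c x)"
    using minner_lact_scaleR[OF x x, of "(norm a)\<^sup>2" 1] x
    by (simp add: * lact_one lact_add lact_closed minner_madd)
  then have "norm (minner M (lact M a x) (lact M a x)) \<le> norm ((norm a)\<^sup>2 *\<^sub>R minner M x x)"
    using x by (simp add: pos_norm_mono pos_minner lact_closed)
  then have "sqrt (norm (minner M (lact M a x) (lact M a x))) \<le> sqrt ((norm a)\<^sup>2 * norm (minner M x x))"
    by (intro real_sqrt_le_mono) simp
  then show ?thesis
    by (simp add: mnorm_def real_sqrt_mult)
qed

lemma ract_zero:
  assumes "x \<in> E" shows "ract M x 0 = mzero M"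
  using assms minner_ract[of "ract M x 0" x 0] by (intro minner_definite) (auto simp: ract_closed)

lemma eq_of_mnorm_mdiff:
  assumes x: "x \<in> E" and y: "y \<in> E" and "mnorm M (mdiff M x y) = 0"
  shows "x = y"
proof -
  have "mdiff M x y = mzero M"
    using assms by (intro minner_definite) (auto simp: mdiff_closed mnorm_def)
  then have 1: "madd M x (ract M y (- 1)) = mzero M"
    by (simp add: mdiff_def)
  have 2: "madd M (ract M y (- 1)) y = mzero M"
    using ract_add[OF y, of "- 1" 1] y by (simp add: ract_one ract_zero)
  have "x = madd M x (madd M (ract M y (- 1)) y)"
    using 2 x by (simp add: madd_zero)
  also have "\<dots> = madd M (mzero M) y"
    using x y 1 by (simp add: ract_closed flip: madd_assoc)
  also have "\<dots> = y"
    using y by (metis madd_commute madd_zero mzero_closed)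
  finally show ?thesis .
qed

lemma norm_minner_diff:
  assumes "x \<in> E" "y \<in> E"
  shows "(mnorm M (mdiff M x y))\<^sup>2 =
    norm (minner M x x - minner M x y - minner M y x + minner M y y)"
  using assms by (simp add: mnorm_square minner_mdiff mdiff_closed algebra_simps)

lemma mnorm_mdiff_commute: "\<lbrakk>x \<in> E; y \<in> E\<rbrakk> \<Longrightarrow> mnorm M (mdiff M x y) = mnorm M (mdiff M y x)"
proof (rule power2_eq_imp_eq)
  assume "x \<in> E" "y \<in> E"
  moreover have "minner M x x - minner M x y - minner M y x + minner M y y
      = minner M y y - minner M y x - minner M x y + minner M x x"
    by simp
  ultimately show "(mnorm M (mdiff M x y))\<^sup>2 = (mnorm M (mdiff M y x))\<^sup>2"
    by (simp only: norm_minner_diff)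
qed simp_all

text \<open>The hypothesis says \<open>w = u + v\<close> only at the level of inner products, so no
  computation in the carrier is needed. Both triangle inequalities below are instances.\<close>

lemma mnorm_triangle_of_minner:
  assumes "u \<in> E" "v \<in> E" "w \<in> E" and "minner M w w = minner M u u + minner M u v + minner M v u + minner M v v"
  shows "mnorm M w \<le> mnorm M u + mnorm M v"
proof (rule power2_le_imp_le)
  have "(mnorm M w)\<^sup>2 \<le> norm (minner M u u) + norm (minner M u v) + norm (minner M v u) + norm (minner M v v)"
    unfolding mnorm_square assms(4) by (intro norm_triangle_le add_right_mono) simp
  also have "\<dots> \<le> (mnorm M u)\<^sup>2 + mnorm M u * mnorm M v + mnorm M v * mnorm M u + (mnorm M v)\<^sup>2"
    using assms by (intro add_mono cauchy_schwarz) (auto simp: mnorm_square)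
  also have "\<dots> = (mnorm M u + mnorm M v)\<^sup>2"
    by (simp add: power2_eq_square algebra_simps)
  finally show "(mnorm M w)\<^sup>2 \<le> (mnorm M u + mnorm M v)\<^sup>2" .
qed simp

lemma mnorm_mdiff_triangle:
  assumes "x \<in> E" "y \<in> E" "z \<in> E"
  shows "mnorm M (mdiff M x z) \<le> mnorm M (mdiff M x y) + mnorm M (mdiff M y z)"
  using assms
  by (intro mnorm_triangle_of_minner) (auto simp: mdiff_closed minner_mdiff algebra_simps)

lemma mnorm_le_mdiff:
  assumes "x \<in> E" "y \<in> E"
  shows "mnorm M x \<le> mnorm M (mdiff M x y) + mnorm M y"
  using assms
  by (intro mnorm_triangle_of_minner) (auto simp: mdiff_closed minner_mdiff algebra_simps)

lemma mlim_carrier: "mlim M X l \<Longrightarrow> l \<in> E"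
  by (simp add: mlim_def)

lemma mlim_iff_bound:
  assumes "l \<in> E" "\<forall>\<^sub>F n in sequentially. mnorm M (mdiff M (X n) l) \<le> g n" "g \<longlonglongrightarrow> 0"
  shows "mlim M X l"
  unfolding mlim_def using assms
  by (auto intro: tendsto_sandwich[OF _ assms(2) tendsto_const])

lemma mlim_unique:
  assumes X: "\<forall>\<^sub>F n in sequentially. X n \<in> E" and "mlim M X l" "mlim M X l'"
  shows "l = l'"
proof -
  have l: "l \<in> E" "l' \<in> E" using assms by (auto simp: mlim_def)
  have "(\<lambda>n. mnorm M (mdiff M (X n) l) + mnorm M (mdiff M (X n) l')) \<longlonglongrightarrow> 0 + 0"
    using assms by (intro tendsto_intros) (auto simp: mlim_def)
  moreover have "\<forall>\<^sub>F n in sequentially. mnorm M (mdiff M l l')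
      \<le> mnorm M (mdiff M (X n) l) + mnorm M (mdiff M (X n) l')"
    using X by eventually_elim (metis l mnorm_mdiff_commute mnorm_mdiff_triangle)
  ultimately have "mnorm M (mdiff M l l') \<le> 0 + 0"
    by (intro tendsto_lowerbound[of _ "0 + 0" sequentially]) auto
  then show ?thesis
    using l mnorm_nonneg[of "mdiff M l l'"] by (intro eq_of_mnorm_mdiff) auto
qed

lemma mlim_the:
  assumes "\<forall>\<^sub>F n in sequentially. X n \<in> E" "mlim M X l"
  shows "(THE l. mlim M X l) = l"
  using assms mlim_unique by blast

lemma bounded_linear_minner_lact:
  assumes "x \<in> E" "y \<in> E"
  shows "bounded_linear (\<lambda>b. minner M x (lact M b y))"
proof (rule bounded_linear_intro)
  show "norm (minner M x (lact M b y)) \<le> norm b * (mnorm M x * mnorm M y)" for b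
  proof -
    have "norm (minner M x (lact M b y)) \<le> mnorm M x * mnorm M (lact M b y)"
      using assms by (intro cauchy_schwarz lact_closed)
    also have "\<dots> \<le> mnorm M x * (norm b * mnorm M y)"
      using assms by (intro mult_left_mono mnorm_lact) auto
    finally show ?thesis by (simp add: mult_ac)
  qed
qed (use assms in \<open>simp_all add: lact_add minner_madd lact_closed minner_lact_scaleR\<close>)

end


subsection \<open>The Banach algebra of bounded operators\<close>

text \<open>A copy of the bounded operators whose multiplication is composition, so that
  \<open>exp\<close>, powers and \<open>prod_list\<close> are those of a Banach algebra. The sort
  \<open>perfect_space\<close> makes the space nonzero, hence \<open>norm 1 = 1\<close>.\<close>

typedef (overloaded) ('a::"{banach,perfect_space}") bop = "UNIV :: ('a \<Rightarrow>\<^sub>L 'a) set"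
  morphisms rep_bop bop
  by simp

setup_lifting type_definition_bop

instantiation bop :: ("{banach,perfect_space}") real_normed_algebra_1
begin

lift_definition norm_bop :: "'a bop \<Rightarrow> real" is norm .
lift_definition zero_bop :: "'a bop" is 0 .
lift_definition one_bop :: "'a bop" is id_blinfun .
lift_definition plus_bop :: "'a bop \<Rightarrow> 'a bop \<Rightarrow> 'a bop" is "(+)" .
lift_definition minus_bop :: "'a bop \<Rightarrow> 'a bop \<Rightarrow> 'a bop" is "(-)" .
lift_definition uminus_bop :: "'a bop \<Rightarrow> 'a bop" is uminus .
lift_definition scaleR_bop :: "real \<Rightarrow> 'a bop \<Rightarrow> 'a bop" is scaleR .
lift_definition times_bop :: "'a bop \<Rightarrow> 'a bop \<Rightarrow> 'a bop" is "(o\<^sub>L)" .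

definition dist_bop :: "'a bop \<Rightarrow> 'a bop \<Rightarrow> real" where
  "dist_bop a b = norm (a - b)"

definition sgn_bop :: "'a bop \<Rightarrow> 'a bop" where
  "sgn_bop x = scaleR (inverse (norm x)) x"

definition uniformity_bop :: "('a bop \<times> 'a bop) filter" where
  "uniformity_bop = (INF e\<in>{0 <..}. principal {(x, y). dist x y < e})"

definition open_bop :: "'a bop set \<Rightarrow> bool" where
  "open_bop S = (\<forall>x\<in>S. \<forall>\<^sub>F (x', y) in uniformity. x' = x \<longrightarrow> y \<in> S)"

instance
proof
  fix x y z :: "'a bop" and r s :: real
  show "dist x y = norm (x - y)" by (rule dist_bop_def)
  show "sgn x = inverse (norm x) *\<^sub>R x" by (rule sgn_bop_def)
  show "uniformity = (INF e\<in>{0 <..}. principal {(x :: 'a bop, y). dist x y < e})"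
    by (rule uniformity_bop_def)
  show "open U = (\<forall>x\<in>U. \<forall>\<^sub>F (x', y) in uniformity. x' = x \<longrightarrow> y \<in> U)" for U :: "'a bop set"
    by (rule open_bop_def)
  show "x + y + z = x + (y + z)" "x + y = y + x" "0 + x = x" "- x + x = 0" "x - y = x + - y"
    "r *\<^sub>R (x + y) = r *\<^sub>R x + r *\<^sub>R y" "(r + s) *\<^sub>R x = r *\<^sub>R x + s *\<^sub>R x"
    "r *\<^sub>R s *\<^sub>R x = (r * s) *\<^sub>R x" "1 *\<^sub>R x = x"
    by (transfer; simp add: algebra_simps)+
  show "norm x = 0 \<longleftrightarrow> x = 0" by transfer simp
  show "norm (x + y) \<le> norm x + norm y" by transfer (rule norm_triangle_ineq)
  show "norm (r *\<^sub>R x) = \<bar>r\<bar> * norm x" by transfer simp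
  show "x * y * z = x * (y * z)" by transfer (intro blinfun_eqI; simp)
  show "(x + y) * z = x * z + y * z" "x * (y + z) = x * y + x * z"
    "r *\<^sub>R x * y = r *\<^sub>R (x * y)" "x * r *\<^sub>R y = r *\<^sub>R (x * y)" "1 * x = x" "x * 1 = x"
    by (transfer; intro blinfun_eqI; simp add: blinfun.bilinear_simps)+
  show "norm (x * y) \<le> norm x * norm y" by transfer (rule norm_blinfun_compose)
  show n1: "norm (1 :: 'a bop) = 1" by transfer (rule norm_blinfun_id)
  have "norm (0 :: 'a bop) = 0" by transfer simp
  with n1 show "(0::'a bop) \<noteq> 1" by (metis zero_neq_one[where 'a=real])
qed

end

instance bop :: ("{banach,perfect_space}") banach
proof
  fix X :: "nat \<Rightarrow> 'a bop" assume X: "Cauchy X"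
  have d: "dist (rep_bop x) (rep_bop y) = dist x y" for x y :: "'a bop"
    by (simp add: dist_norm norm_bop.rep_eq minus_bop.rep_eq)
  have "Cauchy (\<lambda>n. rep_bop (X n))"
    using X by (simp add: Cauchy_def d)
  then obtain l where "(\<lambda>n. rep_bop (X n)) \<longlonglongrightarrow> l"
    using Cauchy_convergent convergent_def by blast
  then have "X \<longlonglongrightarrow> bop l"
    by (simp add: lim_sequentially bop_inverse flip: d)
  then show "convergent X" by (auto simp: convergent_def)
qed

lift_definition bapp :: "'a::{banach,perfect_space} bop \<Rightarrow> 'a \<Rightarrow> 'a" is blinfun_apply .

lift_definition mk_bop :: "('a::{banach,perfect_space} \<Rightarrow> 'a) \<Rightarrow> 'a bop" is Blinfun .

lemma bapp_mk_bop: "bounded_linear f \<Longrightarrow> bapp (mk_bop f) = f"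
  by transfer (simp add: bounded_linear_Blinfun_apply)

lemma bop_eqI: "(\<And>b. bapp S b = bapp T b) \<Longrightarrow> S = T"
  by transfer (simp add: blinfun_eqI)

lemma bapp_simps [simp]:
  "bapp (S + T) b = bapp S b + bapp T b" "bapp (S - T) b = bapp S b - bapp T b"
  "bapp (r *\<^sub>R S) b = r *\<^sub>R bapp S b" "bapp (- S) b = - bapp S b"
  "bapp (S * T) b = bapp S (bapp T b)" "bapp 1 b = b" "bapp 0 b = 0"
  by (transfer, simp add: blinfun.bilinear_simps)+

lemma norm_bapp: "norm (bapp T b) \<le> norm T * norm b"
  by transfer (rule norm_blinfun)

lemma norm_bop_bound: "0 \<le> c \<Longrightarrow> (\<And>b. norm (bapp T b) \<le> c * norm b) \<Longrightarrow> norm T \<le> c"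
  by transfer (rule norm_blinfun_bound)

lemma bounded_linear_bapp: "bounded_linear (bapp T)"
  by transfer (rule blinfun.bounded_linear_right)

lemma continuous_on_rep_bop: "continuous_on S (\<lambda>t::real. rep_bop (f t :: 'b::{banach,perfect_space} bop)) \<longleftrightarrow> continuous_on S f"
proof -
  have "dist (rep_bop x) (rep_bop y) = dist x y" for x y :: "'b bop"
    by (simp add: dist_norm norm_bop.rep_eq minus_bop.rep_eq)
  then show ?thesis
    by (simp add: continuous_on_iff)
qed

definition lmul :: "'b::cstar_algebra \<Rightarrow> 'b bop" where
  "lmul a = mk_bop (\<lambda>b. a * b)"

lemma bapp_lmul [simp]: "bapp (lmul a) b = a * b"
  unfolding lmul_def by (subst bapp_mk_bop) (auto intro: bounded_linear_mult_right)

lemma lmul_simps: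
  "lmul (a + b) = lmul a + lmul b" "lmul (a - b) = lmul a - lmul b" "lmul (- a) = - lmul a"
  "lmul (a * b) = lmul a * lmul b" "lmul 1 = 1" "lmul (r *\<^sub>R a) = r *\<^sub>R lmul a" "lmul 0 = 0"
  by (rule bop_eqI, simp add: algebra_simps)+

lemma norm_lmul: "norm (lmul a) \<le> norm a"
  by (rule norm_bop_bound) (auto simp: norm_mult_ineq)

text \<open>The effect on a kernel of exchanging its two arguments, see
  \<open>kop_swap\<close>.\<close>

definition cconj :: "'b::cstar_algebra bop \<Rightarrow> 'b bop" where
  "cconj T = mk_bop (\<lambda>b. star (bapp T (star b)))"

lemma bapp_cconj [simp]: "bapp (cconj T) b = star (bapp T (star b))"
proof -
  have "bounded_linear (\<lambda>b. star (bapp T (star b)))"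
    using bounded_linear_compose[OF bounded_linear_star bounded_linear_compose[OF bounded_linear_bapp[of T] bounded_linear_star]]
    by (simp add: o_def)
  then show ?thesis
    unfolding cconj_def by (subst bapp_mk_bop) auto
qed

lemma cconj_simps:
  "cconj (S + T) = cconj S + cconj T" "cconj (S - T) = cconj S - cconj T"
  "cconj (r *\<^sub>R T) = r *\<^sub>R cconj T" "cconj 1 = 1"
  by (rule bop_eqI, simp add: star_add star_diff star_scaleR star_star)+

lemma norm_cconj: "norm (cconj T) \<le> norm T"
  by (rule norm_bop_bound) (auto intro: order_trans[OF norm_bapp])


subsection \<open>One-parameter semigroups in Banach algebras\<close>

lemma norm_exp_minus_first_order:
  fixes x :: "'a::{real_normed_algebra_1,banach}"
  shows "norm (exp x - 1 - x) \<le> (norm x)\<^sup>2 * exp (norm x)"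
proof -
  let ?f = "\<lambda>n. inverse (fact (n + 2)) *\<^sub>R (x ^ (n + 2))"
  let ?g = "\<lambda>n. (norm x)\<^sup>2 * (inverse (fact n) *\<^sub>R norm x ^ n)"
  have sg: "?g sums ((norm x)\<^sup>2 * exp (norm x))"
    using exp_converges[of "norm x"] by (intro sums_mult) simp
  have "norm (?f n) \<le> ?g n" for n
  proof -
    have "norm (?f n) \<le> inverse (fact (n + 2)) * norm x ^ (n + 2)"
      using norm_power_ineq[of x "n + 2"] by (simp del: power_Suc)
    also have "\<dots> \<le> inverse (fact n) * norm x ^ (n + 2)"
      by (intro mult_right_mono le_imp_inverse_le fact_mono) auto
    also have "\<dots> = ?g n" by (simp only: power_add real_scaleR_def mult_ac)
    finally show ?thesis .
  qed
  then have "norm (suminf ?f) \<le> suminf ?g"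
    using sg by (intro norm_suminf_le) (auto simp: sums_iff)
  then show ?thesis
    using sg by (subst exp_first_two_terms) (simp add: sums_iff)
qed

lemma norm_exp_scaleR_minus_first_order:
  fixes L :: "'a::{real_normed_algebra_1,banach}"
  assumes "0 \<le> s" "s \<le> 1"
  shows "norm (exp (s *\<^sub>R L) - 1 - s *\<^sub>R L) \<le> (norm L)\<^sup>2 * exp (norm L) * s\<^sup>2"
proof -
  have "norm (exp (s *\<^sub>R L) - 1 - s *\<^sub>R L) \<le> (s * norm L)\<^sup>2 * exp (s * norm L)"
    using norm_exp_minus_first_order[of "s *\<^sub>R L"] assms by simp
  also have "\<dots> \<le> (s * norm L)\<^sup>2 * exp (norm L)"
    using assms by (intro mult_left_mono) (auto simp: mult_left_le_one_le)
  finally show ?thesis by (simp add: power_mult_distrib mult_ac)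
qed

lemma exp_add_scaleR:
  fixes L :: "'a::{real_normed_algebra_1,banach}"
  shows "exp ((s + t) *\<^sub>R L) = exp (s *\<^sub>R L) * exp (t *\<^sub>R L)"
  by (simp add: scaleR_add_left exp_add_commuting)

lemma norm_exp_scaleR:
  fixes L :: "'a::{real_normed_algebra_1,banach}"
  assumes "0 \<le> s" "norm L \<le> m"
  shows "norm (exp (s *\<^sub>R L)) \<le> exp (m * s)"
proof -
  have "norm (exp (s *\<^sub>R L)) \<le> exp (norm (s *\<^sub>R L))" by (rule norm_exp)
  also have "\<dots> \<le> exp (m * s)"
    using mult_right_mono[OF assms(2,1)] assms(1) by (simp add: mult.commute)
  finally show ?thesis .
qed

text \<open>The factor of \<open>s^2\<close> in the first-order expansion of
  \<open>exp (s L)\<close> for s between 0 and 1.\<close>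

definition exp_remainder :: "'a::{real_normed_algebra_1,banach} \<Rightarrow> real" where
  "exp_remainder L = (norm L)\<^sup>2 * exp (norm L)"

text \<open>The factors are multiplied in reverse order, as they occur in kernels of tensor products.\<close>

lemma product_approx_exp:
  fixes L :: "'a::{real_normed_algebra_1,banach}"
  assumes "0 \<le> C" "d \<le> 1"
    and "\<And>s K. (s, K) \<in> set ks \<Longrightarrow> 0 \<le> s \<and> s \<le> d \<and> norm (K - 1 - s *\<^sub>R L) \<le> C * s\<^sup>2"
  defines "t \<equiv> sum_list (map fst ks)" and "m \<equiv> norm L + C"
  shows "0 \<le> t \<and> norm (prod_list (map snd (rev ks)) - exp (t *\<^sub>R L))
    \<le> (C + exp_remainder L) * d * t * exp (m * t)"
  using assms(3) unfolding t_def
proof (induction ks)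
  case (Cons k ks)
  obtain s K where k: "k = (s, K)" by (cases k)
  define t where "t = sum_list (map fst ks)"
  define P where "P = prod_list (map snd (rev ks))"
  define B where "B = C + exp_remainder L"
  have B: "B \<ge> 0" using assms(1) by (simp add: B_def exp_remainder_def)
  have IH: "0 \<le> t" "norm (P - exp (t *\<^sub>R L)) \<le> B * d * t * exp (m * t)"
    using Cons by (auto simp: t_def P_def B_def)
  have s: "0 \<le> s" "s \<le> d" "norm (K - 1 - s *\<^sub>R L) \<le> C * s\<^sup>2"
    using Cons.prems[of s K] by (auto simp: k)
  have s1: "s \<le> 1" using s assms(2) by simp
  have m: "norm L \<le> m" using assms(1) by (simp add: m_def)
  have "K - exp (s *\<^sub>R L) = (K - 1 - s *\<^sub>R L) - (exp (s *\<^sub>R L) - 1 - s *\<^sub>R L)"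
    by simp
  also have "norm \<dots> \<le> C * s\<^sup>2 + exp_remainder L * s\<^sup>2"
    using norm_exp_scaleR_minus_first_order[OF s(1) s1, of L] s(3)
    by (intro order_trans[OF norm_triangle_ineq4 add_mono]) (simp_all add: exp_remainder_def)
  finally have 1: "norm (K - exp (s *\<^sub>R L)) \<le> B * s\<^sup>2"
    by (simp add: B_def algebra_simps)
  have "K = 1 + s *\<^sub>R L + (K - 1 - s *\<^sub>R L)" by simp
  also have "norm \<dots> \<le> 1 + s * norm L + C * s\<^sup>2"
    using s by (intro norm_triangle_le add_mono order_trans[OF norm_triangle_ineq]) auto
  also have "\<dots> \<le> 1 + s * m"
    using mult_left_le[of s "C * s"] s s1 assms(1) by (simp add: m_def algebra_simps power2_eq_square)
  also have "\<dots> \<le> exp (m * s)"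
    using exp_ge_add_one_self[of "m * s"] by (simp add: mult.commute)
  finally have 2: "norm K \<le> exp (m * s)" .
  \<comment> \<open>Telescoping: one factor at a time is replaced by its exponential. Factors and
    exponentials over time s are at most \<open>exp (m s)\<close>, so the products stay
    bounded.\<close>
  have "P * K - exp ((s + t) *\<^sub>R L) = exp (t *\<^sub>R L) * (K - exp (s *\<^sub>R L)) + (P - exp (t *\<^sub>R L)) * K"
    unfolding add.commute[of s t] exp_add_scaleR by (simp add: algebra_simps)
  also have "norm \<dots> \<le> exp (m * t) * (B * s\<^sup>2) + (B * d * t * exp (m * t)) * exp (m * s)"
    using IH 1 2 norm_exp_scaleR[OF IH(1) m] B s
    by (intro norm_triangle_le add_mono order_trans[OF norm_mult_ineq] mult_mono) auto
  \<comment> \<open>This is where the mesh enters: \<open>s^2\<close> is at most \<open>d s\<close>,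
    and the s add up to the total time.\<close>
  also have "exp (m * t) * (B * s\<^sup>2) \<le> exp (m * (s + t)) * (B * (d * s))"
    using s B IH m norm_ge_zero[of L]
    by (intro mult_mono) (auto simp: power2_eq_square mult_right_mono mult_left_mono simp del: norm_ge_zero)
  also have "exp (m * (s + t)) * (B * (d * s)) + (B * d * t * exp (m * t)) * exp (m * s)
      = B * d * (s + t) * exp (m * (s + t))"
    by (simp add: algebra_simps exp_add)
  finally show ?case
    using IH s by (simp add: k P_def t_def B_def)
qed simp

text \<open>Powers of short-time values bound K on compact intervals, and
  \<open>K t - K s = K s (K (t - s) - 1)\<close> for s below t. Factoring out the smaller time gives
  continuity from both sides.\<close>

lemma semigroup_continuous:
  fixes K :: "real \<Rightarrow> 'a::real_normed_algebra_1"
  assumes K0: "K 0 = 1" and Kadd: "\<And>s t. 0 \<le> s \<Longrightarrow> 0 \<le> t \<Longrightarrow> K (s + t) = K t * K s"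
    and lim: "(K \<longlongrightarrow> 1) (at_right 0)"
  shows "continuous_on {0..} K"
proof -
  have small: "\<exists>d>0. \<forall>r. 0 \<le> r \<and> r < d \<longrightarrow> norm (K r - 1) < e" if e: "e > 0" for e
  proof -
    obtain d where "d > 0" "\<And>r. 0 < r \<Longrightarrow> r < d \<Longrightarrow> dist (K r) 1 < e"
      using tendstoD[OF lim e] by (auto simp: eventually_at_right_field)
    then show ?thesis
      using e K0 by (intro exI[of _ d]) (auto simp: dist_norm le_less)
  qed
  obtain h where h: "h > 0" "\<And>r. 0 \<le> r \<Longrightarrow> r < h \<Longrightarrow> norm (K r - 1) < 1"
    using small[of 1] by auto
  have K2: "norm (K r) \<le> 2" if "0 \<le> r" "r < h" for r
    using h(2)[OF that] norm_triangle_ineq[of "K r - 1" 1] by simp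
  have pow: "K (real n * r) = K r ^ n" if "r \<ge> 0" for n r
  proof (induction n)
    case (Suc n)
    have "K (real (Suc n) * r) = K (real n * r + r)" by (simp add: algebra_simps)
    also have "\<dots> = K r * K (real n * r)" using that by (intro Kadd) auto
    finally show ?case using Suc by simp
  qed (simp add: K0)
  have loc: "\<exists>M>0. \<forall>t. 0 \<le> t \<and> t \<le> T \<longrightarrow> norm (K t) \<le> M" for T
  proof -
    obtain n where n: "T < real n * h" "n > 0"
    proof -
      obtain n where "max T 0 < real n * h"
        using reals_Archimedean3[OF h(1)] by blast
      then show ?thesis
        by (intro that[of n]) (auto intro: gr0I)
    qed
    have "norm (K t) \<le> 2 ^ n" if t: "0 \<le> t" "t \<le> T" for t
    proof -
      have "t / real n < h" using t n by (simp add: divide_less_eq mult.commute)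
      then have "norm (K (t / real n)) ^ n \<le> 2 ^ n"
        using t by (intro power_mono K2) auto
      moreover have "K t = K (t / real n) ^ n"
        using pow[of "t / real n" n] t n by simp
      ultimately show ?thesis
        using norm_power_ineq[of "K (t / real n)" n] by simp
    qed
    then show ?thesis by (intro exI[of _ "2 ^ n"]) auto
  qed
  have step: "norm (K t - K s) \<le> norm (K s) * norm (K (t - s) - 1)" if "0 \<le> s" "s \<le> t" for s t
  proof -
    have "K t - K s = K s * (K (t - s) - 1)"
      using Kadd[of "t - s" s] that by (simp add: algebra_simps)
    then show ?thesis by (simp add: norm_mult_ineq)
  qed
  show ?thesis
    unfolding continuous_on_iff
  proof (intro ballI allI impI)
    fix t e :: real assume t: "t \<in> {0..}" and e: "e > 0"
    obtain M where M: "M > 0" "\<And>r. 0 \<le> r \<Longrightarrow> r \<le> t + 1 \<Longrightarrow> norm (K r) \<le> M"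
      using loc[of "t + 1"] by auto
    obtain d where d: "d > 0" "\<And>r. 0 \<le> r \<Longrightarrow> r < d \<Longrightarrow> norm (K r - 1) < e / M"
      using small[of "e / M"] e M by auto
    have near: "norm (K r - K s) < e" if "0 \<le> s" "s \<le> r" "s \<le> t" "r - s < d" for r s
    proof -
      have "norm (K r - K s) \<le> M * norm (K (r - s) - 1)"
        using step[of s r] M(2)[of s] that
        by (meson mult_right_mono norm_ge_zero order_trans add_increasing2 zero_le_one)
      also have "\<dots> < M * (e / M)"
        using d(2)[of "r - s"] that M by (intro mult_strict_left_mono) auto
      finally show ?thesis using M by simp
    qed
    show "\<exists>d>0. \<forall>x'\<in>{0..}. dist x' t < d \<longrightarrow> dist (K x') (K t) < e"
    proof (intro exI[of _ d] conjI ballI impI d)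
      fix r assume r: "r \<in> {0..}" "dist r t < d"
      show "dist (K r) (K t) < e"
      proof (cases "r \<le> t")
        case True
        then show ?thesis
          using near[of r t] r t by (simp add: dist_norm norm_minus_commute abs_if split: if_splits)
      next
        case False
        then show ?thesis
          using near[of t r] r t by (simp add: dist_norm abs_if split: if_splits)
      qed
    qed
  qed
qed

text \<open>For small h the integral I of K over [0, h] is close to h and thus invertible, and
  \<open>K t * I\<close> is an integral of K over [t, t + h]. Hence K is differentiable with
  \<open>K' = K L\<close>, where \<open>L = (K h - 1) N\<close> and N is a right inverse of
  I.\<close>

lemma continuous_semigroup_exp:
  fixes K :: "real \<Rightarrow> 'a::{real_normed_algebra_1,banach}"
  assumes K0: "K 0 = 1" and Kadd: "\<And>s t. 0 \<le> s \<Longrightarrow> 0 \<le> t \<Longrightarrow> K (s + t) = K t * K s"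
    and cont: "continuous_on {0..} K"
  obtains L where "\<And>t. 0 \<le> t \<Longrightarrow> K t = exp (t *\<^sub>R L)"
proof -
  obtain h where h: "h > 0" and Kh: "\<And>r. 0 \<le> r \<Longrightarrow> r \<le> h \<Longrightarrow> norm (K r - 1) \<le> 1/2"
  proof -
    obtain d where d: "d > 0" "\<And>r. 0 \<le> r \<Longrightarrow> dist r 0 < d \<Longrightarrow> dist (K r) (K 0) < 1/2"
      using cont unfolding continuous_on_iff by (metis atLeast_iff half_gt_zero order_refl zero_less_one)
    show ?thesis
      by (rule that[of "d/2"]) (use d K0 in \<open>auto simp: dist_norm less_imp_le\<close>)
  qed
  have contI: "continuous_on {a..b} K" if "0 \<le> a" for a b
    by (rule continuous_on_subset[OF cont]) (use that in auto)
  define I where "I = integral {0..h} K"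
  have "h *\<^sub>R 1 - I = integral {0..h} (\<lambda>r. 1 - K r)"
    using h by (simp add: I_def integral_diff integrable_continuous_interval contI)
  also have "norm \<dots> \<le> (1/2) * (h - 0)"
    using h Kh by (intro integral_bound continuous_intros contI) (auto simp: norm_minus_commute)
  finally have I: "norm (h *\<^sub>R 1 - I) \<le> h / 2" by simp
  have "1 - (1/h) *\<^sub>R I = (1/h) *\<^sub>R (h *\<^sub>R 1 - I)"
    using h by (simp add: algebra_simps)
  then have "norm (1 - (1/h) *\<^sub>R I) = norm (h *\<^sub>R 1 - I) / h"
    using h by simp
  also have "\<dots> \<le> 1/2" using I h by (simp add: divide_simps)
  finally obtain N0 where "((1/h) *\<^sub>R I) * N0 = 1"
    using neumann_inverse[of "(1/h) *\<^sub>R I"] by auto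
  then obtain N where N: "I * N = 1"
    by (metis mult_scaleR_left mult_scaleR_right)
  define L where "L = (K h - 1) * N"
  define F where "F u = integral {0..u} K" for u
  have KF: "K t = (F (t + h) - F t) * N" if t: "0 \<le> t" for t
  proof -
    have "K t * I = integral {0..h} (\<lambda>r. K t * K r)"
      unfolding I_def
      using integral_linear[OF integrable_continuous_interval[OF contI] bounded_linear_mult_right[of "K t"], of 0 h]
      by (simp add: o_def)
    also have "\<dots> = integral {0..h} (K \<circ> (+) t)"
      using t by (intro integral_cong) (simp add: Kadd add.commute[of t])
    also have "\<dots> = integral {0 + t..h + t} K"
      by (rule integral_shift_Icc_real)
    also have "\<dots> = F (t + h) - F t"
      using Henstock_Kurzweil_Integration.integral_combine[of 0 t "t + h" K] t h
      by (simp add: F_def integrable_continuous_interval contI add.commute algebra_simps)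
    finally have "K t * I * N = (F (t + h) - F t) * N" by simp
    then show ?thesis by (simp add: mult.assoc N)
  qed
  have dF: "(F has_vector_derivative K u) (at u within {0..T})" if "0 \<le> u" "u \<le> T" for u T
    unfolding F_def[abs_def] using that by (intro integral_has_vector_derivative contI) auto
  have dK: "(K has_vector_derivative K t * L) (at t within {0..T})" if t: "0 \<le> t" "t \<le> T" for t T
  proof -
    have "((\<lambda>u. u + h) has_vector_derivative 1) (at t within {0..T})"
      by (auto intro!: derivative_eq_intros)
    moreover have "(F has_vector_derivative K (t + h)) (at (t + h) within (\<lambda>u. u + h) ` {0..T})"
      by (rule has_vector_derivative_within_subset[OF dF[of "t + h" "T + h"]]) (use t h in auto)
    ultimately have "((F \<circ> (\<lambda>u. u + h)) has_vector_derivative 1 *\<^sub>R K (t + h)) (at t within {0..T})"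
      by (rule vector_diff_chain_within)
    then have "((\<lambda>u. F (u + h)) has_vector_derivative K (t + h)) (at t within {0..T})"
      by (simp add: o_def)
    then have "((\<lambda>u. (F (u + h) - F u) * N) has_vector_derivative (K (t + h) - K t) * N) (at t within {0..T})"
      by (intro bounded_linear.has_vector_derivative[OF bounded_linear_mult_left]
          has_vector_derivative_diff dF t)
    moreover have "(K (t + h) - K t) * N = K t * L"
      using Kadd[of h t] t h by (simp add: L_def algebra_simps add.commute)
    ultimately show ?thesis
      using t KF by (intro has_vector_derivative_transform[of t "{0..T}" K]) auto
  qed
  have "K T = exp (T *\<^sub>R L)" if T: "0 \<le> T" for T
  proof -
    have "((\<lambda>t. K t * exp (t *\<^sub>R (- L))) has_vector_derivative 0) (at t within {0..T})"
      if "t \<in> {0..T}" for t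
    proof -
      have "((\<lambda>t. K t * exp (t *\<^sub>R (- L))) has_vector_derivative
          K t * ((- L) * exp (t *\<^sub>R (- L))) + (K t * L) * exp (t *\<^sub>R (- L))) (at t within {0..T})"
        using that by (intro has_vector_derivative_mult dK
            has_vector_derivative_at_within[OF exp_scaleR_has_vector_derivative_left]) auto
      then show ?thesis by (simp add: mult.assoc)
    qed
    then obtain c where c: "\<And>t. t \<in> {0..T} \<Longrightarrow> K t * exp (t *\<^sub>R (- L)) = c"
      using has_vector_derivative_zero_constant[of "{0..T}" "\<lambda>t. K t * exp (t *\<^sub>R (- L))"]
      by (auto simp: convex_real_interval)
    have "K T * exp (T *\<^sub>R (- L)) = 1"
      using c[of T] c[of 0] T K0 by simp
    then have "K T * (exp (T *\<^sub>R (- L)) * exp (T *\<^sub>R L)) = exp (T *\<^sub>R L)"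
      by (simp flip: mult.assoc)
    moreover have "exp (T *\<^sub>R (- L)) * exp (T *\<^sub>R L) = 1"
      using exp_minus_inverse[of "- (T *\<^sub>R L)"] by simp
    ultimately show ?thesis by simp
  qed
  then show ?thesis using that by blast
qed

text \<open>Comparing first-order expansions bounds \<open>s norm (L - L')\<close> by a multiple of
  \<open>s^2\<close>.\<close>

lemma exp_scaleR_inject:
  fixes L L' :: "'a::{real_normed_algebra_1,banach}"
  assumes "\<And>t. 0 \<le> t \<Longrightarrow> exp (t *\<^sub>R L) = exp (t *\<^sub>R L')"
  shows "L = L'"
proof -
  define C where "C = exp_remainder L + exp_remainder L'"
  have "norm (L - L') \<le> C * s" if s: "0 < s" "s \<le> 1" for s
  proof -
    have "s *\<^sub>R (L - L') = (exp (s *\<^sub>R L') - 1 - s *\<^sub>R L') - (exp (s *\<^sub>R L) - 1 - s *\<^sub>R L)"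
      using assms[of s] s by (simp add: algebra_simps)
    also have "norm \<dots> \<le> exp_remainder L' * s\<^sup>2 + exp_remainder L * s\<^sup>2"
      unfolding exp_remainder_def using s
      by (intro order_trans[OF norm_triangle_ineq4] add_mono norm_exp_scaleR_minus_first_order) auto
    also have "norm (s *\<^sub>R (L - L')) = s * norm (L - L')"
      using s by (simp del: scaleR_diff_right)
    also have "exp_remainder L' * s\<^sup>2 + exp_remainder L * s\<^sup>2 = s * (C * s)"
      by (simp add: C_def algebra_simps power2_eq_square)
    finally show ?thesis using s by simp
  qed
  then have "\<forall>\<^sub>F s in at_right 0. norm (L - L') \<le> C * s"
    by (auto simp: eventually_at_right_field intro!: exI[of _ 1])
  moreover have "((\<lambda>s. C * s) \<longlongrightarrow> C * 0) (at_right 0)"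
    by (intro tendsto_intros)
  ultimately have "norm (L - L') \<le> C * 0"
    by (intro tendsto_lowerbound[of _ "C * 0" "at_right (0::real)"]) auto
  then show ?thesis by simp
qed


subsection \<open>Kernels in product systems\<close>

context product_system
begin

abbreviation car :: "real \<Rightarrow> 'e set" where
  "car t \<equiv> mcarrier (fiber P t)"

text \<open>The kernel of two elements at a single time. Unlike \<open>kernel\<close> it also
  applies to elements that do not come from units, and its values can be multiplied and
  exponentiated.\<close>

definition kop :: "real \<Rightarrow> 'e \<Rightarrow> 'e \<Rightarrow> 'b bop" where
  "kop t f g = mk_bop (\<lambda>b. minner (fiber P t) f (lact (fiber P t) b g))"

lemma bimodule_fiber: "0 \<le> t \<Longrightarrow> bimodule (fiber P t)"
  by (rule hilbert_bimodule.axioms(1)[OF fiber_hilbert])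

lemmas madd_car = bimodule.madd_closed[OF bimodule_fiber]
  and mzero_car = bimodule.mzero_closed[OF bimodule_fiber]
  and lact_car = bimodule.lact_closed[OF bimodule_fiber]
  and ract_car = bimodule.ract_closed[OF bimodule_fiber]
  and mdiff_car = hilbert_bimodule.mdiff_closed[OF fiber_hilbert]

lemma bapp_kop:
  "\<lbrakk>0 \<le> t; f \<in> car t; g \<in> car t\<rbrakk> \<Longrightarrow> bapp (kop t f g) b = minner (fiber P t) f (lact (fiber P t) b g)"
  unfolding kop_def
  by (subst bapp_mk_bop) (auto intro: hilbert_bimodule.bounded_linear_minner_lact[OF fiber_hilbert])

lemma rep_bop_kop: "rep_bop (kop t (u t) (v t)) = kernel P u v t"
  by (simp add: kop_def kernel_def mk_bop.rep_eq)

lemma kop_madd_left: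
  "\<lbrakk>0 \<le> t; f \<in> car t; f' \<in> car t; g \<in> car t\<rbrakk> \<Longrightarrow> kop t (madd (fiber P t) f f') g = kop t f g + kop t f' g"
  by (rule bop_eqI)
    (simp add: bapp_kop madd_car lact_car hilbert_bimodule.minner_madd_left[OF fiber_hilbert])

lemma kop_mdiff_left:
  "\<lbrakk>0 \<le> t; f \<in> car t; f' \<in> car t; g \<in> car t\<rbrakk> \<Longrightarrow> kop t (mdiff (fiber P t) f f') g = kop t f g - kop t f' g"
  by (rule bop_eqI)
    (simp add: bapp_kop mdiff_car lact_car hilbert_bimodule.minner_mdiff[OF fiber_hilbert])

lemma kop_lact_left:
  "\<lbrakk>0 \<le> t; f \<in> car t; g \<in> car t\<rbrakk> \<Longrightarrow> kop t (lact (fiber P t) a f) g = kop t f g * lmul (star a)"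
  by (rule bop_eqI)
    (simp add: bapp_kop lact_car hilbert_bimodule.minner_lact[OF fiber_hilbert]
      bimodule.lact_mult[OF bimodule_fiber])

lemma kop_ract_left:
  "\<lbrakk>0 \<le> t; f \<in> car t; g \<in> car t\<rbrakk> \<Longrightarrow> kop t (ract (fiber P t) f c) g = lmul (star c) * kop t f g"
  by (rule bop_eqI)
    (simp add: bapp_kop lact_car ract_car hilbert_bimodule.minner_ract_left[OF fiber_hilbert])

lemma kop_mzero_left:
  assumes "0 \<le> t" "g \<in> car t"
  shows "kop t (mzero (fiber P t)) g = 0"
proof -
  have "mzero (fiber P t) = madd (fiber P t) (mzero (fiber P t)) (mzero (fiber P t))"
    using assms by (simp add: bimodule.madd_zero[OF bimodule_fiber] mzero_car)
  then have "kop t (mzero (fiber P t)) g = kop t (mzero (fiber P t)) g + kop t (mzero (fiber P t)) g"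
    using assms by (metis kop_madd_left mzero_car)
  then show ?thesis by simp
qed

lemma kop_swap:
  assumes "0 \<le> t" "f \<in> car t" "g \<in> car t"
  shows "kop t g f = cconj (kop t f g)"
proof (rule bop_eqI)
  fix b
  have "bapp (cconj (kop t f g)) b = minner (fiber P t) (lact (fiber P t) (star b) g) f"
    using assms by (simp add: bapp_kop lact_car hilbert_bimodule.minner_star[OF fiber_hilbert])
  also have "\<dots> = bapp (kop t g f) b"
    using assms by (simp add: bapp_kop hilbert_bimodule.minner_lact[OF fiber_hilbert] star_star)
  finally show "bapp (kop t g f) b = bapp (cconj (kop t f g)) b" by simp
qed

lemma kop_mdiff_right:
  assumes "0 \<le> t" "f \<in> car t" "g \<in> car t" "g' \<in> car t"
  shows "kop t f (mdiff (fiber P t) g g') = kop t f g - kop t f g'"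
  using assms kop_swap[of t "mdiff (fiber P t) g g'" f] kop_swap[of t g f] kop_swap[of t g' f]
  by (simp add: kop_mdiff_left mdiff_car cconj_simps)

lemma norm_kop:
  assumes "0 \<le> t" "f \<in> car t" "g \<in> car t"
  shows "norm (kop t f g) \<le> mnorm (fiber P t) f * mnorm (fiber P t) g"
proof (rule norm_bop_bound)
  interpret hilbert_bimodule "fiber P t" by (rule fiber_hilbert[OF assms(1)])
  fix b
  have "norm (bapp (kop t f g) b) \<le> mnorm (fiber P t) f * mnorm (fiber P t) (lact (fiber P t) b g)"
    using assms by (simp add: bapp_kop cauchy_schwarz lact_car)
  also have "\<dots> \<le> mnorm (fiber P t) f * (norm b * mnorm (fiber P t) g)"
    using assms by (intro mult_left_mono mnorm_lact) auto
  finally show "norm (bapp (kop t f g) b) \<le> mnorm (fiber P t) f * mnorm (fiber P t) g * norm b"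
    by (simp add: mult_ac)
next
  show "0 \<le> mnorm (fiber P t) f * mnorm (fiber P t) g"
    using assms by (simp add: hilbert_bimodule.mnorm_nonneg[OF fiber_hilbert])
qed

lemma minner_eq_bapp_kop:
  assumes "0 \<le> t" "f \<in> car t" "g \<in> car t"
  shows "minner (fiber P t) f g = bapp (kop t f g) 1"
  using assms by (simp add: bapp_kop bimodule.lact_one[OF bimodule_fiber])

lemma mnorm_square_le_kop:
  assumes "0 \<le> t" "f \<in> car t"
  shows "(mnorm (fiber P t) f)\<^sup>2 \<le> norm (kop t f f)"
  using assms norm_bapp[of "kop t f f" 1]
  by (simp add: hilbert_bimodule.mnorm_square[OF fiber_hilbert] minner_eq_bapp_kop)

lemma mnorm_mdiff_le_kop:
  assumes "0 \<le> t" "f \<in> car t" "g \<in> car t"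
  shows "(mnorm (fiber P t) (mdiff (fiber P t) f g))\<^sup>2
    \<le> norm (kop t f f - kop t f g - kop t g f + kop t g g)"
  using assms mnorm_square_le_kop[of t "mdiff (fiber P t) f g"]
  by (simp add: mdiff_car kop_mdiff_left kop_mdiff_right algebra_simps)

lemma eq_of_kop_eq:
  assumes "0 \<le> t" "f \<in> car t" "g \<in> car t"
    and "kop t f f = kop t f g" "kop t g f = kop t g g"
  shows "f = g"
  using mnorm_mdiff_le_kop[OF assms(1-3)] assms
  by (intro hilbert_bimodule.eq_of_mnorm_mdiff[OF fiber_hilbert]) auto

lemma kop_tendsto:
  assumes t: "0 \<le> t" and X: "\<forall>\<^sub>F n in sequentially. X n \<in> car t" and x: "x \<in> car t"
    and lim: "mlim (fiber P t) X l"
  shows "(\<lambda>n. kop t x (X n)) \<longlonglongrightarrow> kop t x l"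
proof -
  interpret hilbert_bimodule "fiber P t" by (rule fiber_hilbert[OF t])
  have l: "l \<in> car t" using lim by (rule mlim_carrier)
  have "\<forall>\<^sub>F n in sequentially. norm (kop t x (X n) - kop t x l)
      \<le> mnorm (fiber P t) x * mnorm (fiber P t) (mdiff (fiber P t) (X n) l)"
    using X by eventually_elim (use t x l norm_kop in \<open>simp add: mdiff_closed flip: kop_mdiff_right\<close>)
  moreover have "(\<lambda>n. mnorm (fiber P t) x * mnorm (fiber P t) (mdiff (fiber P t) (X n) l)) \<longlonglongrightarrow> 0"
    using lim by (auto simp: mlim_def intro: tendsto_mult_right_zero)
  ultimately have "(\<lambda>n. kop t x (X n) - kop t x l) \<longlonglongrightarrow> 0"
    by (rule Lim_null_comparison)
  then show ?thesis by (simp add: LIM_zero_iff)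
qed

lemma tens_car: "\<lbrakk>0 \<le> t; 0 \<le> s; u \<in> car t; v \<in> car s\<rbrakk> \<Longrightarrow> tens P t s u v \<in> car (t + s)"
  using tens_product[of t s] by (simp add: inner_tensor_product_def)

text \<open>The inner product of the tensor product evaluates the left factors first and puts the
  result between the right ones, so kernels compose, the later factor being outermost.\<close>

lemma kop_tens:
  assumes ts: "0 \<le> t" "0 \<le> s" and "u \<in> car t" "v \<in> car s" "u' \<in> car t" "v' \<in> car s"
  shows "kop (t + s) (tens P t s u v) (tens P t s u' v') = kop s v v' * kop t u u'"
proof (rule bop_eqI)
  fix b
  have l: "lact (fiber P (t + s)) b (tens P t s u' v') = tens P t s (lact (fiber P t) b u') v'"
    and i: "minner (fiber P (t + s)) (tens P t s u v) (tens P t s w v')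
      = minner (fiber P s) v (lact (fiber P s) (minner (fiber P t) u w) v')" if "w \<in> car t" for w
    using tens_product[OF ts] assms that by (simp_all add: inner_tensor_product_def)
  show "bapp (kop (t + s) (tens P t s u v) (tens P t s u' v')) b = bapp (kop s v v' * kop t u u') b"
    using assms by (simp add: bapp_kop tens_car l[OF assms(5)] i lact_car)
qed

lemma iota_car: "iota P a \<in> car 0"
  using iota_unitary by (auto simp: bilinear_unitary_def self_bimod_def bij_betw_def)

lemma kop_iota_one: "kop 0 (iota P 1) (iota P 1) = 1"
proof (rule bop_eqI)
  fix b
  have "\<forall>x a. iota P (a * x) = lact (fiber P 0) a (iota P x)"
    using iota_unitary by (simp add: bilinear_unitary_def self_bimod_def)
  then have "lact (fiber P 0) b (iota P 1) = iota P b"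
    by (metis mult.right_neutral)
  moreover have "minner (fiber P 0) (iota P 1) (iota P b) = star 1 * b"
    using iota_unitary by (simp add: bilinear_unitary_def self_bimod_def)
  ultimately show "bapp (kop 0 (iota P 1) (iota P 1)) b = bapp 1 b"
    by (simp add: bapp_kop iota_car)
qed

lemma unit_car: "\<lbrakk>is_unit_of P u; 0 \<le> t\<rbrakk> \<Longrightarrow> u t \<in> car t"
  by (auto simp: is_unit_of_def PiE_def Pi_def)

lemma unit_zero: "is_unit_of P u \<Longrightarrow> u 0 = iota P 1"
  by (simp add: is_unit_of_def)

lemma unit_tens: "\<lbrakk>is_unit_of P u; 0 \<le> t; 0 \<le> s\<rbrakk> \<Longrightarrow> tens P t s (u t) (u s) = u (t + s)"
  by (simp add: is_unit_of_def)

lemma unit_eqI: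
  assumes "is_unit_of P u" "is_unit_of P v" "\<And>t. 0 \<le> t \<Longrightarrow> u t = v t"
  shows "u = v"
proof (rule PiE_ext)
  show "u \<in> (\<Pi>\<^sub>E t\<in>{0..}. car t)" "v \<in> (\<Pi>\<^sub>E t\<in>{0..}. car t)"
    using assms by (simp_all add: is_unit_of_def)
qed (use assms in auto)

end


subsection \<open>Continuous sets of units\<close>

locale pointed_product_system = product_system P
  for P :: "('b::cstar_algebra, 'e) prod_sys" +
  fixes \<omega> :: "real \<Rightarrow> 'e"
  assumes omega_cont: "continuous_unit P \<omega>"
begin

abbreviation \<U> :: "(real \<Rightarrow> 'e) set" where
  "\<U> \<equiv> U_set P \<omega>"

lemma omega_unit: "is_unit_of P \<omega>"
  using omega_cont by (simp add: continuous_unit_def continuous_unit_set_def)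

lemma tens_iota_iota: "tens P 0 0 (iota P 1) (iota P 1) = iota P 1"
  using unit_tens[OF omega_unit, of 0 0] by (simp add: unit_zero[OF omega_unit])

text \<open>Tensoring with \<open>iota P 1\<close> is an isometry and, by associativity, idempotent, hence trivial.\<close>

lemma tens_iota_right:
  assumes "0 \<le> t" "x \<in> car t"
  shows "tens P t 0 x (iota P 1) = x"
proof -
  define V where "V y = tens P t 0 y (iota P 1)" for y
  have car: "V y \<in> car t" if "y \<in> car t" for y
    using tens_car[of t 0 y "iota P 1"] assms that by (simp add: V_def iota_car)
  have iso: "kop t (V y) (V z) = kop t y z" if "y \<in> car t" "z \<in> car t" for y z
    using kop_tens[of t 0 y "iota P 1" z "iota P 1"] assms that
    by (simp add: V_def iota_car kop_iota_one)
  have idem: "V (V x) = V x"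
    using tens_assoc[of t 0 0 x "iota P 1" "iota P 1"] assms
    by (simp add: V_def iota_car tens_iota_iota)
  have "V x = x"
    using iso[of "V x" x] iso[of x "V x"] iso[of x x] assms car[of x] car[of "V x"]
    by (intro eq_of_kop_eq[of t]) (simp_all add: idem)
  then show ?thesis by (simp add: V_def)
qed

lemma tens_iota_left:
  assumes "0 \<le> t" "x \<in> car t"
  shows "tens P 0 t (iota P 1) x = x"
proof -
  define V where "V y = tens P 0 t (iota P 1) y" for y
  have car: "V y \<in> car t" if "y \<in> car t" for y
    using tens_car[of 0 t "iota P 1" y] assms that by (simp add: V_def iota_car)
  have iso: "kop t (V y) (V z) = kop t y z" if "y \<in> car t" "z \<in> car t" for y z
    using kop_tens[of 0 t "iota P 1" y "iota P 1" z] assms that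
    by (simp add: V_def iota_car kop_iota_one)
  have idem: "V (V x) = V x"
    using tens_assoc[of 0 0 t "iota P 1" "iota P 1" x] assms
    by (simp add: V_def iota_car tens_iota_iota)
  have "V x = x"
    using iso[of "V x" x] iso[of x "V x"] iso[of x x] assms car[of x] car[of "V x"]
    by (intro eq_of_kop_eq[of t]) (simp_all add: idem)
  then show ?thesis by (simp add: V_def)
qed

lemma U_unit: "x \<in> \<U> \<Longrightarrow> is_unit_of P x"
  by (simp add: U_set_def continuous_unit_def continuous_unit_set_def)

lemmas U_car = unit_car[OF U_unit] and U_zero = unit_zero[OF U_unit] and U_tens = unit_tens[OF U_unit]

lemma omega_in_U: "\<omega> \<in> \<U>"
  using omega_cont by (simp add: U_set_def continuous_unit_def)

lemma continuous_kernel_iff: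
  "continuous_on {0..} (kernel P u v) \<longleftrightarrow> continuous_on {0..} (\<lambda>t. kop t (u t) (v t))"
  by (subst continuous_on_rep_bop[symmetric]) (simp add: rep_bop_kop)

lemma continuous_on_cconj: "continuous_on S f \<Longrightarrow> continuous_on S (\<lambda>t::real. cconj (f t))"
  by (rule bounded_linear.continuous_on[of cconj])
    (auto intro!: bounded_linear_intro[of _ 1] simp: cconj_simps norm_cconj)

lemma U_I:
  assumes u: "is_unit_of P u"
    and "continuous_on {0..} (\<lambda>t. kop t (u t) (u t))" "continuous_on {0..} (\<lambda>t. kop t (u t) (\<omega> t))"
  shows "u \<in> \<U>"
proof -
  have "continuous_on {0..} (\<lambda>t. cconj (kop t (u t) (\<omega> t)))"
    by (intro continuous_on_cconj assms)
  then have "continuous_on {0..} (\<lambda>t. kop t (\<omega> t) (u t))"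
    by (rule continuous_on_eq) (auto simp: u omega_unit unit_car intro!: kop_swap[symmetric])
  then show ?thesis
    using assms omega_cont
    by (auto simp: U_set_def continuous_unit_def continuous_unit_set_def continuous_kernel_iff)
qed

lemma kop_units_add:
  assumes "is_unit_of P x" "is_unit_of P y" "0 \<le> s" "0 \<le> t"
  shows "kop (s + t) (x (s + t)) (y (s + t)) = kop t (x t) (y t) * kop s (x s) (y s)"
  using kop_tens[of s t "x s" "x t" "y s" "y t"] assms
  by (simp add: unit_car unit_tens)

lemma kop_units_zero: "is_unit_of P x \<Longrightarrow> is_unit_of P y \<Longrightarrow> kop 0 (x 0) (y 0) = 1"
  by (simp add: unit_zero kop_iota_one)

text \<open>Membership in \<U> gives continuity only against \<omega> and against the unit itself.
  These kernels make \<open>x t - \<omega> t\<close> small in norm, so that \<omega> can replace x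
  in the kernel of x and y. In this way \<U> is a continuous set as a whole.\<close>

lemma U_kop_tendsto:
  assumes x: "x \<in> \<U>" and y: "y \<in> \<U>"
  shows "((\<lambda>t. kop t (x t) (y t)) \<longlongrightarrow> 1) (at_right 0)"
proof -
  have lim0: "((\<lambda>t. kop t (u t) (v t)) \<longlongrightarrow> 1) (at_right 0)"
    if "continuous_on {0..} (kernel P u v)" "is_unit_of P u" "is_unit_of P v" for u v
  proof -
    have "((\<lambda>t. kop t (u t) (v t)) \<longlongrightarrow> kop 0 (u 0) (v 0)) (at 0 within {0..})"
      using that(1)[unfolded continuous_kernel_iff] by (auto simp: continuous_on_def)
    then show ?thesis
      using that by (simp add: kop_units_zero) (erule tendsto_within_subset, auto)
  qed
  have lims: "((\<lambda>t. kop t (x t) (x t)) \<longlongrightarrow> 1) (at_right 0)" "((\<lambda>t. kop t (y t) (y t)) \<longlongrightarrow> 1) (at_right 0)"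
    "((\<lambda>t. kop t (x t) (\<omega> t)) \<longlongrightarrow> 1) (at_right 0)" "((\<lambda>t. kop t (\<omega> t) (x t)) \<longlongrightarrow> 1) (at_right 0)"
    "((\<lambda>t. kop t (\<omega> t) (\<omega> t)) \<longlongrightarrow> 1) (at_right 0)" "((\<lambda>t. kop t (\<omega> t) (y t)) \<longlongrightarrow> 1) (at_right 0)"
    using x y omega_in_U
    by (intro lim0; simp add: U_set_def continuous_unit_def continuous_unit_set_def)+
  define g where "g t = sqrt (norm (kop t (x t) (x t) - kop t (x t) (\<omega> t) - kop t (\<omega> t) (x t) + kop t (\<omega> t) (\<omega> t)))" for t
  define e where "e t = g t * sqrt (norm (kop t (y t) (y t))) + norm (kop t (\<omega> t) (y t) - 1)" for t
  have "(g \<longlongrightarrow> sqrt (norm (1 - 1 - 1 + 1 :: 'b bop))) (at_right 0)"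
    unfolding g_def by (intro tendsto_intros lims)
  then have "(e \<longlongrightarrow> sqrt (norm (1 - 1 - 1 + 1 :: 'b bop)) * sqrt (norm (1 :: 'b bop)) + norm (1 - 1 :: 'b bop)) (at_right 0)"
    unfolding e_def by (intro tendsto_intros lims)
  then have e: "(e \<longlongrightarrow> 0) (at_right 0)" by simp
  have "norm (kop t (x t) (y t) - 1) \<le> e t" if t: "0 < t" for t
  proof -
    have c: "x t \<in> car t" "y t \<in> car t" "\<omega> t \<in> car t" "0 \<le> t"
      using x y omega_unit t by (auto simp: U_car unit_car)
    have "mnorm (fiber P t) (mdiff (fiber P t) (x t) (\<omega> t)) \<le> g t"
      unfolding g_def using mnorm_mdiff_le_kop[OF c(4,1,3)] by (rule real_le_rsqrt)
    moreover have "mnorm (fiber P t) (y t) \<le> sqrt (norm (kop t (y t) (y t)))"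
      using mnorm_square_le_kop[OF c(4,2)] by (rule real_le_rsqrt)
    moreover have "norm (kop t (mdiff (fiber P t) (x t) (\<omega> t)) (y t))
        \<le> mnorm (fiber P t) (mdiff (fiber P t) (x t) (\<omega> t)) * mnorm (fiber P t) (y t)"
      using c by (intro norm_kop mdiff_car)
    ultimately have "norm (kop t (mdiff (fiber P t) (x t) (\<omega> t)) (y t)) \<le> g t * sqrt (norm (kop t (y t) (y t)))"
      by (meson order_trans mult_mono hilbert_bimodule.mnorm_nonneg[OF fiber_hilbert[OF c(4)]])
    moreover have eq: "kop t (x t) (y t) - 1 = kop t (mdiff (fiber P t) (x t) (\<omega> t)) (y t) + (kop t (\<omega> t) (y t) - 1)"
      using c by (simp add: kop_mdiff_left)
    ultimately show ?thesis
      unfolding e_def eq by (intro norm_triangle_le add_right_mono)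
  qed
  then have "\<forall>\<^sub>F t in at_right 0. norm (kop t (x t) (y t) - 1) \<le> e t"
    by (auto simp: eventually_at_right_field intro!: exI[of _ 1])
  from Lim_null_comparison[OF this e] show ?thesis
    by (simp add: LIM_zero_iff)
qed

text \<open>The generator of the kernel semigroup of x and y, characterized by the exponential
  formula. On \<U> it exists by \<open>kop_exp_gen\<close> and is unique by
  \<open>exp_scaleR_inject\<close>.\<close>

definition gen :: "(real \<Rightarrow> 'e) \<Rightarrow> (real \<Rightarrow> 'e) \<Rightarrow> 'b bop" where
  "gen x y = (SOME L. \<forall>t\<ge>0. kop t (x t) (y t) = exp (t *\<^sub>R L))"

lemma kop_exp_gen:
  assumes "x \<in> \<U>" "y \<in> \<U>" "0 \<le> t"
  shows "kop t (x t) (y t) = exp (t *\<^sub>R gen x y)"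
proof -
  have K: "kop 0 (x 0) (y 0) = 1" "\<And>s t. 0 \<le> s \<Longrightarrow> 0 \<le> t \<Longrightarrow>
      kop (s + t) (x (s + t)) (y (s + t)) = kop t (x t) (y t) * kop s (x s) (y s)"
    using assms by (auto simp: kop_units_zero kop_units_add U_unit)
  then have "continuous_on {0..} (\<lambda>t. kop t (x t) (y t))"
    using U_kop_tendsto[OF assms(1,2)] by (rule semigroup_continuous)
  then obtain L where "\<And>t. 0 \<le> t \<Longrightarrow> kop t (x t) (y t) = exp (t *\<^sub>R L)"
    using continuous_semigroup_exp[of "\<lambda>t. kop t (x t) (y t)"] K by blast
  then have "\<exists>L. \<forall>t\<ge>0. kop t (x t) (y t) = exp (t *\<^sub>R L)" by blast
  from someI_ex[OF this] show ?thesis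
    using assms(3) by (simp add: gen_def)
qed

lemma gen_eqI:
  assumes "x \<in> \<U>" "y \<in> \<U>" "\<And>t. 0 \<le> t \<Longrightarrow> kop t (x t) (y t) = exp (t *\<^sub>R L)"
  shows "gen x y = L"
proof (rule exp_scaleR_inject)
  fix t :: real assume "0 \<le> t"
  then show "exp (t *\<^sub>R gen x y) = exp (t *\<^sub>R L)"
    using kop_exp_gen[OF assms(1,2)] assms(3) by metis
qed

text \<open>Testing against x and y themselves makes all four kernels in the norm of
  \<open>x t - y t\<close> agree.\<close>

lemma U_eqI:
  assumes "x \<in> \<U>" "y \<in> \<U>" "\<And>\<xi>. \<xi> \<in> \<U> \<Longrightarrow> gen x \<xi> = gen y \<xi>"
  shows "x = y"
proof (rule unit_eqI)
  fix t :: real assume t: "0 \<le> t"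
  show "x t = y t"
  proof (rule eq_of_kop_eq[OF t])
    show c: "x t \<in> car t" "y t \<in> car t"
      using assms t by (auto simp: U_car)
    have 1: "kop t (x t) (x t) = kop t (y t) (x t)" "kop t (x t) (y t) = kop t (y t) (y t)"
      using assms t by (simp_all add: kop_exp_gen)
    show 2: "kop t (y t) (x t) = kop t (y t) (y t)"
      using kop_swap[OF t c] kop_swap[OF t c(2) c(2)] 1 by simp
    show "kop t (x t) (x t) = kop t (x t) (y t)"
      using 1 2 by simp
  qed
qed (use assms in \<open>auto simp: U_unit\<close>)


subsection \<open>Tensor products along partitions\<close>

text \<open>A partition is encoded by the list of its cell lengths, where length zero is allowed;
  the product is nested to the right.\<close>

primrec ptens :: "(real \<Rightarrow> 'e) \<Rightarrow> real list \<Rightarrow> 'e" where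
  "ptens y [] = iota P 1"
| "ptens y (a # ts) = tens P a (sum_list ts) (y a) (ptens y ts)"

abbreviation nonneg :: "real list \<Rightarrow> bool" where
  "nonneg ts \<equiv> set ts \<subseteq> {0..}"

lemma sum_list_nonneg': "nonneg ts \<Longrightarrow> 0 \<le> sum_list ts"
  by (intro sum_list_nonneg) auto

lemma ptens_car:
  assumes "\<And>s. 0 \<le> s \<Longrightarrow> y s \<in> car s"
  shows "nonneg ts \<Longrightarrow> ptens y ts \<in> car (sum_list ts)"
  by (induction ts) (auto simp: iota_car assms sum_list_nonneg' intro!: tens_car)

lemma ptens_append:
  assumes y: "\<And>s. 0 \<le> s \<Longrightarrow> y s \<in> car s"
  shows "nonneg ts \<Longrightarrow> nonneg ss \<Longrightarrow>
    ptens y (ts @ ss) = tens P (sum_list ts) (sum_list ss) (ptens y ts) (ptens y ss)"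
proof (induction ts)
  case Nil
  then show ?case
    by (simp add: tens_iota_left ptens_car[OF y] sum_list_nonneg')
next
  case (Cons a ts)
  then show ?case
    by (simp add: tens_assoc y ptens_car[OF y] sum_list_nonneg')
qed

lemma ptens_singleton: "0 \<le> a \<Longrightarrow> y a \<in> car a \<Longrightarrow> ptens y [a] = y a"
  by (simp add: tens_iota_right)

lemma ptens_unit: "is_unit_of P u \<Longrightarrow> nonneg ts \<Longrightarrow> ptens u ts = u (sum_list ts)"
  by (induction ts) (auto simp: unit_zero unit_tens sum_list_nonneg')

text \<open>\<open>tpow\<close> nests to the left and \<open>ptens\<close> to the right;
  associativity, in the form of \<open>ptens_append\<close>, reconciles them.\<close>

lemma tpow_eq_ptens:
  assumes y: "\<And>s. 0 \<le> s \<Longrightarrow> y s \<in> car s" and s: "0 \<le> s"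
  shows "tpow P s (y s) m = ptens y (replicate m s)"
proof (induction m)
  case (Suc m)
  have n: "nonneg (replicate m s)" using s by auto
  show ?case
  proof (cases "m = 0")
    case True
    then show ?thesis using ptens_singleton[of s y, OF s y[OF s]] by simp
  next
    case False
    have "ptens y (replicate (Suc m) s) = ptens y (replicate m s @ [s])"
      by (simp only: replicate_append_same replicate_Suc)
    also have "\<dots> = tens P (real m * s) s (ptens y (replicate m s)) (y s)"
      using ptens_append[OF y n, of "[s]"] s ptens_singleton[of s y, OF s y[OF s]]
      by (simp add: sum_list_replicate del: ptens.simps(2))
    finally show ?thesis using False Suc by simp
  qed
qed simp

section \<open>Refinements of partitions and the factorization of kernels along them\<close>

inductive refines :: "real list \<Rightarrow> real list \<Rightarrow> bool" where
  Nil: "refines [] []"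
| Cons: "nonneg us \<Longrightarrow> refines rs ts \<Longrightarrow> refines (us @ rs) (sum_list us # ts)"

lemma refines_nonneg: "refines rs ts \<Longrightarrow> nonneg rs \<and> nonneg ts \<and> sum_list rs = sum_list ts"
  by (induction rule: refines.induct) (auto simp: sum_list_nonneg')

lemma refines_refl: "nonneg ts \<Longrightarrow> refines ts ts"
proof (induction ts)
  case (Cons a ts)
  then show ?case using refines.Cons[of "[a]" ts ts] by simp
qed (rule refines.Nil)

lemma refines_mesh:
  assumes "refines rs ts" "set ts \<subseteq> {..d}"
  shows "set rs \<subseteq> {..d}"
  using assms
proof (induction rule: refines.induct)
  case (Cons us rs ts)
  have "u \<le> sum_list us" if "u \<in> set us" for u
    using that Cons(1) by (intro member_le_sum_list) auto
  then show ?case using Cons by fastforce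
qed simp

text \<open>The longer of the two leading cells is cut at the length of the shorter one; the
  remaining lists have one entry less in total.\<close>

lemma common_refinement:
  assumes "nonneg ts" "nonneg ss" "sum_list ts = sum_list ss"
  shows "\<exists>rs. refines rs ts \<and> refines rs ss"
  using assms
proof (induction "length ts + length ss" arbitrary: ts ss rule: less_induct)
  case less
  \<comment> \<open>This covers the case of one exhausted list: the other then has only cells of
    length zero, each of which is refined by no cell at all.\<close>
  have zero: "refines [] us" if "nonneg us" "sum_list us = 0" for us :: "real list"
    using that
  proof (induction us)
    case (Cons u us)
    then have "u = 0" "sum_list us = 0"
      using sum_list_nonneg'[of us] by auto
    then show ?case using Cons refines.Cons[of "[]" "[]" us] by simp
  qed (rule refines.Nil)
  have main: "\<exists>rs. refines rs (a # as) \<and> refines rs (b # bs)"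
    if le: "a \<le> b" and n: "nonneg (a # as)" "nonneg (b # bs)"
      and eq: "sum_list (a # as) = sum_list (b # bs)"
      and len: "length (a # as) + length (b # bs) \<le> length ts + length ss" for a b as bs
  proof -
    have "\<exists>rs. refines rs as \<and> refines rs ((b - a) # bs)"
      using n eq le len by (intro less(1)) auto
    then obtain rs where rs: "refines rs as" "refines rs ((b - a) # bs)" by blast
    from rs(2) obtain us qs where us: "rs = us @ qs" "sum_list us = b - a" "nonneg us" "refines qs bs"
      by (auto elim: refines.cases)
    have "refines ([a] @ rs) (sum_list [a] # as)"
      using rs n by (intro refines.Cons) auto
    moreover have "refines ((a # us) @ qs) (sum_list (a # us) # bs)"
      using us n by (intro refines.Cons) auto
    ultimately show ?thesis
      using us by (intro exI[of _ "a # rs"]) simp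
  qed
  show ?case
  proof (cases ts)
    case Nil
    then show ?thesis using zero[of ss] less(2-) refines.Nil by auto
  next
    case t: (Cons a as)
    show ?thesis
    proof (cases ss)
      case Nil
      then show ?thesis using zero[of ts] less(2-) refines.Nil by auto
    next
      case s: (Cons b bs)
      show ?thesis
      proof (cases "a \<le> b")
        case True
        then show ?thesis using main[of a b as bs] less(2-) by (simp add: t s)
      next
        case False
        then show ?thesis using main[of b a bs as] less(2-) by (auto simp: t s)
      qed
    qed
  qed
qed

text \<open>Grouping the fine list by the coarse cells, the kernel factors by
  \<open>kop_tens\<close>, in reverse order. Each entry of \<open>ks\<close> pairs a coarse cell
  with its kernel, and \<open>Q\<close> carries the estimate for one cell into the product.\<close>

lemma kop_refines:
  assumes y: "\<And>s. 0 \<le> s \<Longrightarrow> y s \<in> car s" and z: "\<And>s. 0 \<le> s \<Longrightarrow> z s \<in> car s"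
    and "refines rs ts"
    and est: "\<And>us. nonneg us \<Longrightarrow> sum_list us \<in> set ts \<Longrightarrow> Q (sum_list us) (kop (sum_list us) (y (sum_list us)) (ptens z us))"
  shows "\<exists>ks. map fst ks = ts \<and> (\<forall>(s, K)\<in>set ks. Q s K) \<and>
    kop (sum_list ts) (ptens y ts) (ptens z rs) = prod_list (map snd (rev ks))"
  using assms(3,4)
proof (induction rule: refines.induct)
  case Nil
  then show ?case by (simp add: kop_iota_one)
next
  case (Cons us rs ts)
  then obtain ks where ks: "map fst ks = ts" "\<forall>(s, K)\<in>set ks. Q s K"
      "kop (sum_list ts) (ptens y ts) (ptens z rs) = prod_list (map snd (rev ks))"
    by auto
  let ?s = "sum_list us"
  let ?K = "kop ?s (y ?s) (ptens z us)"
  have n: "nonneg rs" "nonneg ts" "sum_list rs = sum_list ts" "0 \<le> ?s" "0 \<le> sum_list ts"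
    using refines_nonneg[OF Cons(2)] Cons(1) by (auto simp: sum_list_nonneg')
  have app: "ptens z (us @ rs) = tens P ?s (sum_list rs) (ptens z us) (ptens z rs)"
    by (rule ptens_append) (use z Cons(1) n in auto)
  have "kop (?s + sum_list ts) (ptens y (?s # ts)) (ptens z (us @ rs))
      = kop (sum_list ts) (ptens y ts) (ptens z rs) * ?K"
    unfolding app
    using n ptens_car[OF y n(2)] ptens_car[OF z n(1)] ptens_car[OF z Cons(1)] y[OF n(4)]
    by (simp add: kop_tens)
  then show ?case
    using ks Cons.prems[OF Cons(1)] by (intro exI[of _ "(?s, ?K) # ks"]) auto
qed

end


subsection \<open>Germs and their limit units\<close>

context pointed_product_system
begin

definition tests :: "(real \<times> 'e) set \<Rightarrow> bool" where
  "tests T \<longleftrightarrow> (\<forall>(s, g)\<in>T. 0 \<le> s \<and> s \<le> 1 \<and> g \<in> car s)"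

text \<open>One constant serves all tests. The zeroth-order term A is left free so that summands can
  be treated separately; for \<omega> with coefficient -1, for example, it is -1.\<close>

definition expands :: "(real \<times> 'e) set \<Rightarrow> (real \<Rightarrow> 'e) \<Rightarrow> 'b bop \<Rightarrow> 'b bop \<Rightarrow> bool" where
  "expands T f A L \<longleftrightarrow> (\<exists>C\<ge>0. \<forall>(s, g)\<in>T. norm (kop s (f s) g - A - s *\<^sub>R L) \<le> C * s\<^sup>2)"

definition section_of :: "(real \<Rightarrow> 'e) \<Rightarrow> bool" where
  "section_of f \<longleftrightarrow> (\<forall>s\<ge>0. f s \<in> car s)"

lemma section_ofD: "section_of f \<Longrightarrow> 0 \<le> s \<Longrightarrow> f s \<in> car s"
  by (simp add: section_of_def)

lemma testsD: "tests T \<Longrightarrow> (s, g) \<in> T \<Longrightarrow> 0 \<le> s \<and> s \<le> 1 \<and> g \<in> car s"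
  by (auto simp: tests_def)

lemma expandsE:
  assumes "expands T f A L"
  obtains C where "C \<ge> 0" "\<And>s g. (s, g) \<in> T \<Longrightarrow> norm (kop s (f s) g - A - s *\<^sub>R L) \<le> C * s\<^sup>2"
  using assms by (auto simp: expands_def)

lemma expands_madd:
  assumes T: "tests T" and f: "section_of f" "section_of f'"
    and "expands T f A L" "expands T f' A' L'"
  shows "expands T (\<lambda>s. madd (fiber P s) (f s) (f' s)) (A + A') (L + L')"
proof -
  obtain C where C: "C \<ge> 0" "\<And>s g. (s, g) \<in> T \<Longrightarrow> norm (kop s (f s) g - A - s *\<^sub>R L) \<le> C * s\<^sup>2"
    using assms(4) by (rule expandsE) blast
  obtain C' where C': "C' \<ge> 0" "\<And>s g. (s, g) \<in> T \<Longrightarrow> norm (kop s (f' s) g - A' - s *\<^sub>R L') \<le> C' * s\<^sup>2"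
    using assms(5) by (rule expandsE) blast
  have "norm (kop s (madd (fiber P s) (f s) (f' s)) g - (A + A') - s *\<^sub>R (L + L')) \<le> (C + C') * s\<^sup>2"
    if sg: "(s, g) \<in> T" for s g
  proof -
    have "kop s (madd (fiber P s) (f s) (f' s)) g - (A + A') - s *\<^sub>R (L + L')
        = (kop s (f s) g - A - s *\<^sub>R L) + (kop s (f' s) g - A' - s *\<^sub>R L')"
      using testsD[OF T sg] f by (simp add: kop_madd_left section_ofD algebra_simps)
    also have "norm \<dots> \<le> C * s\<^sup>2 + C' * s\<^sup>2"
      by (intro norm_triangle_le add_mono C C' sg)
    finally show ?thesis by (simp add: algebra_simps)
  qed
  then show ?thesis
    unfolding expands_def using C(1) C'(1) by (intro exI[of _ "C + C'"]) auto
qed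

lemma expands_mzero: "tests T \<Longrightarrow> expands T (\<lambda>s. mzero (fiber P s)) 0 0"
  by (auto simp: expands_def tests_def kop_mzero_left intro!: exI[of _ 0])

lemma expands_lact:
  assumes T: "tests T" and f: "section_of f" and "expands T f A L"
  shows "expands T (\<lambda>s. lact (fiber P s) a (f s)) (A * lmul (star a)) (L * lmul (star a))"
proof -
  obtain C where C: "C \<ge> 0" "\<And>s g. (s, g) \<in> T \<Longrightarrow> norm (kop s (f s) g - A - s *\<^sub>R L) \<le> C * s\<^sup>2"
    using assms(3) by (rule expandsE) blast
  have "norm (kop s (lact (fiber P s) a (f s)) g - A * lmul (star a) - s *\<^sub>R (L * lmul (star a)))
      \<le> C * norm (lmul (star a)) * s\<^sup>2" if sg: "(s, g) \<in> T" for s g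
  proof -
    have "kop s (lact (fiber P s) a (f s)) g - A * lmul (star a) - s *\<^sub>R (L * lmul (star a))
        = (kop s (f s) g - A - s *\<^sub>R L) * lmul (star a)"
      using testsD[OF T sg] f by (simp add: kop_lact_left section_ofD algebra_simps)
    also have "norm \<dots> \<le> C * s\<^sup>2 * norm (lmul (star a))"
      by (intro order_trans[OF norm_mult_ineq] mult_right_mono C sg) simp
    finally show ?thesis by (simp add: mult_ac)
  qed
  then show ?thesis
    unfolding expands_def using C(1) by (intro exI[of _ "C * norm (lmul (star a))"]) auto
qed

text \<open>A product rule. The coefficient may depend on time because \<open>unit_exp\<close> uses
  \<open>exp (s \<beta>)\<close>.\<close>

lemma expands_ract:
  assumes T: "tests T" and f: "section_of f" and "expands T f A L"
    and D: "D \<ge> 0" "\<And>s. 0 \<le> s \<Longrightarrow> s \<le> 1 \<Longrightarrow> norm (c s - c0 - s *\<^sub>R c1) \<le> D * s\<^sup>2"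
  shows "expands T (\<lambda>s. ract (fiber P s) (f s) (c s)) (lmul (star c0) * A)
    (lmul (star c0) * L + lmul (star c1) * A)"
proof -
  obtain C where C: "C \<ge> 0" "\<And>s g. (s, g) \<in> T \<Longrightarrow> norm (kop s (f s) g - A - s *\<^sub>R L) \<le> C * s\<^sup>2"
    using assms(3) by (rule expandsE) blast
  define m where "m = norm L + C"
  have m: "m \<ge> 0" using C by (simp add: m_def)
  define C' where "C' = D * (norm A + m) + norm c0 * C + norm c1 * m"
  have "norm (kop s (ract (fiber P s) (f s) (c s)) g - lmul (star c0) * A
      - s *\<^sub>R (lmul (star c0) * L + lmul (star c1) * A)) \<le> C' * s\<^sup>2" if sg: "(s, g) \<in> T" for s g
  proof -
    define K where "K = kop s (f s) g"
    define d where "d = c s - c0 - s *\<^sub>R c1"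
    have s: "0 \<le> s" "s \<le> 1" "g \<in> car s" using testsD[OF T sg] by auto
    have K: "norm (K - A - s *\<^sub>R L) \<le> C * s\<^sup>2" unfolding K_def by (rule C sg)+
    have "K - A = s *\<^sub>R L + (K - A - s *\<^sub>R L)" by simp
    also have "norm \<dots> \<le> s * norm L + C * s\<^sup>2"
      using s by (intro norm_triangle_le add_mono K) simp
    also have "\<dots> \<le> s * norm L + C * s"
      using s C(1) by (intro add_left_mono mult_left_mono) (auto simp: power2_eq_square mult_left_le)
    finally have KA: "norm (K - A) \<le> s * m" by (simp add: m_def algebra_simps)
    have "norm K \<le> norm A + norm (K - A)"
      using norm_triangle_ineq[of A "K - A"] by simp
    also have "\<dots> \<le> norm A + m"
      using KA mult_right_mono[OF s(2) m] by simp
    finally have nK: "norm K \<le> norm A + m" .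
    have "kop s (ract (fiber P s) (f s) (c s)) g = lmul (star (c s)) * K"
      using s f by (simp add: kop_ract_left section_ofD K_def)
    moreover have ld: "lmul (star d) = lmul (star (c s)) - lmul (star c0) - s *\<^sub>R lmul (star c1)"
      by (simp only: d_def star_diff star_scaleR lmul_simps)
    \<comment> \<open>The three second-order errors: the remainder of the coefficient, the remainder
      of f, and the product of the first-order term of c with the deviation of K from A.\<close>
    ultimately have "kop s (ract (fiber P s) (f s) (c s)) g - lmul (star c0) * A
        - s *\<^sub>R (lmul (star c0) * L + lmul (star c1) * A)
        = lmul (star d) * K + lmul (star c0) * (K - A - s *\<^sub>R L) + s *\<^sub>R (lmul (star c1) * (K - A))"
      by (simp add: ld algebra_simps)
    also have "norm \<dots> \<le> (D * s\<^sup>2) * (norm A + m) + norm c0 * (C * s\<^sup>2) + s * (norm c1 * (s * m))"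
    proof (intro norm_triangle_le add_mono)
      have nl: "norm (lmul (star a)) \<le> norm a" for a :: 'b
        using norm_lmul[of "star a"] by simp
      have "norm d \<le> D * s\<^sup>2" unfolding d_def by (rule D s)+
      then have "norm (lmul (star d)) \<le> D * s\<^sup>2" using nl order_trans by blast
      then show "norm (lmul (star d) * K) \<le> (D * s\<^sup>2) * (norm A + m)"
        using nK D(1) by (intro order_trans[OF norm_mult_ineq] mult_mono) auto
      show "norm (lmul (star c0) * (K - A - s *\<^sub>R L)) \<le> norm c0 * (C * s\<^sup>2)"
        using nl K by (intro order_trans[OF norm_mult_ineq] mult_mono) auto
      have "norm (lmul (star c1) * (K - A)) \<le> norm c1 * (s * m)"
        using nl KA by (intro order_trans[OF norm_mult_ineq] mult_mono) auto
      then show "norm (s *\<^sub>R (lmul (star c1) * (K - A))) \<le> s * (norm c1 * (s * m))"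
        using s by (simp add: mult_left_mono)
    qed
    also have "\<dots> = C' * s\<^sup>2"
      by (simp add: C'_def power2_eq_square algebra_simps)
    finally show ?thesis .
  qed
  moreover have "C' \<ge> 0" using D(1) C(1) m by (simp add: C'_def)
  ultimately show ?thesis
    unfolding expands_def by (intro exI[of _ C']) auto
qed

lemma expands_ract_const:
  assumes "tests T" "section_of f" "expands T f A L"
  shows "expands T (\<lambda>s. ract (fiber P s) (f s) c) (lmul (star c) * A) (lmul (star c) * L)"
  using expands_ract[OF assms, of 0 "\<lambda>s. c" c 0] by (simp add: lmul_simps)

lemma section_intros:
  "section_of f \<Longrightarrow> section_of g \<Longrightarrow> section_of (\<lambda>s. madd (fiber P s) (f s) (g s))"
  "section_of f \<Longrightarrow> section_of (\<lambda>s. lact (fiber P s) a (f s))"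
  "section_of f \<Longrightarrow> section_of (\<lambda>s. ract (fiber P s) (f s) (c s))"
  "section_of (\<lambda>s. mzero (fiber P s))"
  "x \<in> \<U> \<Longrightarrow> section_of x"
  by (auto simp: section_of_def madd_car lact_car ract_car mzero_car U_car)

text \<open>Quantifying over all test sets makes it possible to test \<open>y\<close> first against units and then against
  tensor products of \<open>y\<close> itself along partitions.\<close>

definition germ :: "(real \<Rightarrow> 'e) \<Rightarrow> bool" where
  "germ y \<longleftrightarrow> section_of y \<and>
    (\<forall>T. tests T \<longrightarrow> (\<forall>x\<in>\<U>. \<exists>L. expands T x 1 L) \<longrightarrow> (\<exists>L. expands T y 1 L))"

definition graph :: "(real \<Rightarrow> 'e) \<Rightarrow> (real \<times> 'e) set" where
  "graph g = {(s, g s) | s. 0 \<le> s \<and> s \<le> 1}"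

lemma tests_graph: "section_of g \<Longrightarrow> tests (graph g)"
  by (auto simp: tests_def graph_def section_of_def)

lemma expands_units:
  assumes "x \<in> \<U>" "y \<in> \<U>"
  shows "expands (graph y) x 1 (gen x y)"
  unfolding expands_def
  using assms norm_exp_scaleR_minus_first_order[of _ "gen x y"]
  by (intro exI[of _ "(norm (gen x y))\<^sup>2 * exp (norm (gen x y))"]) (auto simp: graph_def kop_exp_gen)

lemma expands_swap:
  assumes x: "section_of x" and y: "section_of y" and "expands (graph y) x 1 L"
  shows "expands (graph x) y 1 (cconj L)"
proof -
  obtain C where C: "C \<ge> 0" "\<And>s. 0 \<le> s \<Longrightarrow> s \<le> 1 \<Longrightarrow> norm (kop s (x s) (y s) - 1 - s *\<^sub>R L) \<le> C * s\<^sup>2"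
    using assms(3) by (auto simp: expands_def graph_def)
  have "norm (kop s (y s) (x s) - 1 - s *\<^sub>R cconj L) \<le> C * s\<^sup>2" if s: "0 \<le> s" "s \<le> 1" for s
  proof -
    have "kop s (y s) (x s) - 1 - s *\<^sub>R cconj L = cconj (kop s (x s) (y s) - 1 - s *\<^sub>R L)"
      using kop_swap[of s "x s" "y s"] x y s by (simp add: section_ofD cconj_simps)
    then show ?thesis
      using norm_cconj[of "kop s (x s) (y s) - 1 - s *\<^sub>R L"] C(2)[OF s] by simp
  qed
  then show ?thesis
    using C(1) unfolding expands_def graph_def by (intro exI[of _ C]) auto
qed

text \<open>The constants of \<open>product_approx_exp\<close>, for a partition of \<open>t\<close> into cells of length at most \<open>d\<close>.\<close>

definition mesh_bound :: "real \<Rightarrow> 'b bop \<Rightarrow> real \<Rightarrow> real \<Rightarrow> real" where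
  "mesh_bound C L d t = (C + exp_remainder L) * d * t * exp ((norm L + C) * t)"

lemma kop_refines_approx:
  assumes y: "section_of y" and z: "section_of z" and r: "refines rs ts"
    and d: "set ts \<subseteq> {..d}" "d \<le> 1" and C: "C \<ge> 0"
    and est: "\<And>us. nonneg us \<Longrightarrow> sum_list us \<le> 1 \<Longrightarrow>
      norm (kop (sum_list us) (y (sum_list us)) (ptens z us) - 1 - sum_list us *\<^sub>R L) \<le> C * (sum_list us)\<^sup>2"
  shows "norm (kop (sum_list ts) (ptens y ts) (ptens z rs) - exp (sum_list ts *\<^sub>R L))
    \<le> mesh_bound C L d (sum_list ts)"
proof -
  let ?Q = "\<lambda>s K. 0 \<le> s \<and> s \<le> d \<and> norm (K - 1 - s *\<^sub>R L) \<le> C * s\<^sup>2"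
  have Q: "?Q (sum_list us) (kop (sum_list us) (y (sum_list us)) (ptens z us))"
    if "nonneg us" "sum_list us \<in> set ts" for us
    using est[OF that(1)] that d sum_list_nonneg'[OF that(1)] by fastforce
  obtain ks where ks: "map fst ks = ts" "\<forall>(s, K)\<in>set ks. ?Q s K"
    "kop (sum_list ts) (ptens y ts) (ptens z rs) = prod_list (map snd (rev ks))"
    using kop_refines[OF section_ofD[OF y] section_ofD[OF z] r, of ?Q] Q by blast
  show ?thesis
    using product_approx_exp[OF C d(2), of ks L] ks by (auto simp: mesh_bound_def)
qed

lemma mesh_bound_tendsto: "(\<lambda>n. mesh_bound C L (t / real n) t) \<longlonglongrightarrow> 0"
proof -
  have "(\<lambda>n. (C + exp_remainder L) * (t / real n) * t * exp ((norm L + C) * t))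
      \<longlonglongrightarrow> (C + exp_remainder L) * 0 * t * exp ((norm L + C) * t)"
    by (intro tendsto_intros lim_const_over_n)
  then show ?thesis by (simp add: mesh_bound_def)
qed

section \<open>Convergence of tensor products along partitions\<close>

lemma germ_expands_partitions:
  assumes "germ y"
  obtains C L where "C \<ge> 0" "\<And>us. nonneg us \<Longrightarrow> sum_list us \<le> 1 \<Longrightarrow>
      norm (kop (sum_list us) (y (sum_list us)) (ptens y us) - 1 - sum_list us *\<^sub>R L) \<le> C * (sum_list us)\<^sup>2"
proof -
  have y: "section_of y" using assms by (simp add: germ_def)
  define T where "T = {(sum_list us, ptens y us) | us. nonneg us \<and> sum_list us \<le> 1}"
  have T: "tests T"
    by (auto simp: tests_def T_def sum_list_nonneg' ptens_car section_ofD[OF y])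
  have "\<exists>L. expands T x 1 L" if x: "x \<in> \<U>" for x
  proof -
    have sx: "section_of x" using x by (rule section_intros)
    obtain L0 where "expands (graph x) y 1 L0"
      using assms expands_units x tests_graph[OF sx] unfolding germ_def by blast
    then have "expands (graph y) x 1 (cconj L0)"
      by (rule expands_swap[OF y sx])
    then obtain L C where C: "C \<ge> 0"
        "\<And>s. 0 \<le> s \<Longrightarrow> s \<le> 1 \<Longrightarrow> norm (kop s (x s) (y s) - 1 - s *\<^sub>R L) \<le> C * s\<^sup>2"
      by (auto simp: expands_def graph_def)
    \<comment> \<open>The error of the product estimate at total time at most 1, plus the remainder
      of the exponential itself.\<close>
    define B where "B = (C + exp_remainder L) * exp (norm L + C) + exp_remainder L"
    have B: "B \<ge> 0" using C(1) by (simp add: B_def exp_remainder_def)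
    have "norm (kop (sum_list us) (x (sum_list us)) (ptens y us) - 1 - sum_list us *\<^sub>R L) \<le> B * (sum_list us)\<^sup>2"
      if us: "nonneg us" "sum_list us \<le> 1" for us
    proof -
      let ?s = "sum_list us"
      have s0: "0 \<le> ?s" using us(1) by (rule sum_list_nonneg')
      have le: "0 \<le> u \<and> u \<le> ?s" if "u \<in> set us" for u
        using member_le_sum_list[of u us] that us(1) by auto
      define ks where "ks = map (\<lambda>u. (u, kop u (x u) (y u))) us"
      have "kop ?s (ptens x us) (ptens y us) = prod_list (map snd (rev ks))"
        using us(1) unfolding ks_def
        by (induction us) (auto simp: kop_iota_one kop_tens section_ofD[OF sx] section_ofD[OF y]
            ptens_car sum_list_nonneg')
      then have "kop ?s (x ?s) (ptens y us) = prod_list (map snd (rev ks))"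
        using ptens_unit[OF U_unit[OF x] us(1)] by simp
      moreover have "sum_list (map fst ks) = ?s"
        by (simp add: ks_def o_def)
      moreover have "0 \<le> u \<and> u \<le> ?s \<and> norm (K - 1 - u *\<^sub>R L) \<le> C * u\<^sup>2" if "(u, K) \<in> set ks" for u K
        using that le C(2) us(2) unfolding ks_def by fastforce
      \<comment> \<open>The whole length s serves as the mesh, so the factor \<open>d * t\<close>
        becomes \<open>s^2\<close>, uniformly in the partition.\<close>
      ultimately have "norm (kop ?s (x ?s) (ptens y us) - exp (?s *\<^sub>R L))
          \<le> (C + exp_remainder L) * ?s * ?s * exp ((norm L + C) * ?s)"
        using product_approx_exp[OF C(1) us(2), of ks L] by simp
      also have "\<dots> \<le> (C + exp_remainder L) * ?s * ?s * exp (norm L + C)"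
        using s0 us(2) C(1) by (intro mult_left_mono) (auto simp: exp_remainder_def mult_left_le)
      finally have 1: "norm (kop ?s (x ?s) (ptens y us) - exp (?s *\<^sub>R L)) \<le> \<dots>" .
      have "kop ?s (x ?s) (ptens y us) - 1 - ?s *\<^sub>R L
          = (kop ?s (x ?s) (ptens y us) - exp (?s *\<^sub>R L)) + (exp (?s *\<^sub>R L) - 1 - ?s *\<^sub>R L)"
        by simp
      also have "norm \<dots> \<le> (C + exp_remainder L) * ?s * ?s * exp (norm L + C) + exp_remainder L * ?s\<^sup>2"
        using norm_exp_scaleR_minus_first_order[OF s0 us(2), of L]
        by (intro norm_triangle_le add_mono 1) (simp add: exp_remainder_def)
      finally show ?thesis by (simp add: B_def power2_eq_square algebra_simps)
    qed
    then show ?thesis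
      using B unfolding expands_def T_def by (intro exI[of _ L] exI[of _ B]) auto
  qed
  then obtain L where "expands T y 1 L"
    using assms T unfolding germ_def by blast
  then obtain C where C: "C \<ge> 0" "\<And>s g. (s, g) \<in> T \<Longrightarrow> norm (kop s (y s) g - 1 - s *\<^sub>R L) \<le> C * s\<^sup>2"
    by (rule expandsE) blast
  show ?thesis
    by (rule that[OF C(1), of L]) (rule C(2), auto simp: T_def)
qed

text \<open>Write x for the coarse and z for the fine product. The kernels xx and xz are close to
  \<open>exp (t L)\<close>, while zz and zx are close to its \<open>cconj\<close>. Pairing them in
  this way cancels the main terms without knowing that L equals \<open>cconj L\<close>; four errors
  remain.\<close>

lemma germ_refines_close:
  assumes y: "section_of y" and C: "C \<ge> 0"
    and est: "\<And>us. nonneg us \<Longrightarrow> sum_list us \<le> 1 \<Longrightarrow>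
      norm (kop (sum_list us) (y (sum_list us)) (ptens y us) - 1 - sum_list us *\<^sub>R L) \<le> C * (sum_list us)\<^sup>2"
    and r: "refines rs ts" and d: "set ts \<subseteq> {..d}" "d \<le> 1"
  defines "t \<equiv> sum_list ts"
  shows "mnorm (fiber P t) (mdiff (fiber P t) (ptens y ts) (ptens y rs)) \<le> sqrt (4 * mesh_bound C L d t)"
proof -
  have n: "nonneg rs" "nonneg ts" "sum_list rs = t"
    using refines_nonneg[OF r] by (auto simp: t_def)
  have t: "0 \<le> t" using n(2) by (simp add: t_def sum_list_nonneg')
  let ?x = "ptens y ts" and ?z = "ptens y rs" and ?e = "exp (t *\<^sub>R L)" and ?B = "mesh_bound C L d t"
  have car: "?x \<in> car t" "?z \<in> car t"
    using ptens_car[OF section_ofD[OF y] n(2)] ptens_car[OF section_ofD[OF y] n(1)] n(3)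
    by (auto simp: t_def)
  have 1: "norm (kop t ?x ?x - ?e) \<le> ?B"
    unfolding t_def by (rule kop_refines_approx[OF y y refines_refl[OF n(2)] d C est])
  have 2: "norm (kop t ?x ?z - ?e) \<le> ?B"
    unfolding t_def by (rule kop_refines_approx[OF y y r d C est])
  have "norm (kop (sum_list rs) ?z ?z - exp (sum_list rs *\<^sub>R L)) \<le> mesh_bound C L d (sum_list rs)"
    by (rule kop_refines_approx[OF y y refines_refl[OF n(1)] refines_mesh[OF r d(1)] d(2) C est])
  then have 3: "norm (kop t ?z ?z - ?e) \<le> ?B"
    by (simp add: n(3))
  have "norm (cconj (kop t ?x ?z - ?e)) \<le> ?B" "norm (cconj (kop t ?z ?z - ?e)) \<le> ?B"
    using norm_cconj 2 3 order_trans by blast+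
  then have 4: "norm (kop t ?z ?x - cconj ?e) \<le> ?B" "norm (kop t ?z ?z - cconj ?e) \<le> ?B"
    using kop_swap[OF t car] kop_swap[OF t car(2) car(2)] by (simp_all add: cconj_simps)
  have "(mnorm (fiber P t) (mdiff (fiber P t) ?x ?z))\<^sup>2 \<le> norm (kop t ?x ?x - kop t ?x ?z - kop t ?z ?x + kop t ?z ?z)"
    by (rule mnorm_mdiff_le_kop[OF t car])
  also have "kop t ?x ?x - kop t ?x ?z - kop t ?z ?x + kop t ?z ?z
      = ((kop t ?x ?x - ?e) - (kop t ?x ?z - ?e)) + ((kop t ?z ?z - cconj ?e) - (kop t ?z ?x - cconj ?e))"
    by simp
  also have "norm \<dots> \<le> (?B + ?B) + (?B + ?B)"
    by (rule order_trans[OF norm_triangle_ineq add_mono[OF order_trans[OF norm_triangle_ineq4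
          add_mono[OF 1 2]] order_trans[OF norm_triangle_ineq4 add_mono[OF 4(2,1)]]]])
  finally show ?thesis by (intro real_le_rsqrt) simp
qed

text \<open>Everything about the limit is obtained from kernels: convergence from closeness along
  common refinements, multiplicativity from equality of four kernels, and the generators from
  passing to the limit in the products of cell kernels.\<close>

lemma unit_limit_in_U:
  assumes "germ y"
  shows "unit_limit P y \<in> \<U> \<and>
    (\<forall>\<xi>\<in>\<U>. \<forall>L. expands (graph \<xi>) y 1 L \<longrightarrow> gen (unit_limit P y) \<xi> = L)"
proof -
  have y: "section_of y" using assms by (simp add: germ_def)
  obtain C L where C: "C \<ge> 0" and est: "\<And>us. nonneg us \<Longrightarrow> sum_list us \<le> 1 \<Longrightarrow>
      norm (kop (sum_list us) (y (sum_list us)) (ptens y us) - 1 - sum_list us *\<^sub>R L) \<le> C * (sum_list us)\<^sup>2"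
    using germ_expands_partitions[OF assms] by blast
  \<comment> \<open>Twice the distance to a refinement, since two arbitrary partitions are compared
    through a common one.\<close>
  define B where "B d t = 2 * sqrt (4 * mesh_bound C L d t)" for d t
  have B0: "(\<lambda>n. B (t / real n) t) \<longlonglongrightarrow> 0" for t
  proof -
    have "(\<lambda>n. 2 * sqrt (4 * mesh_bound C L (t / real n) t)) \<longlonglongrightarrow> 2 * sqrt (4 * 0)"
      by (intro tendsto_intros mesh_bound_tendsto)
    then show ?thesis by (simp add: B_def)
  qed
  have close: "mnorm (fiber P t) (mdiff (fiber P t) (ptens y ts) (ptens y ss)) \<le> B d t"
    if n: "nonneg ts" "nonneg ss" and sums: "sum_list ts = t" "sum_list ss = t"
      and d: "set ts \<subseteq> {..d}" "set ss \<subseteq> {..d}" "d \<le> 1"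
    for ts ss t d
  proof -
    have t: "0 \<le> t" using n sums sum_list_nonneg' by blast
    interpret hilbert_bimodule "fiber P t" by (rule fiber_hilbert[OF t])
    obtain rs where rs: "refines rs ts" "refines rs ss"
      using common_refinement n sums by metis
    have car: "ptens y us \<in> car t" if "nonneg us" "sum_list us = t" for us
      using ptens_car[OF section_ofD[OF y] that(1)] that(2) by simp
    have c: "ptens y ts \<in> car t" "ptens y ss \<in> car t" "ptens y rs \<in> car t"
      using car[OF n(1) sums(1)] car[OF n(2) sums(2)] car[of rs] refines_nonneg[OF rs(1)] sums(1)
      by simp_all
    have "mnorm (fiber P t) (mdiff (fiber P t) (ptens y ts) (ptens y rs)) \<le> sqrt (4 * mesh_bound C L d t)"
      "mnorm (fiber P t) (mdiff (fiber P t) (ptens y ss) (ptens y rs)) \<le> sqrt (4 * mesh_bound C L d t)"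
      using germ_refines_close[OF y C est rs(1)] germ_refines_close[OF y C est rs(2)] sums d by auto
    then show ?thesis
      using mnorm_mdiff_triangle[OF c(1,3,2)] mnorm_mdiff_commute[OF c(3,2)] by (simp add: B_def)
  qed
  define X where "X t m = ptens y (replicate m (t / real m))" for t m
  have rep: "nonneg (replicate m (t / real m))" "set (replicate m (t / real m)) \<subseteq> {..t / real m}"
    if "0 \<le> t" for t and m :: nat
    using that by auto
  have rep_sum: "sum_list (replicate m (t / real m)) = t" if "0 < m" for t and m :: nat
    using that by (simp add: sum_list_replicate)
  have Xcar: "X t m \<in> car t" if "0 \<le> t" "0 < m" for t m
    using ptens_car[OF section_ofD[OF y] rep(1)[OF that(1), of m]] rep_sum[OF that(2), of t]
    by (simp add: X_def)
  have Xev: "\<forall>\<^sub>F m in sequentially. X t m \<in> car t" if "0 \<le> t" for t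
    using eventually_gt_at_top[of "0::nat"] by eventually_elim (rule Xcar[OF that])
  have "\<exists>l. mlim (fiber P t) (X t) l" if t: "0 \<le> t" for t
  proof -
    interpret hilbert_bimodule "fiber P t" by (rule fiber_hilbert[OF t])
    \<comment> \<open>The index is shifted because the empty product \<open>X t 0\<close> lies in
      the fiber at 0, whereas completeness asks for all terms in the fiber at t.\<close>
    have "mCauchy (fiber P t) (\<lambda>n. X t (Suc n))"
      unfolding mCauchy_def
    proof (intro allI impI)
      fix e :: real assume e: "e > 0"
      have "\<forall>\<^sub>F n in sequentially. B (t / real n) t < e"
        using order_tendstoD(2)[OF B0 e] .
      moreover have "\<forall>\<^sub>F n in sequentially. real n > t"
        by (rule eventually_gt_at_top[THEN filterlim_real_sequentially[unfolded filterlim_def le_filter_def, THEN spec, THEN mp, unfolded eventually_filtermap]])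
      ultimately have "\<forall>\<^sub>F n in sequentially. B (t / real n) t < e \<and> real n > t \<and> n > 0"
        using eventually_gt_at_top[of "0::nat"] by eventually_elim auto
      then obtain N where N: "B (t / real N) t < e" "real N > t" "N > 0"
        using eventually_happens' sequentially_bot by blast
      have "mnorm (fiber P t) (mdiff (fiber P t) (X t (Suc m)) (X t (Suc n))) < e" if "m \<ge> N" "n \<ge> N" for m n
      proof -
        have *: "set (replicate (Suc k) (t / real (Suc k))) \<subseteq> {..t / real N}" if "k \<ge> N" for k
          using that N t by (auto intro!: divide_left_mono)
        have "mnorm (fiber P t) (mdiff (fiber P t) (X t (Suc m)) (X t (Suc n))) \<le> B (t / real N) t"
          unfolding X_def
          by (rule close[OF rep(1)[OF t] rep(1)[OF t] rep_sum rep_sum *[OF that(1)] *[OF that(2)]])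
            (use N t in auto)
        then show ?thesis using N by simp
      qed
      then show "\<exists>N. \<forall>m\<ge>N. \<forall>n\<ge>N. mnorm (fiber P t) (mdiff (fiber P t) (X t (Suc m)) (X t (Suc n))) < e"
        by blast
    qed
    then obtain l where "mlim (fiber P t) (\<lambda>n. X t (Suc n)) l"
      using mcomplete[of "\<lambda>n. X t (Suc n)"] Xcar[OF t] by blast
    then have "mlim (fiber P t) (X t) l"
      unfolding mlim_def
      using filterlim_sequentially_Suc[of "\<lambda>n. mnorm (fiber P t) (mdiff (fiber P t) (X t n) l)" "nhds 0"] by simp
    then show ?thesis ..
  qed
  then obtain \<zeta>0 where z0: "\<And>t. 0 \<le> t \<Longrightarrow> mlim (fiber P t) (X t) (\<zeta>0 t)"
    by metis
  define \<zeta> where "\<zeta> = unit_limit P y"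
  have ul: "\<zeta> t = \<zeta>0 t" if t: "0 \<le> t" for t
  proof -
    have "tpow P (t / real m) (y (t / real m)) m = X t m" for m
      using t tpow_eq_ptens[OF section_ofD[OF y]] by (simp add: X_def)
    then show ?thesis
      using t hilbert_bimodule.mlim_the[OF fiber_hilbert[OF t] Xev[OF t] z0[OF t]]
      by (simp add: \<zeta>_def unit_limit_def)
  qed
  have lim: "mlim (fiber P t) (X t) (\<zeta> t)" if "0 \<le> t" for t
    using z0[OF that] ul[OF that] by simp
  have zc: "\<zeta> t \<in> car t" if "0 \<le> t" for t
    using lim[OF that] by (simp add: mlim_def)
  \<comment> \<open>Not only the uniform partitions converge: letting m grow in \<open>close\<close>
    shows that every fine partition gives an element near \<zeta>. This is needed for concatenated
    partitions below.\<close>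
  have near: "mnorm (fiber P t) (mdiff (fiber P t) (ptens y ts) (\<zeta> t)) \<le> B d t"
    if ts: "nonneg ts" "sum_list ts = t" "set ts \<subseteq> {..d}" "0 < d" "d \<le> 1" for ts t d
  proof -
    have t: "0 \<le> t" using ts sum_list_nonneg' by blast
    interpret hilbert_bimodule "fiber P t" by (rule fiber_hilbert[OF t])
    have car: "ptens y ts \<in> car t"
      using ptens_car[OF section_ofD[OF y] ts(1)] ts(2) by simp
    have "\<forall>\<^sub>F m in sequentially. t / real m < d"
      using order_tendstoD(2)[OF lim_const_over_n ts(4)] .
    then have lower: "\<forall>\<^sub>F m in sequentially. mnorm (fiber P t) (mdiff (fiber P t) (ptens y ts) (\<zeta> t))
        \<le> B d t + mnorm (fiber P t) (mdiff (fiber P t) (X t m) (\<zeta> t))"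
      using eventually_gt_at_top[of "0::nat"]
    proof eventually_elim
      case (elim m)
      have "mnorm (fiber P t) (mdiff (fiber P t) (ptens y ts) (X t m)) \<le> B d t"
        unfolding X_def using rep(2)[OF t, of m] elim
        by (intro close ts rep(1)[OF t] rep_sum) auto
      then show ?case
        using mnorm_mdiff_triangle[OF car Xcar[OF t elim(2)] zc[OF t]] by simp
    qed
    have "(\<lambda>m. B d t + mnorm (fiber P t) (mdiff (fiber P t) (X t m) (\<zeta> t))) \<longlonglongrightarrow> B d t + 0"
      using lim[OF t] by (intro tendsto_intros) (simp add: mlim_def)
    then have "mnorm (fiber P t) (mdiff (fiber P t) (ptens y ts) (\<zeta> t)) \<le> B d t + 0"
      using lower by (rule tendsto_lowerbound) simp
    then show ?thesis by simp
  qed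
  \<comment> \<open>The kernels of \<zeta> against \<open>X t m\<close> tend to the kernel of
    \<zeta> with itself, and also to \<open>exp (t L)\<close>, the limit of the kernels of
    \<open>X t m\<close> with itself.\<close>
  have kzz: "kop t (\<zeta> t) (\<zeta> t) = exp (t *\<^sub>R L)"
    and kzX: "(\<lambda>m. kop t (\<zeta> t) (X t m)) \<longlonglongrightarrow> exp (t *\<^sub>R L)" if t: "0 \<le> t" for t
  proof -
    interpret hilbert_bimodule "fiber P t" by (rule fiber_hilbert[OF t])
    have "\<forall>\<^sub>F m in sequentially. norm (kop t (X t m) (X t m) - exp (t *\<^sub>R L)) \<le> mesh_bound C L (t / real m) t"
      using order_tendstoD(2)[OF lim_const_over_n[of t] zero_less_one] eventually_gt_at_top[of "0::nat"]
    proof eventually_elim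
      case (elim m)
      show ?case
        using kop_refines_approx[OF y y refines_refl[OF rep(1)[OF t, of m]] rep(2)[OF t] _ C est] elim
          rep_sum[OF elim(2), of t]
        by (simp add: X_def)
    qed
    then have "(\<lambda>m. kop t (X t m) (X t m) - exp (t *\<^sub>R L)) \<longlonglongrightarrow> 0"
      by (rule Lim_null_comparison[OF _ mesh_bound_tendsto])
    then have XX: "(\<lambda>m. kop t (X t m) (X t m)) \<longlonglongrightarrow> exp (t *\<^sub>R L)"
      by (simp add: LIM_zero_iff)
    have zX: "(\<lambda>m. kop t (\<zeta> t) (X t m)) \<longlonglongrightarrow> kop t (\<zeta> t) (\<zeta> t)"
      by (rule kop_tendsto[OF t Xev[OF t] zc[OF t] lim[OF t]])
    have "\<forall>\<^sub>F m in sequentially. norm (kop t (X t m) (X t m) - kop t (\<zeta> t) (X t m))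
      \<le> mnorm (fiber P t) (mdiff (fiber P t) (X t m) (\<zeta> t))
        * (mnorm (fiber P t) (mdiff (fiber P t) (X t m) (\<zeta> t)) + mnorm (fiber P t) (\<zeta> t))"
      using Xev[OF t]
    proof eventually_elim
      case (elim m)
      have "norm (kop t (X t m) (X t m) - kop t (\<zeta> t) (X t m))
          \<le> mnorm (fiber P t) (mdiff (fiber P t) (X t m) (\<zeta> t)) * mnorm (fiber P t) (X t m)"
        using elim zc[OF t] t norm_kop[of t "mdiff (fiber P t) (X t m) (\<zeta> t)" "X t m"]
        by (simp add: kop_mdiff_left mdiff_closed)
      also have "\<dots> \<le> mnorm (fiber P t) (mdiff (fiber P t) (X t m) (\<zeta> t))
        * (mnorm (fiber P t) (mdiff (fiber P t) (X t m) (\<zeta> t)) + mnorm (fiber P t) (\<zeta> t))"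
        using elim zc[OF t] by (intro mult_left_mono mnorm_le_mdiff) auto
      finally show ?case .
    qed
    moreover have "(\<lambda>m. mnorm (fiber P t) (mdiff (fiber P t) (X t m) (\<zeta> t))
        * (mnorm (fiber P t) (mdiff (fiber P t) (X t m) (\<zeta> t)) + mnorm (fiber P t) (\<zeta> t)))
        \<longlonglongrightarrow> 0 * (0 + mnorm (fiber P t) (\<zeta> t))"
      using lim[OF t] by (intro tendsto_intros) (simp_all add: mlim_def)
    ultimately have "(\<lambda>m. kop t (X t m) (X t m) - kop t (\<zeta> t) (X t m)) \<longlonglongrightarrow> 0"
      unfolding mult_zero_left by (rule Lim_null_comparison)
    from tendsto_diff[OF XX this] show zX': "(\<lambda>m. kop t (\<zeta> t) (X t m)) \<longlonglongrightarrow> exp (t *\<^sub>R L)"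
      by simp
    show "kop t (\<zeta> t) (\<zeta> t) = exp (t *\<^sub>R L)"
      by (rule LIMSEQ_unique[OF zX zX'])
  qed
  have z_unit: "is_unit_of P \<zeta>"
    unfolding is_unit_of_def
  proof (intro conjI allI impI)
    show "\<zeta> \<in> (\<Pi>\<^sub>E t\<in>{0..}. car t)"
      using zc by (auto simp: \<zeta>_def unit_limit_def)
    \<comment> \<open>\<open>mesh_bound\<close> has the total time as a factor, so at time 0 the
      empty product coincides with the limit.\<close>
    have "mnorm (fiber P 0) (mdiff (fiber P 0) (iota P 1) (\<zeta> 0)) \<le> 0"
      using near[of "[]" 0 1] by (simp add: B_def mesh_bound_def)
    then show "\<zeta> 0 = iota P 1"
      using hilbert_bimodule.eq_of_mnorm_mdiff[OF fiber_hilbert, of 0 "iota P 1" "\<zeta> 0"]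
        hilbert_bimodule.mnorm_nonneg[OF fiber_hilbert, of 0] zc[of 0] iota_car
      by (metis order_antisym order_refl)
    fix t s :: real assume t: "0 \<le> t" and s: "0 \<le> s"
    have ts: "0 \<le> t + s" using t s by simp
    let ?a = "tens P t s (\<zeta> t) (\<zeta> s)"
    have ac: "?a \<in> car (t + s)" using t s by (intro tens_car zc)
    \<comment> \<open>A tensor product along the concatenation of two uniform partitions, hence
      close to \<open>\<zeta> (t + s)\<close>. The mesh \<open>(t + s + 1) / m\<close> used for it
      stays positive even for \<open>t = s = 0\<close>, as \<open>near\<close> requires.\<close>
    define Z where "Z m = tens P t s (X t m) (X s m)" for m
    have Zcar: "Z m \<in> car (t + s)" if "0 < m" for m
      unfolding Z_def using t s that by (intro tens_car Xcar)
    have Zev: "\<forall>\<^sub>F m in sequentially. Z m \<in> car (t + s)"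
      using eventually_gt_at_top[of "0::nat"] by eventually_elim (rule Zcar)
    have "\<forall>\<^sub>F m in sequentially. mnorm (fiber P (t + s)) (mdiff (fiber P (t + s)) (Z m) (\<zeta> (t + s)))
        \<le> B ((t + s + 1) / real m) (t + s)"
      using order_tendstoD(2)[OF lim_const_over_n[of "t + s + 1"] zero_less_one] eventually_gt_at_top[of "0::nat"]
    proof eventually_elim
      case (elim m)
      let ?ts = "replicate m (t / real m) @ replicate m (s / real m)"
      have "Z m = ptens y ?ts"
        using ptens_append[OF section_ofD[OF y] rep(1)[OF t] rep(1)[OF s], of m m] rep_sum[OF elim(2)]
        by (simp add: Z_def X_def)
      moreover have "set ?ts \<subseteq> {..(t + s + 1) / real m}"
        using t s elim by (auto simp: divide_right_mono)
      ultimately show ?case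
        using near[of ?ts "t + s" "(t + s + 1) / real m"] rep(1)[OF t, of m] rep(1)[OF s, of m] rep_sum[OF elim(2)]
          elim t s by simp
    qed
    moreover have "(\<lambda>m. B ((t + s + 1) / real m) (t + s)) \<longlonglongrightarrow> 0"
    proof -
      have "(\<lambda>m. 2 * sqrt (4 * ((C + exp_remainder L) * ((t + s + 1) / real m) * (t + s) * exp ((norm L + C) * (t + s)))))
        \<longlonglongrightarrow> 2 * sqrt (4 * ((C + exp_remainder L) * 0 * (t + s) * exp ((norm L + C) * (t + s))))"
        by (intro tendsto_intros lim_const_over_n)
      then show ?thesis by (simp add: B_def mesh_bound_def)
    qed
    ultimately have Zlim: "mlim (fiber P (t + s)) Z (\<zeta> (t + s))"
      by (intro hilbert_bimodule.mlim_iff_bound[OF fiber_hilbert] ts zc)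
    \<comment> \<open>The kernels of \<open>?a\<close> with \<open>Z m\<close> factor by
      \<open>kop_tens\<close>, so their limit is known. This identifies \<open>?a\<close> with
      \<open>\<zeta> (t + s)\<close> without continuity of the tensor product in norm.\<close>
    have aZ: "(\<lambda>m. kop (t + s) ?a (Z m)) \<longlonglongrightarrow> kop (t + s) ?a (\<zeta> (t + s))"
      by (rule kop_tendsto[OF ts Zev ac Zlim])
    have ev: "\<forall>\<^sub>F m in sequentially. kop s (\<zeta> s) (X s m) * kop t (\<zeta> t) (X t m) = kop (t + s) ?a (Z m)"
      using eventually_gt_at_top[of "0::nat"]
      by eventually_elim (use t s in \<open>simp add: Z_def kop_tens Xcar zc\<close>)
    have "(\<lambda>m. kop s (\<zeta> s) (X s m) * kop t (\<zeta> t) (X t m)) \<longlonglongrightarrow> exp (s *\<^sub>R L) * exp (t *\<^sub>R L)"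
      by (intro tendsto_mult kzX t s)
    then have "(\<lambda>m. kop (t + s) ?a (Z m)) \<longlonglongrightarrow> exp (s *\<^sub>R L) * exp (t *\<^sub>R L)"
      by (simp only: tendsto_cong[OF ev])
    then have "kop (t + s) ?a (\<zeta> (t + s)) = exp (s *\<^sub>R L) * exp (t *\<^sub>R L)"
      by (rule LIMSEQ_unique[OF aZ])
    moreover have e: "exp (s *\<^sub>R L) * exp (t *\<^sub>R L) = exp ((t + s) *\<^sub>R L)"
      by (subst add.commute) (rule exp_add_scaleR[symmetric])
    ultimately have 1: "kop (t + s) ?a (\<zeta> (t + s)) = exp ((t + s) *\<^sub>R L)"
      by simp
    have 2: "kop (t + s) ?a ?a = exp ((t + s) *\<^sub>R L)"
      using t s by (simp add: kop_tens zc kzz e)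
    have 3: "kop (t + s) (\<zeta> (t + s)) (\<zeta> (t + s)) = exp ((t + s) *\<^sub>R L)"
      by (rule kzz[OF ts])
    have 4: "kop (t + s) (\<zeta> (t + s)) ?a = exp ((t + s) *\<^sub>R L)"
      using kop_swap[OF ts ac zc[OF ts]] kop_swap[OF ts zc[OF ts] zc[OF ts]] 1 3 by simp
    show "?a = \<zeta> (t + s)"
      by (rule eq_of_kop_eq[OF ts ac zc[OF ts]]) (simp_all add: 1 2 3 4)
  qed
  \<comment> \<open>The unit \<xi> splits along every partition, so the expansion of y against \<xi>
    at short times determines the kernel of the limit.\<close>
  have kzx: "kop t (\<zeta> t) (\<xi> t) = exp (t *\<^sub>R M)"
    if x: "\<xi> \<in> \<U>" and M: "expands (graph \<xi>) y 1 M" and t: "0 \<le> t" for \<xi> M t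
  proof -
    have sx: "section_of \<xi>" by (rule section_intros(5)[OF x])
    have xc: "\<xi> t \<in> car t" by (rule section_ofD[OF sx t])
    obtain D where D: "D \<ge> 0" "\<And>s. 0 \<le> s \<Longrightarrow> s \<le> 1 \<Longrightarrow> norm (kop s (y s) (\<xi> s) - 1 - s *\<^sub>R M) \<le> D * s\<^sup>2"
      using M by (auto simp: expands_def graph_def)
    have est': "norm (kop (sum_list us) (y (sum_list us)) (ptens \<xi> us) - 1 - sum_list us *\<^sub>R M) \<le> D * (sum_list us)\<^sup>2"
      if "nonneg us" "sum_list us \<le> 1" for us
      using D(2)[of "sum_list us"] that by (simp add: ptens_unit[OF U_unit[OF x]] sum_list_nonneg')
    have "\<forall>\<^sub>F m in sequentially. norm (kop t (X t m) (\<xi> t) - exp (t *\<^sub>R M)) \<le> mesh_bound D M (t / real m) t"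
      using order_tendstoD(2)[OF lim_const_over_n[of t] zero_less_one] eventually_gt_at_top[of "0::nat"]
    proof eventually_elim
      case (elim m)
      show ?case
        using kop_refines_approx[OF y sx refines_refl[OF rep(1)[OF t, of m]] rep(2)[OF t] _ D(1) est'] elim
          rep_sum[OF elim(2), of t] ptens_unit[OF U_unit[OF x] rep(1)[OF t, of m]]
        by (simp add: X_def)
    qed
    then have "(\<lambda>m. kop t (X t m) (\<xi> t) - exp (t *\<^sub>R M)) \<longlonglongrightarrow> 0"
      by (rule Lim_null_comparison[OF _ mesh_bound_tendsto])
    moreover have "\<forall>\<^sub>F m in sequentially. norm (kop t (X t m) (\<xi> t) - kop t (\<zeta> t) (\<xi> t))
        \<le> mnorm (fiber P t) (mdiff (fiber P t) (X t m) (\<zeta> t)) * mnorm (fiber P t) (\<xi> t)"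
      using Xev[OF t]
      by eventually_elim (use t zc xc norm_kop in \<open>simp add: mdiff_car flip: kop_mdiff_left\<close>)
    then have "(\<lambda>m. kop t (X t m) (\<xi> t) - kop t (\<zeta> t) (\<xi> t)) \<longlonglongrightarrow> 0"
      by (rule Lim_null_comparison) (use lim[OF t] in \<open>auto simp: mlim_def intro: tendsto_mult_left_zero\<close>)
    ultimately show ?thesis
      by (metis LIMSEQ_unique LIM_zero_iff)
  qed
  have ex: "\<exists>M. expands (graph \<xi>) y 1 M" if "\<xi> \<in> \<U>" for \<xi>
    using assms that expands_units section_intros(5) tests_graph unfolding germ_def by blast
  have cont: "continuous_on {0..} (\<lambda>t. exp (t *\<^sub>R M))" for M :: "'b bop"
    unfolding continuous_on_eq_continuous_within
    by (auto intro: has_vector_derivative_continuous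
        has_vector_derivative_at_within[OF exp_scaleR_has_vector_derivative_right])
  have zU: "\<zeta> \<in> \<U>"
  proof (rule U_I[OF z_unit])
    show "continuous_on {0..} (\<lambda>t. kop t (\<zeta> t) (\<zeta> t))"
      by (rule continuous_on_eq[OF cont[of L]]) (simp add: kzz)
    obtain M where M: "expands (graph \<omega>) y 1 M"
      using ex[OF omega_in_U] ..
    show "continuous_on {0..} (\<lambda>t. kop t (\<zeta> t) (\<omega> t))"
      by (rule continuous_on_eq[OF cont[of M]]) (simp add: kzx[OF omega_in_U M])
  qed
  then show ?thesis
    using gen_eqI[OF zU] kzx unfolding \<zeta>_def by blast
qed

end


subsection \<open>The module of units\<close>

context pointed_product_system
begin

lemma germI:
  assumes "section_of y"
    and "\<And>T Lx. tests T \<Longrightarrow> (\<And>x. x \<in> \<U> \<Longrightarrow> expands T x 1 (Lx x)) \<Longrightarrow> expands T y 1 (F Lx)"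
  shows "germ y"
  unfolding germ_def using assms by metis

text \<open>\<open>F\<close> expresses the first-order coefficient of y through those of the units.
  Since the same \<open>F\<close> serves all test sets, it may be evaluated on
  \<open>graph \<xi>\<close>, where the coefficient of x is \<open>gen x \<xi>\<close>.\<close>

lemma unit_limit_gen:
  assumes y: "section_of y"
    and exp: "\<And>T Lx. tests T \<Longrightarrow> (\<And>x. x \<in> \<U> \<Longrightarrow> expands T x 1 (Lx x)) \<Longrightarrow> expands T y 1 (F Lx)"
  shows "unit_limit P y \<in> \<U>"
    and "\<xi> \<in> \<U> \<Longrightarrow> gen (unit_limit P y) \<xi> = F (\<lambda>x. gen x \<xi>)"
proof -
  have germ: "germ y"
    using assms by (rule germI)
  then show "unit_limit P y \<in> \<U>"
    using unit_limit_in_U by blast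
  assume xi: "\<xi> \<in> \<U>"
  have "expands (graph \<xi>) y 1 (F (\<lambda>x. gen x \<xi>))"
    by (rule exp[OF tests_graph[OF section_intros(5)[OF xi]]]) (rule expands_units[OF _ xi])
  then show "gen (unit_limit P y) \<xi> = F (\<lambda>x. gen x \<xi>)"
    using unit_limit_in_U[OF germ] xi by blast
qed

section \<open>Generators of the operations on units\<close>

abbreviation uadd :: "(real \<Rightarrow> 'e) \<Rightarrow> (real \<Rightarrow> 'e) \<Rightarrow> real \<Rightarrow> 'e" where
  "uadd \<equiv> madd (U_bimod P \<omega>)"

abbreviation ulact :: "'b \<Rightarrow> (real \<Rightarrow> 'e) \<Rightarrow> real \<Rightarrow> 'e" where
  "ulact \<equiv> lact (U_bimod P \<omega>)"

abbreviation uract :: "(real \<Rightarrow> 'e) \<Rightarrow> 'b \<Rightarrow> real \<Rightarrow> 'e" where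
  "uract \<equiv> ract (U_bimod P \<omega>)"

lemma uadd_gen:
  assumes x: "x \<in> \<U>" and y: "y \<in> \<U>"
  shows "uadd x y \<in> \<U>"
    and "\<xi> \<in> \<U> \<Longrightarrow> gen (uadd x y) \<xi> = gen x \<xi> + gen y \<xi> - gen \<omega> \<xi>"
proof -
  define f where "f = (\<lambda>s. msum (fiber P s) (map (\<lambda>(k, x). lact (fiber P s) k (x s)) [(1, x), (1, y), (- 1, \<omega>)]))"
  have f: "f = (\<lambda>s. madd (fiber P s) (lact (fiber P s) 1 (x s)) (madd (fiber P s) (lact (fiber P s) 1 (y s))
      (madd (fiber P s) (lact (fiber P s) (- 1) (\<omega> s)) (mzero (fiber P s)))))"
    by (simp add: f_def msum_def)
  have eq: "uadd x y = unit_limit P f"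
    by (simp add: U_bimod_def boxplus_left_def f_def)
  have s: "section_of f"
    unfolding f by (intro section_intros x y omega_in_U)
  have e: "expands T f 1 (Lx x + Lx y - Lx \<omega>)"
    if T: "tests T" and L: "\<And>x. x \<in> \<U> \<Longrightarrow> expands T x 1 (Lx x)" for T Lx
  proof -
    \<comment> \<open>The zeroth-order terms are 1, 1 and -1. That the coefficients of a boxplus sum
      to 1 makes the total 1, as \<open>germ\<close> demands.\<close>
    have "expands T f (1 * lmul (star 1) + (1 * lmul (star 1) + (1 * lmul (star (- 1)) + 0)))
        (Lx x * lmul (star 1) + (Lx y * lmul (star 1) + (Lx \<omega> * lmul (star (- 1)) + 0)))"
      unfolding f
      by (intro expands_madd expands_lact expands_mzero section_intros T L x y omega_in_U)
    then show ?thesis by (simp add: star_minus lmul_simps add_diff_eq)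
  qed
  show "uadd x y \<in> \<U>" "\<xi> \<in> \<U> \<Longrightarrow> gen (uadd x y) \<xi> = gen x \<xi> + gen y \<xi> - gen \<omega> \<xi>"
    unfolding eq using unit_limit_gen[of f "\<lambda>Lx. Lx x + Lx y - Lx \<omega>"] s e by blast+
qed

text \<open>A left coefficient moves across the inner product onto the argument of the kernel and so
  acts by composition on the right; in \<open>uract_gen\<close> it multiplies the value
  instead.\<close>

lemma ulact_gen:
  assumes x: "x \<in> \<U>"
  shows "ulact a x \<in> \<U>"
    and "\<xi> \<in> \<U> \<Longrightarrow> gen (ulact a x) \<xi> = gen x \<xi> * lmul (star a) + gen \<omega> \<xi> * (1 - lmul (star a))"
proof -
  define f where "f = (\<lambda>s. msum (fiber P s) (map (\<lambda>(k, x). lact (fiber P s) k (x s)) [(a, x), (1 - a, \<omega>)]))"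
  have f: "f = (\<lambda>s. madd (fiber P s) (lact (fiber P s) a (x s))
      (madd (fiber P s) (lact (fiber P s) (1 - a) (\<omega> s)) (mzero (fiber P s))))"
    by (simp add: f_def msum_def)
  have eq: "ulact a x = unit_limit P f"
    by (simp add: U_bimod_def boxplus_left_def f_def)
  have s: "section_of f"
    unfolding f by (intro section_intros x omega_in_U)
  have e: "expands T f 1 (Lx x * lmul (star a) + Lx \<omega> * (1 - lmul (star a)))"
    if T: "tests T" and L: "\<And>x. x \<in> \<U> \<Longrightarrow> expands T x 1 (Lx x)" for T Lx
  proof -
    have "expands T f (1 * lmul (star a) + (1 * lmul (star (1 - a)) + 0))
        (Lx x * lmul (star a) + (Lx \<omega> * lmul (star (1 - a)) + 0))"
      unfolding f
      by (intro expands_madd expands_lact expands_mzero section_intros T L x omega_in_U)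
    then show ?thesis by (simp add: star_diff lmul_simps)
  qed
  show "ulact a x \<in> \<U>"
    "\<xi> \<in> \<U> \<Longrightarrow> gen (ulact a x) \<xi> = gen x \<xi> * lmul (star a) + gen \<omega> \<xi> * (1 - lmul (star a))"
    unfolding eq
    using unit_limit_gen[of f "\<lambda>Lx. Lx x * lmul (star a) + Lx \<omega> * (1 - lmul (star a))"] s e by blast+
qed

lemma uract_gen:
  assumes x: "x \<in> \<U>"
  shows "uract x a \<in> \<U>"
    and "\<xi> \<in> \<U> \<Longrightarrow> gen (uract x a) \<xi> = lmul (star a) * gen x \<xi> + (1 - lmul (star a)) * gen \<omega> \<xi>"
proof -
  define f where "f = (\<lambda>s. msum (fiber P s) (map (\<lambda>(x, k). ract (fiber P s) (x s) k) [(x, a), (\<omega>, 1 - a)]))"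
  have f: "f = (\<lambda>s. madd (fiber P s) (ract (fiber P s) (x s) a)
      (madd (fiber P s) (ract (fiber P s) (\<omega> s) (1 - a)) (mzero (fiber P s))))"
    by (simp add: f_def msum_def)
  have eq: "uract x a = unit_limit P f"
    by (simp add: U_bimod_def boxplus_right_def f_def)
  have s: "section_of f"
    unfolding f by (intro section_intros x omega_in_U)
  have e: "expands T f 1 (lmul (star a) * Lx x + (1 - lmul (star a)) * Lx \<omega>)"
    if T: "tests T" and L: "\<And>x. x \<in> \<U> \<Longrightarrow> expands T x 1 (Lx x)" for T Lx
  proof -
    have "expands T f (lmul (star a) * 1 + (lmul (star (1 - a)) * 1 + 0))
        (lmul (star a) * Lx x + (lmul (star (1 - a)) * Lx \<omega> + 0))"
      unfolding f
      by (intro expands_madd expands_ract_const expands_mzero section_intros T L x omega_in_U)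
    then show ?thesis by (simp add: star_diff lmul_simps)
  qed
  show "uract x a \<in> \<U>"
    "\<xi> \<in> \<U> \<Longrightarrow> gen (uract x a) \<xi> = lmul (star a) * gen x \<xi> + (1 - lmul (star a)) * gen \<omega> \<xi>"
    unfolding eq
    using unit_limit_gen[of f "\<lambda>Lx. lmul (star a) * Lx x + (1 - lmul (star a)) * Lx \<omega>"] s e by blast+
qed

text \<open>The generator is shifted by an operator that does not depend on \<xi>, which turns the
  relation on units into equality modulo such shifts.\<close>

lemma unit_exp_gen:
  assumes x: "x \<in> \<U>"
  shows "unit_exp P x \<beta> \<in> \<U>"
    and "\<xi> \<in> \<U> \<Longrightarrow> gen (unit_exp P x \<beta>) \<xi> = gen x \<xi> + lmul (star \<beta>)"
proof -
  define f where "f = (\<lambda>s. ract (fiber P s) (x s) (exp (s *\<^sub>R \<beta>)))"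
  have eq: "unit_exp P x \<beta> = unit_limit P f"
    by (simp add: unit_exp_def f_def)
  have s: "section_of f"
    unfolding f_def by (intro section_intros x)
  have e: "expands T f 1 (Lx x + lmul (star \<beta>))"
    if T: "tests T" and L: "\<And>x. x \<in> \<U> \<Longrightarrow> expands T x 1 (Lx x)" for T Lx
  proof -
    have "expands T f (lmul (star 1) * 1) (lmul (star 1) * Lx x + lmul (star \<beta>) * 1)"
      unfolding f_def using norm_exp_scaleR_minus_first_order[of _ \<beta>]
      by (intro expands_ract[where D = "(norm \<beta>)\<^sup>2 * exp (norm \<beta>)"] section_intros T L x) auto
    then show ?thesis by (simp add: lmul_simps)
  qed
  show "unit_exp P x \<beta> \<in> \<U>" "\<xi> \<in> \<U> \<Longrightarrow> gen (unit_exp P x \<beta>) \<xi> = gen x \<xi> + lmul (star \<beta>)"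
    unfolding eq using unit_limit_gen[of f "\<lambda>Lx. Lx x + lmul (star \<beta>)"] s e by blast+
qed

text \<open>Complex homogeneity of the kernel, which the real-linear type \<open>bop\<close> does
  not express. It comes from the agreement of left and right scalars and is needed for the same
  axiom in \<U>.\<close>

lemma kop_lmul_scalar:
  assumes "0 \<le> t" "f \<in> car t" "g \<in> car t"
  shows "kop t f g * lmul (c *\<^sub>C 1) = lmul (c *\<^sub>C 1) * kop t f g"
proof -
  have *: "star (cnj c *\<^sub>C 1 :: 'b) = c *\<^sub>C 1"
    by (simp add: star_scaleC)
  have "kop t f g * lmul (c *\<^sub>C 1) = kop t (lact (fiber P t) (cnj c *\<^sub>C 1) f) g"
    using assms by (simp add: kop_lact_left *)
  also have "\<dots> = kop t (ract (fiber P t) f (cnj c *\<^sub>C 1)) g"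
    using assms by (simp add: bimodule.lact_scalar[OF bimodule_fiber])
  also have "\<dots> = lmul (c *\<^sub>C 1) * kop t f g"
    using assms by (simp add: kop_ract_left *)
  finally show ?thesis .
qed

text \<open>Commutation holds for all kernels \<open>exp (t gen)\<close> and passes to the generator
  by one-sided differentiation at 0.\<close>

lemma gen_lmul_scalar:
  assumes "x \<in> \<U>" "y \<in> \<U>"
  shows "gen x y * lmul (c *\<^sub>C 1) = lmul (c *\<^sub>C 1) * gen x y"
proof -
  let ?S = "lmul (c *\<^sub>C 1 :: 'b)"
  have "((\<lambda>t. exp (t *\<^sub>R gen x y)) has_vector_derivative exp (0 *\<^sub>R gen x y) * gen x y) (at 0 within {0..})"
    by (rule exp_scaleR_has_vector_derivative_right)
  then have d: "((\<lambda>t. exp (t *\<^sub>R gen x y)) has_vector_derivative gen x y) (at 0 within {0..})"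
    by simp
  have 1: "((\<lambda>t. exp (t *\<^sub>R gen x y) * ?S) has_vector_derivative gen x y * ?S) (at 0 within {0..})"
    "((\<lambda>t. ?S * exp (t *\<^sub>R gen x y)) has_vector_derivative ?S * gen x y) (at 0 within {0..})"
    by (rule bounded_linear.has_vector_derivative[OF bounded_linear_mult_left d]
        bounded_linear.has_vector_derivative[OF bounded_linear_mult_right d])+
  have "exp (t *\<^sub>R gen x y) * ?S = ?S * exp (t *\<^sub>R gen x y)" if "t \<in> {0..}" for t
    using kop_lmul_scalar[of t "x t" "y t" c] assms that by (simp add: U_car kop_exp_gen)
  then have "((\<lambda>t. exp (t *\<^sub>R gen x y) * ?S) has_vector_derivative ?S * gen x y) (at 0 within {0..})"
    by (intro has_vector_derivative_transform[OF _ _ 1(2)]) auto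
  then show ?thesis
    using 1(1) vector_derivative_unique_within[of 0 "{0..}"]
    by (metis at_within_Ici_at_right trivial_limit_at_right_real)
qed

lemma bimodule_U: "bimodule (U_bimod P \<omega>)"
proof -
  have car: "mcarrier (U_bimod P \<omega>) = \<U>" and zero: "mzero (U_bimod P \<omega>) = \<omega>"
    by (simp_all add: U_bimod_def)
  note gens = uadd_gen ulact_gen uract_gen omega_in_U
  show ?thesis
  proof (unfold_locales, unfold car zero)
    fix x assume x: "x \<in> \<U>"
    show "\<exists>y\<in>\<U>. uadd x y = \<omega>"
      \<comment> \<open>The generator of \<open>(-1) x\<close> is
        \<open>2 gen \<omega> - gen x\<close>, the reflection of \<open>gen x\<close> at the neutral
        element.\<close>
      by (intro bexI[of _ "ulact (- 1) x"] U_eqI)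
        (simp_all add: gens x star_minus lmul_simps algebra_simps mult_2_right)
    fix a b :: 'b and c :: complex
    show "ulact (c *\<^sub>C 1) x = uract x (c *\<^sub>C 1)"
    proof (rule U_eqI)
      fix \<xi> assume "\<xi> \<in> \<U>"
      \<comment> \<open>The conjugate appears because coefficients enter generators through
        \<open>star\<close>.\<close>
      then show "gen (ulact (c *\<^sub>C 1) x) \<xi> = gen (uract x (c *\<^sub>C 1)) \<xi>"
        using gen_lmul_scalar[of x \<xi> "cnj c"] gen_lmul_scalar[of \<omega> \<xi> "cnj c"]
        by (simp add: gens x star_scaleC algebra_simps)
    qed (simp_all add: gens x)
  qed (rule U_eqI; simp add: gens star_add star_mult lmul_simps algebra_simps | simp add: gens)+
qed

section \<open>The equivalence relation in terms of generators\<close>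

lemma U_equiv_iff: "(x, y) \<in> U_equiv P \<omega> \<longleftrightarrow> x \<in> \<U> \<and> y \<in> \<U> \<and>
  (\<exists>\<beta>. \<forall>\<xi>\<in>\<U>. gen x \<xi> = gen y \<xi> + lmul (star \<beta>))"
proof (cases "x \<in> \<U> \<and> y \<in> \<U>")
  case True
  then have "x = unit_exp P y \<beta> \<longleftrightarrow> (\<forall>\<xi>\<in>\<U>. gen x \<xi> = gen y \<xi> + lmul (star \<beta>))" for \<beta>
    by (metis U_eqI unit_exp_gen)
  then show ?thesis using True by (auto simp: U_equiv_def)
qed (auto simp: U_equiv_def)

lemma U_equivI:
  "\<lbrakk>x \<in> \<U>; y \<in> \<U>; \<And>\<xi>. \<xi> \<in> \<U> \<Longrightarrow> gen x \<xi> = gen y \<xi> + lmul (star \<beta>)\<rbrakk> \<Longrightarrow> (x, y) \<in> U_equiv P \<omega>"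
  unfolding U_equiv_iff by blast

lemma U_equivE:
  assumes "(x, y) \<in> U_equiv P \<omega>"
  obtains \<beta> where "x \<in> \<U>" "y \<in> \<U>" "\<And>\<xi>. \<xi> \<in> \<U> \<Longrightarrow> gen x \<xi> = gen y \<xi> + lmul (star \<beta>)"
  using assms unfolding U_equiv_iff by blast

lemma equiv_U: "equiv \<U> (U_equiv P \<omega>)"
proof (rule equivI)
  show "U_equiv P \<omega> \<subseteq> \<U> \<times> \<U>"
    by (auto simp: U_equiv_def)
  show "refl_on \<U> (U_equiv P \<omega>)"
    by (rule refl_onI) (rule U_equivI[of _ _ 0]; simp add: lmul_simps)
  show "sym (U_equiv P \<omega>)"
  proof (rule symI)
    fix x y assume "(x, y) \<in> U_equiv P \<omega>"
    then show "(y, x) \<in> U_equiv P \<omega>"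
    proof (rule U_equivE)
      fix \<beta> assume "x \<in> \<U>" "y \<in> \<U>" "\<And>\<xi>. \<xi> \<in> \<U> \<Longrightarrow> gen x \<xi> = gen y \<xi> + lmul (star \<beta>)"
      then show ?thesis
        by (intro U_equivI[of _ _ "- \<beta>"]) (simp_all add: star_minus lmul_simps)
    qed
  qed
  show "trans (U_equiv P \<omega>)"
  proof (rule transI)
    fix x y z assume xy: "(x, y) \<in> U_equiv P \<omega>" and yz: "(y, z) \<in> U_equiv P \<omega>"
    obtain \<beta> where "x \<in> \<U>" "\<And>\<xi>. \<xi> \<in> \<U> \<Longrightarrow> gen x \<xi> = gen y \<xi> + lmul (star \<beta>)"
      using xy by (rule U_equivE) blast
    moreover obtain \<gamma> where "z \<in> \<U>" "\<And>\<xi>. \<xi> \<in> \<U> \<Longrightarrow> gen y \<xi> = gen z \<xi> + lmul (star \<gamma>)"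
      using yz by (rule U_equivE) blast
    ultimately show "(x, z) \<in> U_equiv P \<omega>"
      by (intro U_equivI[of _ _ "\<beta> + \<gamma>"]) (simp_all add: star_add lmul_simps algebra_simps)
  qed
qed

lemma U_equiv_uract:
  assumes "(x, y) \<in> U_equiv P \<omega>"
  shows "(uract x b, uract y b) \<in> U_equiv P \<omega>"
proof -
  obtain \<beta> where "x \<in> \<U>" "y \<in> \<U>" "\<And>\<xi>. \<xi> \<in> \<U> \<Longrightarrow> gen x \<xi> = gen y \<xi> + lmul (star \<beta>)"
    using assms by (rule U_equivE) blast
  then show ?thesis
    \<comment> \<open>The shift is multiplied on the left by \<open>lmul (star b)\<close>, and
      \<open>star b * star \<beta>\<close> is the star of \<open>\<beta> * b\<close>.\<close>
    by (intro U_equivI[of _ _ "\<beta> * b"]) (simp_all add: uract_gen star_mult lmul_simps algebra_simps)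
qed

lemma U_equiv_ulact:
  assumes "(x, y) \<in> U_equiv P \<omega>"
  shows "(ulact b x, ulact b y) \<in> U_equiv P \<omega>"
proof -
  obtain \<beta> where "x \<in> \<U>" "y \<in> \<U>" "\<And>\<xi>. \<xi> \<in> \<U> \<Longrightarrow> gen x \<xi> = gen y \<xi> + lmul (star \<beta>)"
    using assms by (rule U_equivE) blast
  then show ?thesis
    by (intro U_equivI[of _ _ "b * \<beta>"]) (simp_all add: ulact_gen star_mult lmul_simps algebra_simps)
qed

lemma U_equiv_uadd:
  assumes "(x1, x2) \<in> U_equiv P \<omega>" "(y1, y2) \<in> U_equiv P \<omega>"
  shows "(uadd x1 y1, uadd x2 y2) \<in> U_equiv P \<omega>"
proof -
  obtain \<beta> where "x1 \<in> \<U>" "x2 \<in> \<U>" "\<And>\<xi>. \<xi> \<in> \<U> \<Longrightarrow> gen x1 \<xi> = gen x2 \<xi> + lmul (star \<beta>)"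
    using assms(1) by (rule U_equivE) blast
  moreover obtain \<gamma> where "y1 \<in> \<U>" "y2 \<in> \<U>" "\<And>\<xi>. \<xi> \<in> \<U> \<Longrightarrow> gen y1 \<xi> = gen y2 \<xi> + lmul (star \<gamma>)"
    using assms(2) by (rule U_equivE) blast
  ultimately show ?thesis
    by (intro U_equivI[of _ _ "\<beta> + \<gamma>"]) (simp_all add: uadd_gen star_add lmul_simps algebra_simps)
qed

end

theorem theorem3p2:
  fixes P :: "('b::cstar_algebra, 'e) prod_sys" and \<omega> :: "real \<Rightarrow> 'e"
  assumes "product_system P" and "continuous_unit P \<omega>"
  shows "bimodule (U_bimod P \<omega>) \<and>
    equiv (U_set P \<omega>) (U_equiv P \<omega>) \<and>
    (\<forall>(b::'b) x y. (x, y) \<in> U_equiv P \<omega> \<longrightarrow>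
      (ract (U_bimod P \<omega>) x b, ract (U_bimod P \<omega>) y b) \<in> U_equiv P \<omega> \<and>
      (lact (U_bimod P \<omega>) b x, lact (U_bimod P \<omega>) b y) \<in> U_equiv P \<omega>) \<and>
    (\<forall>x1 x2 y1 y2. (x1, x2) \<in> U_equiv P \<omega> \<longrightarrow> (y1, y2) \<in> U_equiv P \<omega> \<longrightarrow>
      (madd (U_bimod P \<omega>) x1 y1, madd (U_bimod P \<omega>) x2 y2) \<in> U_equiv P \<omega>)"
proof -
  interpret pointed_product_system P \<omega>
    using assms by (intro pointed_product_system.intro pointed_product_system_axioms.intro)
  show ?thesis
    using bimodule_U equiv_U U_equiv_uract U_equiv_ulact U_equiv_uadd by blast
qed

end
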